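(* Let $\mathcal{E}$ be a deflation-exact category with admissible kernels. There is a hereditary torsion pair $(\operatorname{eff}(\mathcal{E}),\operatorname{mod}^1(\mathcal{E}))$ on the abelian category $\operatorname{mod}(\mathcal{E})$.
   Context: All categories are essentially small and additive, all functors are additive. A \emph{conflation category} is an additive category with a chosen class, closed under isomorphisms, of kernel-cokernel pairs called \emph{conflations}; the kernel part of a conflation is an \emph{inflation}, the cokernel part a \emph{deflation}. It is \emph{deflation-exact} if (R0) every map $X\to 0$ is a deflation, (R1) compositions of deflations are deflations, (R2) pullbacks of deflations along arbitrary morphisms exist and are deflations. It \emph{has admissible kernels} if every morphism has a kernel and every kernel is an inflation. $\operatorname{Mod}(\mathcal{E})$ is the category of contravariant additive functors $\mathcal{E}\to\mathbf{Ab}$, $\mathbb{Y}\colon\mathcal{E}\to\operatorname{Mod}(\mathcal{E})$, $E\mapsto\operatorname{Hom}(-,E)$, is the Yoneda functor, and $\operatorname{mod}(\mathcal{E})\subseteq\operatorname{Mod}(\mathcal{E})$ is the full subcategory of finitely presented functors, i.e. those isomorphic to $\operatorname{coker}\mathbb{Y}(f)$ for a morphism $f$ in $\mathcal{E}$; it is abelian as $\mathcal{E}$ has kernels. $\operatorname{mod}^1(\mathcal{E})$ is the full subcategory of $\operatorname{mod}(\mathcal{E})$ of objects of projective dimension at most one. $\operatorname{eff}(\mathcal{E})$ is the full subcategory of $\operatorname{mod}(\mathcal{E})$ of \emph{effaceable} functors, i.e. those isomorphic to $\operatorname{coker}\mathbb{Y}(f)$ for a deflation $f$ in $\mathcal{E}$.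 A \emph{torsion pair} $(\mathcal{T},\mathcal{F})$ in an abelian category is a pair of full replete subcategories with $\operatorname{Hom}(T,F)=0$ for all $T\in\mathcal{T}$, $F\in\mathcal{F}$, such that every object $M$ fits into a short exact sequence $0\to T\to M\to F\to0$ with $T\in\mathcal{T}$, $F\in\mathcal{F}$. It is \emph{hereditary} if $\mathcal{T}$ is closed under subobjects. *)

theory Defs
  imports "HOL-Algebra.Coset"
begin

text \<open>
  Abelian groups are commutative groups of HOL-Algebra, hence written multiplicatively;
  this includes the Hom-groups of a preadditive category.
\<close>

section \<open>Preadditive, additive and abelian categories\<close>

record ('o, 'm) cat =
  Ob :: "'o set"
  Arr :: "'m set"
  Dom :: "'m \<Rightarrow> 'o"
  Cod :: "'m \<Rightarrow> 'o"
  Ident :: "'o \<Rightarrow> 'm"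
  Comp :: "'m \<Rightarrow> 'm \<Rightarrow> 'm"  (infixr "\<cdot>\<index>" 75)
  Plus :: "'m \<Rightarrow> 'm \<Rightarrow> 'm"
  Zero :: "'o \<Rightarrow> 'o \<Rightarrow> 'm"

definition Hom :: "('o, 'm) cat \<Rightarrow> 'o \<Rightarrow> 'o \<Rightarrow> 'm monoid" where
  "Hom C X Y = \<lparr>carrier = {f \<in> Arr C. Dom C f = X \<and> Cod C f = Y},
                mult = Plus C, one = Zero C X Y\<rparr>"

abbreviation arrows :: "('o, 'm) cat \<Rightarrow> 'o \<Rightarrow> 'o \<Rightarrow> 'm set" where
  "arrows C X Y \<equiv> carrier (Hom C X Y)"

locale preadditive_category =
  fixes C :: "('o, 'm) cat" (structure)
  assumes dom_cod: "f \<in> Arr C \<Longrightarrow> Dom C f \<in> Ob C \<and> Cod C f \<in> Ob C"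
    and ident: "X \<in> Ob C \<Longrightarrow> Ident C X \<in> arrows C X X"
    and comp: "\<lbrakk>f \<in> arrows C X Y; g \<in> arrows C Y Z\<rbrakk> \<Longrightarrow> g \<cdot> f \<in> arrows C X Z"
    and ident_right: "f \<in> arrows C X Y \<Longrightarrow> f \<cdot> Ident C X = f"
    and ident_left: "f \<in> arrows C X Y \<Longrightarrow> Ident C Y \<cdot> f = f"
    and assoc: "\<lbrakk>f \<in> arrows C W X; g \<in> arrows C X Y; h \<in> arrows C Y Z\<rbrakk>
                 \<Longrightarrow> (h \<cdot> g) \<cdot> f = h \<cdot> (g \<cdot> f)"
    and hom_group: "\<lbrakk>X \<in> Ob C; Y \<in> Ob C\<rbrakk> \<Longrightarrow> comm_group (Hom C X Y)"
    and comp_add_right: "\<lbrakk>f \<in> arrows C X Y; f' \<in> arrows C X Y; g \<in> arrows C Y Z\<rbrakk>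
                 \<Longrightarrow> g \<cdot> (Plus C f f') = Plus C (g \<cdot> f) (g \<cdot> f')"
    and comp_add_left: "\<lbrakk>f \<in> arrows C X Y; g \<in> arrows C Y Z; g' \<in> arrows C Y Z\<rbrakk>
                 \<Longrightarrow> (Plus C g g') \<cdot> f = Plus C (g \<cdot> f) (g' \<cdot> f)"

definition is_zero_object :: "('o, 'm) cat \<Rightarrow> 'o \<Rightarrow> bool" where
  "is_zero_object C Z \<longleftrightarrow> Z \<in> Ob C \<and>
     (\<forall>X\<in>Ob C. (\<exists>!f. f \<in> arrows C X Z) \<and> (\<exists>!f. f \<in> arrows C Z X))"

definition is_biproduct ::
  "('o, 'm) cat \<Rightarrow> 'o \<Rightarrow> 'o \<Rightarrow> 'o \<Rightarrow> 'm \<Rightarrow> 'm \<Rightarrow> 'm \<Rightarrow> 'm \<Rightarrow> bool" where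
  "is_biproduct C X Y S i j p q \<longleftrightarrow>
     i \<in> arrows C X S \<and> j \<in> arrows C Y S \<and> p \<in> arrows C S X \<and> q \<in> arrows C S Y \<and>
     p \<cdot>\<^bsub>C\<^esub> i = Ident C X \<and> q \<cdot>\<^bsub>C\<^esub> j = Ident C Y \<and>
     q \<cdot>\<^bsub>C\<^esub> i = Zero C X Y \<and> p \<cdot>\<^bsub>C\<^esub> j = Zero C Y X \<and>
     Plus C (i \<cdot>\<^bsub>C\<^esub> p) (j \<cdot>\<^bsub>C\<^esub> q) = Ident C S"

locale additive_category = preadditive_category +
  assumes ex_zero_object: "\<exists>Z. is_zero_object C Z"
    and ex_biproduct: "\<lbrakk>X \<in> Ob C; Y \<in> Ob C\<rbrakk> \<Longrightarrow> \<exists>S i j p q. is_biproduct C X Y S i j p q"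

definition is_mono :: "('o, 'm) cat \<Rightarrow> 'm \<Rightarrow> bool" where
  "is_mono C f \<longleftrightarrow> f \<in> Arr C \<and>
     (\<forall>X. \<forall>g\<in>arrows C X (Dom C f). \<forall>h\<in>arrows C X (Dom C f). f \<cdot>\<^bsub>C\<^esub> g = f \<cdot>\<^bsub>C\<^esub> h \<longrightarrow> g = h)"

definition is_epi :: "('o, 'm) cat \<Rightarrow> 'm \<Rightarrow> bool" where
  "is_epi C f \<longleftrightarrow> f \<in> Arr C \<and>
     (\<forall>X. \<forall>g\<in>arrows C (Cod C f) X. \<forall>h\<in>arrows C (Cod C f) X. g \<cdot>\<^bsub>C\<^esub> f = h \<cdot>\<^bsub>C\<^esub> f \<longrightarrow> g = h)"

definition is_iso :: "('o, 'm) cat \<Rightarrow> 'm \<Rightarrow> bool" where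
  "is_iso C f \<longleftrightarrow> f \<in> Arr C \<and>
     (\<exists>g\<in>arrows C (Cod C f) (Dom C f).
        g \<cdot>\<^bsub>C\<^esub> f = Ident C (Dom C f) \<and> f \<cdot>\<^bsub>C\<^esub> g = Ident C (Cod C f))"

definition is_kernel :: "('o, 'm) cat \<Rightarrow> 'm \<Rightarrow> 'm \<Rightarrow> bool" where
  "is_kernel C k f \<longleftrightarrow> k \<in> Arr C \<and> f \<in> Arr C \<and> Cod C k = Dom C f \<and>
     f \<cdot>\<^bsub>C\<^esub> k = Zero C (Dom C k) (Cod C f) \<and>
     (\<forall>X. \<forall>g\<in>arrows C X (Dom C f). f \<cdot>\<^bsub>C\<^esub> g = Zero C X (Cod C f) \<longrightarrow>
        (\<exists>!h. h \<in> arrows C X (Dom C k) \<and> k \<cdot>\<^bsub>C\<^esub> h = g))"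

definition is_cokernel :: "('o, 'm) cat \<Rightarrow> 'm \<Rightarrow> 'm \<Rightarrow> bool" where
  "is_cokernel C q f \<longleftrightarrow> q \<in> Arr C \<and> f \<in> Arr C \<and> Dom C q = Cod C f \<and>
     q \<cdot>\<^bsub>C\<^esub> f = Zero C (Dom C f) (Cod C q) \<and>
     (\<forall>X. \<forall>g\<in>arrows C (Cod C f) X. g \<cdot>\<^bsub>C\<^esub> f = Zero C (Dom C f) X \<longrightarrow>
        (\<exists>!h. h \<in> arrows C (Cod C q) X \<and> h \<cdot>\<^bsub>C\<^esub> q = g))"

text \<open>In an abelian category the kernel-cokernel pairs are the short exact sequences.\<close>

definition kernel_cokernel_pair :: "('o, 'm) cat \<Rightarrow> 'm \<Rightarrow> 'm \<Rightarrow> bool" where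
  "kernel_cokernel_pair C i p \<longleftrightarrow> is_kernel C i p \<and> is_cokernel C p i"

text \<open>\<open>is_pullback C p f f' p'\<close>: the arrow \<open>p'\<close> is the pullback of \<open>p\<close> along \<open>f\<close>, and
  \<open>f'\<close> the pullback of \<open>f\<close> along \<open>p\<close>.\<close>

definition is_pullback :: "('o, 'm) cat \<Rightarrow> 'm \<Rightarrow> 'm \<Rightarrow> 'm \<Rightarrow> 'm \<Rightarrow> bool" where
  "is_pullback C p f f' p' \<longleftrightarrow>
     p \<in> Arr C \<and> f \<in> Arr C \<and> f' \<in> Arr C \<and> p' \<in> Arr C \<and>
     Cod C p = Cod C f \<and> Dom C f' = Dom C p' \<and> Cod C f' = Dom C p \<and> Cod C p' = Dom C f \<and>
     p \<cdot>\<^bsub>C\<^esub> f' = f \<cdot>\<^bsub>C\<^esub> p' \<and>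
     (\<forall>X. \<forall>a\<in>arrows C X (Dom C p). \<forall>b\<in>arrows C X (Dom C f). p \<cdot>\<^bsub>C\<^esub> a = f \<cdot>\<^bsub>C\<^esub> b \<longrightarrow>
        (\<exists>!h. h \<in> arrows C X (Dom C p') \<and> f' \<cdot>\<^bsub>C\<^esub> h = a \<and> p' \<cdot>\<^bsub>C\<^esub> h = b))"

locale abelian_category = additive_category +
  assumes ex_kernel: "f \<in> Arr C \<Longrightarrow> \<exists>k. is_kernel C k f"
    and ex_cokernel: "f \<in> Arr C \<Longrightarrow> \<exists>q. is_cokernel C q f"
    and mono_is_kernel: "is_mono C f \<Longrightarrow> \<exists>g. is_kernel C f g"
    and epi_is_cokernel: "is_epi C f \<Longrightarrow> \<exists>g. is_cokernel C f g"

definition is_projective :: "('o, 'm) cat \<Rightarrow> 'o \<Rightarrow> bool" where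
  "is_projective C P \<longleftrightarrow> P \<in> Ob C \<and>
     (\<forall>e. is_epi C e \<longrightarrow>
        (\<forall>f\<in>arrows C P (Cod C e). \<exists>g\<in>arrows C P (Dom C e). e \<cdot>\<^bsub>C\<^esub> g = f))"

text \<open>Projective dimension at most \<open>n\<close>: there is a projective resolution of length at most \<open>n\<close>,
  here spliced together from short exact sequences.\<close>

fun proj_dim_le :: "('o, 'm) cat \<Rightarrow> nat \<Rightarrow> 'o \<Rightarrow> bool" where
  "proj_dim_le C 0 M \<longleftrightarrow> is_projective C M"
| "proj_dim_le C (Suc n) M \<longleftrightarrow>
     (\<exists>i p. kernel_cokernel_pair C i p \<and> Cod C p = M \<and>
            is_projective C (Dom C p) \<and> proj_dim_le C n (Dom C i))"

text \<open>A full subcategory is given by its set of objects.\<close>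

definition full_subcategory :: "('o, 'm) cat \<Rightarrow> 'o set \<Rightarrow> ('o, 'm) cat" where
  "full_subcategory C S =
     C\<lparr>Ob := Ob C \<inter> S, Arr := {f \<in> Arr C. Dom C f \<in> S \<and> Cod C f \<in> S}\<rparr>"

definition is_replete :: "('o, 'm) cat \<Rightarrow> 'o set \<Rightarrow> bool" where
  "is_replete C S \<longleftrightarrow> S \<subseteq> Ob C \<and> (\<forall>f. is_iso C f \<and> Dom C f \<in> S \<longrightarrow> Cod C f \<in> S)"

locale torsion_pair = abelian_category +
  fixes T F :: "'a set"
  assumes replete_T: "is_replete C T"
    and replete_F: "is_replete C F"
    and hom_zero: "\<lbrakk>X \<in> T; Y \<in> F; f \<in> arrows C X Y\<rbrakk> \<Longrightarrow> f = Zero C X Y"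
    and ex_torsion_sequence: "M \<in> Ob C \<Longrightarrow>
          \<exists>i p. kernel_cokernel_pair C i p \<and> Cod C i = M \<and> Dom C i \<in> T \<and> Cod C p \<in> F"

locale hereditary_torsion_pair = torsion_pair +
  assumes subobject_closed: "\<lbrakk>is_mono C m; Cod C m \<in> T\<rbrakk> \<Longrightarrow> Dom C m \<in> T"


section \<open>Deflation-exact categories\<close>

text \<open>A class of conflations is a set \<open>K\<close> of pairs consisting of an inflation and a deflation.\<close>

definition inflation :: "('m \<times> 'm) set \<Rightarrow> 'm \<Rightarrow> bool" where
  "inflation K i \<longleftrightarrow> (\<exists>p. (i, p) \<in> K)"

definition deflation :: "('m \<times> 'm) set \<Rightarrow> 'm \<Rightarrow> bool" where
  "deflation K p \<longleftrightarrow> (\<exists>i. (i, p) \<in> K)"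

locale conflation_category = additive_category E for E :: "('o, 'm) cat" (structure) +
  fixes K :: "('m \<times> 'm) set"
  assumes conflation: "(i, p) \<in> K \<Longrightarrow> kernel_cokernel_pair E i p"
    and conflation_iso:
      "\<lbrakk>(i, p) \<in> K; kernel_cokernel_pair E i' p';
        is_iso E a; is_iso E b; is_iso E c;
        a \<in> arrows E (Dom E i) (Dom E i'); b \<in> arrows E (Cod E i) (Cod E i');
        c \<in> arrows E (Cod E p) (Cod E p');
        b \<cdot> i = i' \<cdot> a; c \<cdot> p = p' \<cdot> b\<rbrakk> \<Longrightarrow> (i', p') \<in> K"

locale deflation_exact_category = conflation_category +
  assumes R0: "\<lbrakk>is_zero_object E Z; f \<in> arrows E X Z\<rbrakk> \<Longrightarrow> deflation K f"
    and R1: "\<lbrakk>deflation K p; deflation K q; Cod E p = Dom E q\<rbrakk> \<Longrightarrow> deflation K (q \<cdot> p)"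
    and R2_ex: "\<lbrakk>deflation K p; f \<in> Arr E; Cod E f = Cod E p\<rbrakk> \<Longrightarrow> \<exists>f' p'. is_pullback E p f f' p'"
    and R2_deflation: "\<lbrakk>deflation K p; is_pullback E p f f' p'\<rbrakk> \<Longrightarrow> deflation K p'"

definition has_admissible_kernels :: "('o, 'm) cat \<Rightarrow> ('m \<times> 'm) set \<Rightarrow> bool" where
  "has_admissible_kernels E K \<longleftrightarrow>
     (\<forall>f\<in>Arr E. \<exists>k. is_kernel E k f) \<and> (\<forall>k f. is_kernel E k f \<longrightarrow> inflation K k)"


section \<open>Functor categories\<close>

text \<open>A functor with values in abelian groups whose elements have type \<open>'v\<close>, which plays the
  role of a universe. Finitely presented functors are pointwise quotients of Hom-groups, so as
  soon as the arrows of the source category embed into \<open>'v\<close>, each of them is isomorphic to one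
  with values in \<open>'v\<close>. Records that differ only outside the source category are distinct but
  isomorphic objects of the functor category.\<close>

record ('o, 'm, 'v) funct =
  FOb :: "'o \<Rightarrow> 'v monoid"
  FArr :: "'m \<Rightarrow> 'v \<Rightarrow> 'v"

definition contravariant_additive :: "('o, 'm) cat \<Rightarrow> ('o, 'm, 'v) funct \<Rightarrow> bool" where
  "contravariant_additive E M \<longleftrightarrow>
     (\<forall>X\<in>Ob E. comm_group (FOb M X)) \<and>
     (\<forall>X Y. \<forall>f\<in>arrows E X Y. FArr M f \<in> hom (FOb M Y) (FOb M X)) \<and>
     (\<forall>X\<in>Ob E. \<forall>x\<in>carrier (FOb M X). FArr M (Ident E X) x = x) \<and>
     (\<forall>X Y Z. \<forall>f\<in>arrows E X Y. \<forall>g\<in>arrows E Y Z. \<forall>z\<in>carrier (FOb M Z).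
        FArr M (g \<cdot>\<^bsub>E\<^esub> f) z = FArr M f (FArr M g z)) \<and>
     (\<forall>X Y. \<forall>f\<in>arrows E X Y. \<forall>g\<in>arrows E X Y. \<forall>y\<in>carrier (FOb M Y).
        FArr M (Plus E f g) y = FArr M f y \<otimes>\<^bsub>FOb M X\<^esub> FArr M g y)"

text \<open>Components of natural transformations are made extensional, so that equality of
  transformations is equality of their components.\<close>

record ('o, 'm, 'v) transf =
  TDom :: "('o, 'm, 'v) funct"
  TCod :: "('o, 'm, 'v) funct"
  TMap :: "'o \<Rightarrow> 'v \<Rightarrow> 'v"

definition natural :: "('o, 'm) cat \<Rightarrow> ('o, 'm, 'v) transf \<Rightarrow> bool" where
  "natural E t \<longleftrightarrow>
     contravariant_additive E (TDom t) \<and> contravariant_additive E (TCod t) \<and>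
     TMap t \<in> extensional (Ob E) \<and>
     (\<forall>X\<in>Ob E. TMap t X \<in> extensional (carrier (FOb (TDom t) X)) \<and>
        TMap t X \<in> hom (FOb (TDom t) X) (FOb (TCod t) X)) \<and>
     (\<forall>X Y. \<forall>f\<in>arrows E X Y. \<forall>y\<in>carrier (FOb (TDom t) Y).
        TMap t X (FArr (TDom t) f y) = FArr (TCod t) f (TMap t Y y))"

definition Mod_cat ::
  "('o, 'm) cat \<Rightarrow> (('o, 'm, 'v) funct, ('o, 'm, 'v) transf) cat" where
  "Mod_cat E =
     \<lparr>Ob = {M. contravariant_additive E M},
      Arr = {t. natural E t},
      Dom = TDom,
      Cod = TCod,
      Ident = (\<lambda>M. \<lparr>TDom = M, TCod = M, TMap = (\<lambda>X\<in>Ob E. \<lambda>x\<in>carrier (FOb M X). x)\<rparr>),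
      Comp = (\<lambda>t s. \<lparr>TDom = TDom s, TCod = TCod t,
                TMap = (\<lambda>X\<in>Ob E. \<lambda>x\<in>carrier (FOb (TDom s) X). TMap t X (TMap s X x))\<rparr>),
      Plus = (\<lambda>s t. \<lparr>TDom = TDom s, TCod = TCod s,
                TMap = (\<lambda>X\<in>Ob E. \<lambda>x\<in>carrier (FOb (TDom s) X).
                          TMap s X x \<otimes>\<^bsub>FOb (TCod s) X\<^esub> TMap t X x)\<rparr>),
      Zero = (\<lambda>M N. \<lparr>TDom = M, TCod = N,
                TMap = (\<lambda>X\<in>Ob E. \<lambda>x\<in>carrier (FOb M X). \<one>\<^bsub>FOb N X\<^esub>)\<rparr>)\<rparr>"

text \<open>Natural isomorphism. The groups may live on different types, so this is not
  \<^const>\<open>is_iso\<close> in a single \<^const>\<open>Mod_cat\<close>.\<close>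

definition funct_iso ::
  "('o, 'm) cat \<Rightarrow> ('o, 'm, 'v) funct \<Rightarrow> ('o, 'm, 'w) funct \<Rightarrow> bool" where
  "funct_iso E M N \<longleftrightarrow>
     (\<exists>\<phi>. (\<forall>X\<in>Ob E. \<phi> X \<in> iso (FOb M X) (FOb N X)) \<and>
          (\<forall>X Y. \<forall>f\<in>arrows E X Y. \<forall>y\<in>carrier (FOb M Y).
             \<phi> X (FArr M f y) = FArr N f (\<phi> Y y)))"

definition yoneda :: "('o, 'm) cat \<Rightarrow> 'o \<Rightarrow> ('o, 'm, 'm) funct" where
  "yoneda E A = \<lparr>FOb = (\<lambda>X. Hom E X A), FArr = (\<lambda>f g. g \<cdot>\<^bsub>E\<^esub> f)\<rparr>"

definition yoneda_map :: "('o, 'm) cat \<Rightarrow> 'm \<Rightarrow> ('o, 'm, 'm) transf" where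
  "yoneda_map E f =
     \<lparr>TDom = yoneda E (Dom E f), TCod = yoneda E (Cod E f),
      TMap = (\<lambda>X\<in>Ob E. \<lambda>g\<in>arrows E X (Dom E f). f \<cdot>\<^bsub>E\<^esub> g)\<rparr>"

text \<open>The pointwise cokernel of a transformation. On cosets, the arrow \<open>f\<close> from \<open>X\<close> to \<open>Y\<close> maps
  the coset of \<open>y\<close> to the coset of the image of \<open>y\<close>.\<close>

definition image_at :: "('o, 'm, 'v) transf \<Rightarrow> 'o \<Rightarrow> 'v set" where
  "image_at t X = TMap t X ` carrier (FOb (TDom t) X)"

definition coker_funct :: "('o, 'm) cat \<Rightarrow> ('o, 'm, 'v) transf \<Rightarrow> ('o, 'm, 'v set) funct" where
  "coker_funct E t =
     \<lparr>FOb = (\<lambda>X. FOb (TCod t) X Mod image_at t X),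
      FArr = (\<lambda>f S. image_at t (Dom E f) <#>\<^bsub>FOb (TCod t) (Dom E f)\<^esub> (FArr (TCod t) f ` S))\<rparr>"

definition finitely_presented :: "('o, 'm) cat \<Rightarrow> ('o, 'm, 'v) funct \<Rightarrow> bool" where
  "finitely_presented E M \<longleftrightarrow>
     contravariant_additive E M \<and>
     (\<exists>f\<in>Arr E. funct_iso E M (coker_funct E (yoneda_map E f)))"

definition mod_cat ::
  "('o, 'm) cat \<Rightarrow> (('o, 'm, 'v) funct, ('o, 'm, 'v) transf) cat" where
  "mod_cat E = full_subcategory (Mod_cat E) {M. finitely_presented E M}"

definition mod1 :: "('o, 'm) cat \<Rightarrow> ('o, 'm, 'v) funct set" where
  "mod1 E = {M \<in> Ob (mod_cat E). proj_dim_le (mod_cat E) 1 M}"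

definition eff :: "('o, 'm) cat \<Rightarrow> ('m \<times> 'm) set \<Rightarrow> ('o, 'm, 'v) funct set" where
  "eff E K = {M \<in> Ob (mod_cat E).
     \<exists>f. deflation K f \<and> funct_iso E M (coker_funct E (yoneda_map E f))}"

end

theory Submission
  imports Defs
begin

text \<open>
  A functor \<open>M\<close> is finitely presented if it is generated by one element \<open>m\<close> in \<open>M B\<close> subject to one
  relation, given by an arrow \<open>f\<close> into \<open>B\<close>: every element of \<open>M X\<close> is \<open>M z m\<close> for some
  \<open>z\<close> from \<open>X\<close> to \<open>B\<close>, and \<open>M z m\<close> is zero if and only if \<open>z\<close> factors through \<open>f\<close> (\<open>presents\<close>). By the
  Yoneda lemma transformations out of \<open>M\<close> are then elements killed by \<open>f\<close>
  (\<open>ex_transf_of_generator\<close>), so that statements about functors become statements about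
  factorizations of arrows.

  The category of finitely presented functors is abelian because pointwise kernels and cokernels
  are again finitely presented: the former by pullbacks (\<open>ex_pointwise_kernel\<close>), which exist as
  the base category has kernels and biproducts, the latter by joining relations
  (\<open>ex_pointwise_cokernel\<close>). Monomorphisms, epimorphisms and short exact sequences are therefore
  those of the underlying groups (\<open>short_exact_iff_pointwise\<close>).

  The torsion sequences come from a factorization. If all kernels are inflations, each
  arrow \<open>f\<close> is a deflation \<open>p\<close>, the cokernel of the kernel of \<open>f\<close>, followed by an arrow \<open>m\<close>, and
  stability of deflations under pullback makes \<open>m\<close> a monomorphism
  (\<open>ex_deflation_mono_factorization\<close>). The cokernels of \<open>Hom(-, p)\<close>, \<open>Hom(-, f)\<close> and
  \<open>Hom(-, m)\<close> then form a short exact sequence, whose first term is effaceable and whose last term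
  is resolved by the two representable functors that \<open>m\<close> connects (\<open>ex_eff_mod1_sequence\<close>).

  Effaceable functors have no nonzero maps to functors of projective dimension at most one because
  a deflation is the cokernel of its kernel, representable functors turn cokernels into kernels,
  and a projective functor is a retract of a representable one (\<open>hom_eff_mod1_zero\<close>). Finally, a
  subfunctor of the cokernel of \<open>Hom(-, p)\<close> is the cokernel of \<open>Hom(-, p')\<close> for a pullback \<open>p'\<close>
  of \<open>p\<close>, hence effaceable with it (\<open>eff_subobject\<close>).
\<close>

section \<open>Arithmetic of arrows in additive categories\<close>

lemma mult_Hom [simp]: "x \<otimes>\<^bsub>Hom C X Y\<^esub> y = Plus C x y"
  and one_Hom [simp]: "\<one>\<^bsub>Hom C X Y\<^esub> = Zero C X Y"
  by (simp_all add: Hom_def)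

lemma mem_arrows: "f \<in> arrows C X Y \<longleftrightarrow> f \<in> Arr C \<and> Dom C f = X \<and> Cod C f = Y"
  by (auto simp: Hom_def)

context preadditive_category
begin

lemma arrows_objects: "f \<in> arrows C X Y \<Longrightarrow> X \<in> Ob C \<and> Y \<in> Ob C"
  using dom_cod by (auto simp: mem_arrows)

lemma Arr_arrows: "f \<in> Arr C \<Longrightarrow> f \<in> arrows C (Dom C f) (Cod C f)"
  by (simp add: mem_arrows)

lemma plus_arrows: "\<lbrakk>f \<in> arrows C X Y; g \<in> arrows C X Y\<rbrakk> \<Longrightarrow> Plus C f g \<in> arrows C X Y"
  using comm_group.axioms(2)[OF hom_group, THEN group.is_monoid, THEN monoid.m_closed]
    arrows_objects by fastforce

lemma zero_arrows: "\<lbrakk>X \<in> Ob C; Y \<in> Ob C\<rbrakk> \<Longrightarrow> Zero C X Y \<in> arrows C X Y"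
  using comm_group.axioms(2)[OF hom_group, THEN group.is_monoid, THEN monoid.one_closed]
  by fastforce

lemma plus_zero:
  assumes "f \<in> arrows C X Y"
  shows "Plus C f (Zero C X Y) = f" "Plus C (Zero C X Y) f = f"
proof -
  interpret H: comm_group "Hom C X Y"
    using hom_group arrows_objects[OF assms] by blast
  show "Plus C f (Zero C X Y) = f" "Plus C (Zero C X Y) f = f"
    using H.r_one[OF assms] H.l_one[OF assms] by simp_all
qed

lemma plus_ac:
  assumes "f \<in> arrows C X Y" "g \<in> arrows C X Y" "h \<in> arrows C X Y"
  shows "Plus C f g = Plus C g f" "Plus C (Plus C f g) h = Plus C f (Plus C g h)"
proof -
  interpret H: comm_group "Hom C X Y"
    using hom_group arrows_objects[OF assms(1)] by blast
  show "Plus C f g = Plus C g f" "Plus C (Plus C f g) h = Plus C f (Plus C g h)"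
    using H.m_comm[OF assms(1,2)] H.m_assoc[OF assms] by simp_all
qed

lemma ex_negative:
  assumes "f \<in> arrows C X Y"
  obtains g where "g \<in> arrows C X Y" "Plus C f g = Zero C X Y" "Plus C g f = Zero C X Y"
proof -
  interpret H: comm_group "Hom C X Y"
    using hom_group arrows_objects[OF assms] by blast
  show thesis
    using that[OF H.inv_closed[OF assms]] H.r_inv[OF assms] H.l_inv[OF assms] by simp
qed

lemma idem_is_zero:
  assumes "f \<in> arrows C X Y" "Plus C f f = f"
  shows "f = Zero C X Y"
proof -
  interpret H: comm_group "Hom C X Y"
    using hom_group arrows_objects[OF assms(1)] by blast
  show ?thesis
    using assms H.r_cancel_one[of f f] by simp
qed

lemma comp_zero:
  assumes "f \<in> arrows C X Y"
  shows "Z \<in> Ob C \<Longrightarrow> f \<cdot> Zero C Z X = Zero C Z Y"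
    and "Z \<in> Ob C \<Longrightarrow> Zero C Y Z \<cdot> f = Zero C X Z"
proof -
  assume Z: "Z \<in> Ob C"
  have XY: "X \<in> Ob C" "Y \<in> Ob C" using arrows_objects[OF assms] by auto
  have z: "Zero C Z X \<in> arrows C Z X" "Zero C Y Z \<in> arrows C Y Z"
    using zero_arrows Z XY by auto
  show "f \<cdot> Zero C Z X = Zero C Z Y"
    using idem_is_zero[OF comp[OF z(1) assms]] comp_add_right[OF z(1) z(1) assms]
      plus_zero[OF z(1)] by simp
  show "Zero C Y Z \<cdot> f = Zero C X Z"
    using idem_is_zero[OF comp[OF assms z(2)]] comp_add_left[OF assms z(2) z(2)]
      plus_zero[OF z(2)] by simp
qed

lemma negative_unique:
  assumes "f \<in> arrows C X Y" "g \<in> arrows C X Y" "h \<in> arrows C X Y"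
    and "Plus C f h = Zero C X Y" "Plus C g h = Zero C X Y"
  shows "f = g"
proof -
  interpret H: comm_group "Hom C X Y"
    using hom_group arrows_objects[OF assms(1)] by blast
  show ?thesis
    using assms H.right_cancel[of h f g] by simp
qed

lemma preadditive_full_subcategory: "preadditive_category (full_subcategory C S)"
proof -
  let ?D = "full_subcategory C S"
  have [simp]: "Comp ?D = Comp C" "Plus ?D = Plus C" "Zero ?D = Zero C"
    "Ident ?D = Ident C" "Dom ?D = Dom C" "Cod ?D = Cod C"
    by (simp_all add: full_subcategory_def)
  have arr: "f \<in> arrows ?D X Y \<longleftrightarrow> f \<in> arrows C X Y \<and> X \<in> S \<and> Y \<in> S" for f X Y
    by (auto simp: mem_arrows full_subcategory_def)
  have hom: "Hom ?D X Y = Hom C X Y" if "X \<in> S" "Y \<in> S" for X Y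
    using that by (auto simp: Hom_def full_subcategory_def)
  have ob: "X \<in> Ob ?D \<longleftrightarrow> X \<in> Ob C \<and> X \<in> S" for X
    by (simp add: full_subcategory_def)
  show ?thesis
  proof (rule preadditive_category.intro)
    show "Dom ?D f \<in> Ob ?D \<and> Cod ?D f \<in> Ob ?D" if "f \<in> Arr ?D" for f
      using that dom_cod by (auto simp: full_subcategory_def)
    show "comm_group (Hom ?D X Y)" if "X \<in> Ob ?D" "Y \<in> Ob ?D" for X Y
      using that hom_group by (simp add: hom ob)
  qed (use ident comp ident_left ident_right assoc comp_add_left comp_add_right in \<open>auto simp: arr ob\<close>)
qed

end

context additive_category
begin

text \<open>The arrow from a biproduct given by a pair of arrows: its image is the sum of the two
  images, so that imposing it as relation imposes both.\<close>

lemma ex_copair: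
  assumes a: "a \<in> arrows C A D" and b: "b \<in> arrows C B D"
  obtains r S where "r \<in> arrows C S D"
    and "\<forall>T v. (\<exists>w\<in>arrows C T S. v = r \<cdot> w) \<longleftrightarrow>
           (\<exists>x\<in>arrows C T A. \<exists>y\<in>arrows C T B. v = Plus C (a \<cdot> x) (b \<cdot> y))"
proof -
  obtain S i j p q where bp: "is_biproduct C A B S i j p q"
    using ex_biproduct arrows_objects[OF a] arrows_objects[OF b] by blast
  then have arr: "i \<in> arrows C A S" "j \<in> arrows C B S" "p \<in> arrows C S A" "q \<in> arrows C S B"
    and eq: "p \<cdot> i = Ident C A" "q \<cdot> j = Ident C B" "q \<cdot> i = Zero C A B" "p \<cdot> j = Zero C B A"
    "Plus C (i \<cdot> p) (j \<cdot> q) = Ident C S"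
    by (auto simp: is_biproduct_def)
  let ?r = "Plus C (a \<cdot> p) (b \<cdot> q)"
  have ap: "a \<cdot> p \<in> arrows C S D" and bq: "b \<cdot> q \<in> arrows C S D"
    using comp a b arr by blast+
  have r: "?r \<in> arrows C S D" using plus_arrows ap bq .
  have rw: "?r \<cdot> w = Plus C (a \<cdot> (p \<cdot> w)) (b \<cdot> (q \<cdot> w))" if "w \<in> arrows C T S" for w T
    using comp_add_left[OF that ap bq] assoc[OF that arr(3) a] assoc[OF that arr(4) b] by simp
  show thesis
  proof (rule that[OF r], intro allI iffI; elim bexE; hypsubst)
    fix T w assume w: "w \<in> arrows C T S"
    show "\<exists>x\<in>arrows C T A. \<exists>y\<in>arrows C T B. ?r \<cdot> w = Plus C (a \<cdot> x) (b \<cdot> y)"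
      using rw[OF w] comp[OF w arr(3)] comp[OF w arr(4)] by auto
  next
    fix T x y assume x: "x \<in> arrows C T A" and y: "y \<in> arrows C T B"
    let ?w = "Plus C (i \<cdot> x) (j \<cdot> y)"
    have ix: "i \<cdot> x \<in> arrows C T S" and jy: "j \<cdot> y \<in> arrows C T S"
      using comp x y arr by blast+
    have w: "?w \<in> arrows C T S" using plus_arrows ix jy .
    have T: "T \<in> Ob C" using arrows_objects[OF x] by simp
    have "p \<cdot> ?w = x"
      using comp_add_right[OF ix jy arr(3)] assoc[OF x arr(1,3)] assoc[OF y arr(2,3)] eq
        ident_left[OF x] comp_zero(2)[OF y] arrows_objects[OF x] plus_zero[OF x] by simp
    moreover have "q \<cdot> ?w = y"
      using comp_add_right[OF ix jy arr(4)] assoc[OF x arr(1,4)] assoc[OF y arr(2,4)] eq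
        ident_left[OF y] comp_zero(2)[OF x] arrows_objects[OF y] plus_zero[OF y] by simp
    ultimately show "\<exists>w\<in>arrows C T S. Plus C (a \<cdot> x) (b \<cdot> y) = ?r \<cdot> w"
      using rw[OF w] by (intro bexI[OF _ w]) simp
  qed
qed

lemma pullback_arrows:
  assumes "is_pullback C a b x y" "a \<in> arrows C A D" "b \<in> arrows C B D"
  obtains P where "x \<in> arrows C P A" "y \<in> arrows C P B" "a \<cdot> x = b \<cdot> y"
  using assms by (auto simp: is_pullback_def mem_arrows)

lemma pullback_lift:
  assumes pb: "is_pullback C a b x y" and x: "x \<in> arrows C P A" and b: "b \<in> arrows C B D"
    and v: "v \<in> arrows C T A" and w: "w \<in> arrows C T B" and vw: "a \<cdot> v = b \<cdot> w"
  obtains h where "h \<in> arrows C T P" "x \<cdot> h = v" "y \<cdot> h = w"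
proof -
  have "Dom C a = A" "Dom C b = B" "Dom C y = P"
    using pb x b by (auto simp: is_pullback_def mem_arrows)
  then have "\<exists>h. h \<in> arrows C T P \<and> x \<cdot> h = v \<and> y \<cdot> h = w"
    using pb v w vw unfolding is_pullback_def by blast
  then show thesis using that by blast
qed

text \<open>The pullback is the kernel of \<open>a \<cdot> p - b \<cdot> q\<close>, where \<open>p\<close> and \<open>q\<close> are the projections of the
  biproduct of the domains of \<open>a\<close> and \<open>b\<close>.\<close>

lemma ex_pullback:
  assumes ker: "\<And>f. f \<in> Arr C \<Longrightarrow> \<exists>k. is_kernel C k f"
    and a: "a \<in> arrows C A D" and b: "b \<in> arrows C B D"
  shows "\<exists>x y. is_pullback C a b x y"
proof -
  obtain S i j p q where bp: "is_biproduct C A B S i j p q"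
    using ex_biproduct arrows_objects[OF a] arrows_objects[OF b] by blast
  then have arr: "i \<in> arrows C A S" "j \<in> arrows C B S" "p \<in> arrows C S A" "q \<in> arrows C S B"
    and eq: "p \<cdot> i = Ident C A" "q \<cdot> j = Ident C B" "q \<cdot> i = Zero C A B" "p \<cdot> j = Zero C B A"
    "Plus C (i \<cdot> p) (j \<cdot> q) = Ident C S"
    by (auto simp: is_biproduct_def)
  obtain n where n: "n \<in> arrows C B D" and bn: "Plus C b n = Zero C B D"
    using ex_negative[OF b] by blast
  have neg: "Plus C (b \<cdot> w) (n \<cdot> w) = Zero C T D" if "w \<in> arrows C T B" for w T
    using comp_add_left[OF that b n] bn comp_zero(2)[OF that] arrows_objects[OF b] by simp
  let ?r = "Plus C (a \<cdot> p) (n \<cdot> q)"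
  have ap: "a \<cdot> p \<in> arrows C S D" and nq: "n \<cdot> q \<in> arrows C S D"
    using comp a n arr by blast+
  have r: "?r \<in> arrows C S D" using plus_arrows ap nq .
  have rw: "?r \<cdot> w = Plus C (a \<cdot> (p \<cdot> w)) (n \<cdot> (q \<cdot> w))" if "w \<in> arrows C T S" for w T
    using comp_add_left[OF that ap nq] assoc[OF that arr(3) a] assoc[OF that arr(4) n] by simp
  have eqv: "a \<cdot> v = b \<cdot> w \<longleftrightarrow> Plus C (a \<cdot> v) (n \<cdot> w) = Zero C T D"
    if "v \<in> arrows C T A" "w \<in> arrows C T B" for v w T
    using negative_unique[OF comp[OF that(1) a] comp[OF that(2) b] comp[OF that(2) n]]
      neg[OF that(2)] by auto
  obtain k where "is_kernel C k ?r" using ker r by (auto simp: mem_arrows)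
  then obtain P where k: "k \<in> arrows C P S" and rk: "?r \<cdot> k = Zero C P D"
    and univ: "\<And>T g. \<lbrakk>g \<in> arrows C T S; ?r \<cdot> g = Zero C T D\<rbrakk>
                 \<Longrightarrow> \<exists>!h. h \<in> arrows C T P \<and> k \<cdot> h = g"
    using r by (auto simp: is_kernel_def mem_arrows)
  have pk: "p \<cdot> k \<in> arrows C P A" and qk: "q \<cdot> k \<in> arrows C P B"
    using comp k arr by blast+
  have comm: "a \<cdot> (p \<cdot> k) = b \<cdot> (q \<cdot> k)"
    using rk rw[OF k] eqv[OF pk qk] by simp
  have "\<exists>!h. h \<in> arrows C T P \<and> (p \<cdot> k) \<cdot> h = v \<and> (q \<cdot> k) \<cdot> h = w"
    if v: "v \<in> arrows C T A" and w: "w \<in> arrows C T B" and vw: "a \<cdot> v = b \<cdot> w" for T v w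
  proof -
    let ?g = "Plus C (i \<cdot> v) (j \<cdot> w)"
    have iv: "i \<cdot> v \<in> arrows C T S" and jw: "j \<cdot> w \<in> arrows C T S"
      using comp v w arr by blast+
    have g: "?g \<in> arrows C T S" using plus_arrows iv jw .
    have pg: "p \<cdot> ?g = v"
      using comp_add_right[OF iv jw arr(3)] assoc[OF v arr(1,3)] assoc[OF w arr(2,3)] eq
        ident_left[OF v] comp_zero(2)[OF w] arrows_objects[OF v] plus_zero[OF v] by simp
    have qg: "q \<cdot> ?g = w"
      using comp_add_right[OF iv jw arr(4)] assoc[OF v arr(1,4)] assoc[OF w arr(2,4)] eq
        ident_left[OF w] comp_zero(2)[OF v] arrows_objects[OF w] plus_zero[OF w] by simp
    have "?r \<cdot> ?g = Zero C T D" using rw[OF g] pg qg eqv[OF v w] vw by simp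
    note ex1 = univ[OF g this]
    have iff: "(p \<cdot> k) \<cdot> h = v \<and> (q \<cdot> k) \<cdot> h = w \<longleftrightarrow> k \<cdot> h = ?g"
      if h: "h \<in> arrows C T P" for h
    proof -
      have kh: "k \<cdot> h \<in> arrows C T S" using comp[OF h k] .
      have "k \<cdot> h = Plus C (i \<cdot> (p \<cdot> (k \<cdot> h))) (j \<cdot> (q \<cdot> (k \<cdot> h)))"
        using ident_left[OF kh] eq(5)
          comp_add_left[OF kh comp[OF arr(3,1)] comp[OF arr(4,2)]]
          assoc[OF kh arr(3,1)] assoc[OF kh arr(4,2)] by simp
      then show ?thesis
        using assoc[OF h k arr(3)] assoc[OF h k arr(4)] pg qg by metis
    qed
    show ?thesis using ex1 iff by blast
  qed
  moreover have "Dom C a = A" "Dom C b = B" "Cod C a = D" "Cod C b = D"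
    "Dom C (p \<cdot> k) = P" "Dom C (q \<cdot> k) = P" "Cod C (p \<cdot> k) = A" "Cod C (q \<cdot> k) = B"
    "a \<in> Arr C" "b \<in> Arr C" "p \<cdot> k \<in> Arr C" "q \<cdot> k \<in> Arr C"
    using pk qk a b by (auto simp: mem_arrows)
  ultimately have "is_pullback C a b (p \<cdot> k) (q \<cdot> k)"
    using comm by (simp add: is_pullback_def)
  then show ?thesis by blast
qed

end

section \<open>The category of additive functors\<close>

context preadditive_category
begin

lemma functor_group:
  "\<lbrakk>contravariant_additive C M; X \<in> Ob C\<rbrakk> \<Longrightarrow> comm_group (FOb M X)"
  by (simp add: contravariant_additive_def)

lemma functor_hom:
  "\<lbrakk>contravariant_additive C M; f \<in> arrows C X Y\<rbrakk> \<Longrightarrow> FArr M f \<in> hom (FOb M Y) (FOb M X)"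
  unfolding contravariant_additive_def by blast

lemma functor_closed:
  "\<lbrakk>contravariant_additive C M; f \<in> arrows C X Y; y \<in> carrier (FOb M Y)\<rbrakk>
     \<Longrightarrow> FArr M f y \<in> carrier (FOb M X)"
  by (rule hom_in_carrier[OF functor_hom])

lemma functor_mult:
  "\<lbrakk>contravariant_additive C M; f \<in> arrows C X Y; y \<in> carrier (FOb M Y); z \<in> carrier (FOb M Y)\<rbrakk>
     \<Longrightarrow> FArr M f (y \<otimes>\<^bsub>FOb M Y\<^esub> z) = FArr M f y \<otimes>\<^bsub>FOb M X\<^esub> FArr M f z"
  by (rule hom_mult[OF functor_hom])

lemma functor_ident:
  "\<lbrakk>contravariant_additive C M; X \<in> Ob C; x \<in> carrier (FOb M X)\<rbrakk> \<Longrightarrow> FArr M (Ident C X) x = x"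
  unfolding contravariant_additive_def by blast

lemma functor_comp:
  "\<lbrakk>contravariant_additive C M; f \<in> arrows C X Y; g \<in> arrows C Y Z; z \<in> carrier (FOb M Z)\<rbrakk>
     \<Longrightarrow> FArr M (g \<cdot> f) z = FArr M f (FArr M g z)"
  unfolding contravariant_additive_def by blast

lemma functor_plus:
  "\<lbrakk>contravariant_additive C M; f \<in> arrows C X Y; g \<in> arrows C X Y; y \<in> carrier (FOb M Y)\<rbrakk>
     \<Longrightarrow> FArr M (Plus C f g) y = FArr M f y \<otimes>\<^bsub>FOb M X\<^esub> FArr M g y"
  unfolding contravariant_additive_def by blast

lemma functor_one:
  assumes "contravariant_additive C M" "f \<in> arrows C X Y"
  shows "FArr M f \<one>\<^bsub>FOb M Y\<^esub> = \<one>\<^bsub>FOb M X\<^esub>"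
  using hom_one[OF functor_hom[OF assms]] functor_group[OF assms(1)] arrows_objects[OF assms(2)]
  by (simp add: comm_group_def)

lemma functor_zero:
  assumes M: "contravariant_additive C M" and XY: "X \<in> Ob C" "Y \<in> Ob C"
    and y: "y \<in> carrier (FOb M Y)"
  shows "FArr M (Zero C X Y) y = \<one>\<^bsub>FOb M X\<^esub>"
proof -
  interpret G: comm_group "FOb M X" using functor_group[OF M XY(1)] .
  have z: "Zero C X Y \<in> arrows C X Y" using zero_arrows XY .
  show ?thesis
    using functor_plus[OF M z z y] plus_zero[OF z] functor_closed[OF M z y]
      G.r_cancel_one[of "FArr M (Zero C X Y) y" "FArr M (Zero C X Y) y"] by simp
qed

text \<open>Composition, sum, zero and identity of the functor category all restrict a family of maps to
  the carriers of the source, so each of them is of this form.\<close>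

definition transf_of ::
  "('o, 'm, 'v) funct \<Rightarrow> ('o, 'm, 'v) funct \<Rightarrow> ('o \<Rightarrow> 'v \<Rightarrow> 'v) \<Rightarrow> ('o, 'm, 'v) transf" where
  "transf_of M N g =
     \<lparr>TDom = M, TCod = N, TMap = (\<lambda>X\<in>Ob C. \<lambda>x\<in>carrier (FOb M X). g X x)\<rparr>"

lemma TMap_transf_of [simp]:
  "\<lbrakk>X \<in> Ob C; x \<in> carrier (FOb M X)\<rbrakk> \<Longrightarrow> TMap (transf_of M N g) X x = g X x"
  by (simp add: transf_of_def)

lemma arrows_Mod: "t \<in> arrows (Mod_cat C) M N \<longleftrightarrow> natural C t \<and> TDom t = M \<and> TCod t = N"
  by (simp add: mem_arrows Mod_cat_def)

lemma transf_of_arrow: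
  assumes M: "contravariant_additive C M" and N: "contravariant_additive C N"
    and closed: "\<And>X x. \<lbrakk>X \<in> Ob C; x \<in> carrier (FOb M X)\<rbrakk> \<Longrightarrow> g X x \<in> carrier (FOb N X)"
    and mult: "\<And>X x y. \<lbrakk>X \<in> Ob C; x \<in> carrier (FOb M X); y \<in> carrier (FOb M X)\<rbrakk>
                 \<Longrightarrow> g X (x \<otimes>\<^bsub>FOb M X\<^esub> y) = g X x \<otimes>\<^bsub>FOb N X\<^esub> g X y"
    and nat: "\<And>X Y f y. \<lbrakk>f \<in> arrows C X Y; y \<in> carrier (FOb M Y)\<rbrakk>
                 \<Longrightarrow> g X (FArr M f y) = FArr N f (g Y y)"
  shows "transf_of M N g \<in> arrows (Mod_cat C) M N"
proof -
  let ?t = "transf_of M N g"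
  have "TMap ?t X \<in> hom (FOb M X) (FOb N X)" if X: "X \<in> Ob C" for X
  proof (rule homI)
    interpret G: comm_group "FOb M X" using functor_group[OF M X] .
    show "TMap ?t X x \<in> carrier (FOb N X)" if "x \<in> carrier (FOb M X)" for x
      using that X closed by simp
    show "TMap ?t X (x \<otimes>\<^bsub>FOb M X\<^esub> y) = TMap ?t X x \<otimes>\<^bsub>FOb N X\<^esub> TMap ?t X y"
      if "x \<in> carrier (FOb M X)" "y \<in> carrier (FOb M X)" for x y
      using that X mult by simp
  qed
  moreover have "TMap ?t X (FArr M f y) = FArr N f (TMap ?t Y y)"
    if "f \<in> arrows C X Y" "y \<in> carrier (FOb M Y)" for X Y f y
    using that nat functor_closed[OF M that] arrows_objects[OF that(1)] by simp
  ultimately show ?thesis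
    using M N unfolding arrows_Mod natural_def by (auto simp: transf_of_def)
qed

lemma transf_functors:
  assumes "t \<in> arrows (Mod_cat C) M N"
  shows "contravariant_additive C M" "contravariant_additive C N"
  using assms by (auto simp: arrows_Mod natural_def)

lemma transf_hom:
  "\<lbrakk>t \<in> arrows (Mod_cat C) M N; X \<in> Ob C\<rbrakk> \<Longrightarrow> TMap t X \<in> hom (FOb M X) (FOb N X)"
  by (auto simp: arrows_Mod natural_def)

lemma transf_closed:
  "\<lbrakk>t \<in> arrows (Mod_cat C) M N; X \<in> Ob C; x \<in> carrier (FOb M X)\<rbrakk>
     \<Longrightarrow> TMap t X x \<in> carrier (FOb N X)"
  by (rule hom_in_carrier[OF transf_hom])

lemma transf_mult:
  "\<lbrakk>t \<in> arrows (Mod_cat C) M N; X \<in> Ob C; x \<in> carrier (FOb M X); y \<in> carrier (FOb M X)\<rbrakk>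
     \<Longrightarrow> TMap t X (x \<otimes>\<^bsub>FOb M X\<^esub> y) = TMap t X x \<otimes>\<^bsub>FOb N X\<^esub> TMap t X y"
  by (rule hom_mult[OF transf_hom])

lemma transf_group_hom:
  assumes "t \<in> arrows (Mod_cat C) M N" "X \<in> Ob C"
  shows "group_hom (FOb M X) (FOb N X) (TMap t X)"
  using transf_hom[OF assms] functor_group[OF transf_functors(1)[OF assms(1)] assms(2)]
    functor_group[OF transf_functors(2)[OF assms(1)] assms(2)]
  by (simp add: group_hom_def group_hom_axioms_def comm_group_def)

lemma transf_one:
  "\<lbrakk>t \<in> arrows (Mod_cat C) M N; X \<in> Ob C\<rbrakk> \<Longrightarrow> TMap t X \<one>\<^bsub>FOb M X\<^esub> = \<one>\<^bsub>FOb N X\<^esub>"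
  using transf_group_hom by (metis group_hom.hom_one)

lemma transf_natural:
  "\<lbrakk>t \<in> arrows (Mod_cat C) M N; f \<in> arrows C X Y; y \<in> carrier (FOb M Y)\<rbrakk>
     \<Longrightarrow> TMap t X (FArr M f y) = FArr N f (TMap t Y y)"
  unfolding arrows_Mod natural_def by blast

lemma transf_eqI:
  assumes "t \<in> arrows (Mod_cat C) M N" "t' \<in> arrows (Mod_cat C) M N"
    and "\<And>X x. \<lbrakk>X \<in> Ob C; x \<in> carrier (FOb M X)\<rbrakk> \<Longrightarrow> TMap t X x = TMap t' X x"
  shows "t = t'"
proof -
  have "TMap t = TMap t'"
  proof (rule extensionalityI)
    show "TMap t \<in> extensional (Ob C)" "TMap t' \<in> extensional (Ob C)"
      using assms(1,2) by (auto simp: arrows_Mod natural_def)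
    show "TMap t X = TMap t' X" if "X \<in> Ob C" for X
      by (rule extensionalityI[of _ "carrier (FOb M X)"])
        (use assms that in \<open>auto simp: arrows_Mod natural_def\<close>)
  qed
  then show ?thesis using assms(1,2) by (auto simp: arrows_Mod)
qed

lemma Comp_Mod: "Comp (Mod_cat C) t s =
    transf_of (TDom s) (TCod t) (\<lambda>X x. TMap t X (TMap s X x))"
  and Plus_Mod: "Plus (Mod_cat C) t s =
    transf_of (TDom t) (TCod t) (\<lambda>X x. TMap t X x \<otimes>\<^bsub>FOb (TCod t) X\<^esub> TMap s X x)"
  and Zero_Mod: "Zero (Mod_cat C) M N = transf_of M N (\<lambda>X x. \<one>\<^bsub>FOb N X\<^esub>)"
  and Ident_Mod: "Ident (Mod_cat C) M = transf_of M M (\<lambda>X x. x)"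
  by (simp_all add: Mod_cat_def transf_of_def)

lemma Comp_Mod_apply [simp]:
  "\<lbrakk>s \<in> arrows (Mod_cat C) L M; X \<in> Ob C; x \<in> carrier (FOb L X)\<rbrakk>
     \<Longrightarrow> TMap (Comp (Mod_cat C) t s) X x = TMap t X (TMap s X x)"
  by (simp add: Comp_Mod arrows_Mod)

lemma Plus_Mod_apply [simp]:
  "\<lbrakk>t \<in> arrows (Mod_cat C) L M; X \<in> Ob C; x \<in> carrier (FOb L X)\<rbrakk>
     \<Longrightarrow> TMap (Plus (Mod_cat C) t s) X x = TMap t X x \<otimes>\<^bsub>FOb M X\<^esub> TMap s X x"
  by (auto simp add: Plus_Mod arrows_Mod)

lemma Zero_Mod_apply [simp]:
  "\<lbrakk>X \<in> Ob C; x \<in> carrier (FOb M X)\<rbrakk> \<Longrightarrow> TMap (Zero (Mod_cat C) M N) X x = \<one>\<^bsub>FOb N X\<^esub>"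
  by (simp add: Zero_Mod)

lemma Ident_Mod_apply [simp]:
  "\<lbrakk>X \<in> Ob C; x \<in> carrier (FOb M X)\<rbrakk> \<Longrightarrow> TMap (Ident (Mod_cat C) M) X x = x"
  by (simp add: Ident_Mod)

lemma Comp_Mod_arrow:
  assumes "s \<in> arrows (Mod_cat C) L M" "t \<in> arrows (Mod_cat C) M N"
  shows "Comp (Mod_cat C) t s \<in> arrows (Mod_cat C) L N"
proof -
  have "Comp (Mod_cat C) t s = transf_of L N (\<lambda>X x. TMap t X (TMap s X x))"
    using assms by (simp add: Comp_Mod arrows_Mod)
  also have "\<dots> \<in> arrows (Mod_cat C) L N"
  proof (rule transf_of_arrow)
    show "TMap t X (TMap s X (FArr L f y)) = FArr N f (TMap t Y (TMap s Y y))"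
      if "f \<in> arrows C X Y" "y \<in> carrier (FOb L Y)" for X Y f y
      using transf_natural[OF assms(1) that]
        transf_natural[OF assms(2) that(1) transf_closed[OF assms(1) _ that(2)]]
        arrows_objects[OF that(1)] by simp
  qed (use assms transf_functors[OF assms(1)] transf_functors[OF assms(2)] transf_closed[OF assms(1)]
       transf_closed[OF assms(2)] transf_mult[OF assms(1)] transf_mult[OF assms(2)] in auto)
  finally show ?thesis .
qed

lemma Plus_Mod_arrow:
  assumes "s \<in> arrows (Mod_cat C) M N" "t \<in> arrows (Mod_cat C) M N"
  shows "Plus (Mod_cat C) s t \<in> arrows (Mod_cat C) M N"
proof -
  note fs = transf_functors[OF assms(1)]
  have "Plus (Mod_cat C) s t = transf_of M N (\<lambda>X x. TMap s X x \<otimes>\<^bsub>FOb N X\<^esub> TMap t X x)"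
    using assms by (auto simp add: Plus_Mod arrows_Mod)
  also have "\<dots> \<in> arrows (Mod_cat C) M N"
  proof (rule transf_of_arrow)
    fix X assume X: "X \<in> Ob C"
    interpret N: comm_group "FOb N X" using functor_group[OF fs(2) X] .
    show "TMap s X x \<otimes>\<^bsub>FOb N X\<^esub> TMap t X x \<in> carrier (FOb N X)" if "x \<in> carrier (FOb M X)" for x
      using transf_closed[OF assms(1) X that] transf_closed[OF assms(2) X that] by simp
    show "TMap s X (x \<otimes>\<^bsub>FOb M X\<^esub> y) \<otimes>\<^bsub>FOb N X\<^esub> TMap t X (x \<otimes>\<^bsub>FOb M X\<^esub> y) =
      TMap s X x \<otimes>\<^bsub>FOb N X\<^esub> TMap t X x \<otimes>\<^bsub>FOb N X\<^esub> (TMap s X y \<otimes>\<^bsub>FOb N X\<^esub> TMap t X y)"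
      if "x \<in> carrier (FOb M X)" "y \<in> carrier (FOb M X)" for x y
      using transf_mult[OF assms(1) X that] transf_mult[OF assms(2) X that]
        transf_closed[OF assms(1) X] transf_closed[OF assms(2) X] that
      by (simp add: N.m_ac)
  next
    fix X Y f y assume f: "f \<in> arrows C X Y" and y: "y \<in> carrier (FOb M Y)"
    show "TMap s X (FArr M f y) \<otimes>\<^bsub>FOb N X\<^esub> TMap t X (FArr M f y) =
       FArr N f (TMap s Y y \<otimes>\<^bsub>FOb N Y\<^esub> TMap t Y y)"
      using transf_natural[OF assms(1) f y] transf_natural[OF assms(2) f y] arrows_objects[OF f]
        functor_mult[OF fs(2) f transf_closed[OF assms(1) _ y] transf_closed[OF assms(2) _ y]]
      by simp
  qed (use fs in auto)
  finally show ?thesis .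
qed

lemma Zero_Mod_arrow:
  assumes "contravariant_additive C M" "contravariant_additive C N"
  shows "Zero (Mod_cat C) M N \<in> arrows (Mod_cat C) M N"
  unfolding Zero_Mod
proof (rule transf_of_arrow[OF assms])
  fix X assume "X \<in> Ob C"
  then interpret N: comm_group "FOb N X" using functor_group assms by blast
  show "\<one>\<^bsub>FOb N X\<^esub> \<in> carrier (FOb N X)" "\<one>\<^bsub>FOb N X\<^esub> = \<one>\<^bsub>FOb N X\<^esub> \<otimes>\<^bsub>FOb N X\<^esub> \<one>\<^bsub>FOb N X\<^esub>"
    by simp_all
qed (use functor_one[OF assms(2)] in auto)

lemma Ident_Mod_arrow:
  "contravariant_additive C M \<Longrightarrow> Ident (Mod_cat C) M \<in> arrows (Mod_cat C) M M"
  unfolding Ident_Mod by (rule transf_of_arrow) auto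

lemma comm_group_Hom_Mod:
  assumes M: "contravariant_additive C M" and N: "contravariant_additive C N"
  shows "comm_group (Hom (Mod_cat C) M N)"
proof (rule comm_groupI; simp only: mult_Hom one_Hom)
  fix r s t
  assume r: "r \<in> arrows (Mod_cat C) M N" and s: "s \<in> arrows (Mod_cat C) M N"
  show "Plus (Mod_cat C) r s \<in> arrows (Mod_cat C) M N" using Plus_Mod_arrow r s .
  note cl = transf_closed[OF r] transf_closed[OF s]
  show "Plus (Mod_cat C) r s = Plus (Mod_cat C) s r"
  proof (rule transf_eqI[OF Plus_Mod_arrow[OF r s] Plus_Mod_arrow[OF s r]])
    fix X x assume X: "X \<in> Ob C" and x: "x \<in> carrier (FOb M X)"
    interpret N: comm_group "FOb N X" using functor_group[OF N X] .
    show "TMap (Plus (Mod_cat C) r s) X x = TMap (Plus (Mod_cat C) s r) X x"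
      using cl[OF X x] N.m_comm Plus_Mod_apply[OF r X x] Plus_Mod_apply[OF s X x] by simp
  qed
  assume t: "t \<in> arrows (Mod_cat C) M N"
  show "Plus (Mod_cat C) (Plus (Mod_cat C) r s) t = Plus (Mod_cat C) r (Plus (Mod_cat C) s t)"
  proof (rule transf_eqI[OF Plus_Mod_arrow[OF Plus_Mod_arrow[OF r s] t]
        Plus_Mod_arrow[OF r Plus_Mod_arrow[OF s t]]])
    fix X x assume X: "X \<in> Ob C" and x: "x \<in> carrier (FOb M X)"
    interpret N: comm_group "FOb N X" using functor_group[OF N X] .
    show "TMap (Plus (Mod_cat C) (Plus (Mod_cat C) r s) t) X x =
        TMap (Plus (Mod_cat C) r (Plus (Mod_cat C) s t)) X x"
      using cl[OF X x] transf_closed[OF t X x] N.m_assoc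
        Plus_Mod_apply[OF r X x] Plus_Mod_apply[OF s X x]
        Plus_Mod_apply[OF Plus_Mod_arrow[OF r s] X x] by simp
  qed
next
  show Z: "Zero (Mod_cat C) M N \<in> arrows (Mod_cat C) M N" using Zero_Mod_arrow M N .
  fix r assume r: "r \<in> arrows (Mod_cat C) M N"
  show "Plus (Mod_cat C) (Zero (Mod_cat C) M N) r = r"
  proof (rule transf_eqI[OF Plus_Mod_arrow[OF Z r] r])
    fix X x assume X: "X \<in> Ob C" and x: "x \<in> carrier (FOb M X)"
    interpret N: comm_group "FOb N X" using functor_group[OF N X] .
    show "TMap (Plus (Mod_cat C) (Zero (Mod_cat C) M N) r) X x = TMap r X x"
      using transf_closed[OF r X x] Plus_Mod_apply[OF Z X x] X x by simp
  qed
  let ?n = "transf_of M N (\<lambda>X x. inv\<^bsub>FOb N X\<^esub> TMap r X x)"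
  have n: "?n \<in> arrows (Mod_cat C) M N"
  proof (rule transf_of_arrow[OF M N])
    fix X assume X: "X \<in> Ob C"
    interpret N: comm_group "FOb N X" using functor_group[OF N X] .
    show "inv\<^bsub>FOb N X\<^esub> TMap r X x \<in> carrier (FOb N X)" if "x \<in> carrier (FOb M X)" for x
      using transf_closed[OF r X that] by simp
    show "inv\<^bsub>FOb N X\<^esub> TMap r X (x \<otimes>\<^bsub>FOb M X\<^esub> y) =
        inv\<^bsub>FOb N X\<^esub> TMap r X x \<otimes>\<^bsub>FOb N X\<^esub> inv\<^bsub>FOb N X\<^esub> TMap r X y"
      if "x \<in> carrier (FOb M X)" "y \<in> carrier (FOb M X)" for x y
      using transf_closed[OF r X] transf_mult[OF r X] that by (simp add: N.inv_mult)
  next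
    fix X Y f y assume f: "f \<in> arrows C X Y" and y: "y \<in> carrier (FOb M Y)"
    interpret h: group_hom "FOb N Y" "FOb N X" "FArr N f"
      using functor_group[OF N] functor_hom[OF N f] arrows_objects[OF f]
      by (simp add: group_hom_def group_hom_axioms_def comm_group_def)
    show "inv\<^bsub>FOb N X\<^esub> TMap r X (FArr M f y) = FArr N f (inv\<^bsub>FOb N Y\<^esub> TMap r Y y)"
      using transf_natural[OF r f y] transf_closed[OF r _ y] arrows_objects[OF f] by simp
  qed
  have "Plus (Mod_cat C) ?n r = Zero (Mod_cat C) M N"
  proof (rule transf_eqI[OF Plus_Mod_arrow[OF n r] Z])
    fix X x assume X: "X \<in> Ob C" and x: "x \<in> carrier (FOb M X)"
    interpret N: comm_group "FOb N X" using functor_group[OF N X] .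
    show "TMap (Plus (Mod_cat C) ?n r) X x = TMap (Zero (Mod_cat C) M N) X x"
      using transf_closed[OF r X x] Plus_Mod_apply[OF n X x] X x by simp
  qed
  with n show "\<exists>n\<in>arrows (Mod_cat C) M N. Plus (Mod_cat C) n r = Zero (Mod_cat C) M N" by blast
qed

lemma preadditive_Mod: "preadditive_category (Mod_cat C)" (is "preadditive_category ?D")
proof (rule preadditive_category.intro)
  fix L M N P r s t s' t'
  show "Dom ?D r \<in> Ob ?D \<and> Cod ?D r \<in> Ob ?D" if "r \<in> Arr ?D"
    using that by (simp add: Mod_cat_def natural_def)
  show "Ident ?D M \<in> arrows ?D M M" if "M \<in> Ob ?D"
    using that Ident_Mod_arrow by (simp add: Mod_cat_def)
  show "comm_group (Hom ?D M N)" if "M \<in> Ob ?D" "N \<in> Ob ?D"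
    using that comm_group_Hom_Mod by (simp add: Mod_cat_def)
  assume r: "r \<in> arrows ?D L M"
  note id = Ident_Mod_arrow transf_functors[OF r]
  show "Comp ?D r (Ident ?D L) = r"
    by (rule transf_eqI[OF Comp_Mod_arrow[OF Ident_Mod_arrow r] r])
      (use transf_functors[OF r] in \<open>auto simp: Comp_Mod_apply[OF Ident_Mod_arrow]\<close>)
  show "Comp ?D (Ident ?D M) r = r"
    by (rule transf_eqI[OF Comp_Mod_arrow[OF r Ident_Mod_arrow] r])
      (use transf_functors[OF r] transf_closed[OF r] in \<open>auto simp: Comp_Mod_apply[OF r]\<close>)
  assume s: "s \<in> arrows ?D M N"
  show rs: "Comp ?D s r \<in> arrows ?D L N" using Comp_Mod_arrow r s .
  show "Comp ?D (Comp ?D t s) r = Comp ?D t (Comp ?D s r)" if t: "t \<in> arrows ?D N P"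
    by (rule transf_eqI[OF Comp_Mod_arrow[OF r Comp_Mod_arrow[OF s t]] Comp_Mod_arrow[OF rs t]])
      (auto simp: Comp_Mod_apply[OF r] Comp_Mod_apply[OF s] Comp_Mod_apply[OF rs] transf_closed[OF r])
  show "Comp ?D (Plus ?D s s') r = Plus ?D (Comp ?D s r) (Comp ?D s' r)"
    if s': "s' \<in> arrows ?D M N"
    by (rule transf_eqI[OF Comp_Mod_arrow[OF r Plus_Mod_arrow[OF s s']]
          Plus_Mod_arrow[OF rs Comp_Mod_arrow[OF r s']]])
      (auto simp: Comp_Mod_apply[OF r] Plus_Mod_apply[OF s] Plus_Mod_apply[OF rs] transf_closed[OF r])
  show "Comp ?D s (Plus ?D r t') = Plus ?D (Comp ?D s r) (Comp ?D s t')"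
    if t': "t' \<in> arrows ?D L M"
    by (rule transf_eqI[OF Comp_Mod_arrow[OF Plus_Mod_arrow[OF r t'] s]
          Plus_Mod_arrow[OF rs Comp_Mod_arrow[OF t' s]]])
      (auto simp: Comp_Mod_apply[OF r] Comp_Mod_apply[OF t'] Comp_Mod_apply[OF Plus_Mod_arrow[OF r t']]
         Plus_Mod_apply[OF r] Plus_Mod_apply[OF rs] transf_closed[OF r] transf_closed[OF t']
         transf_mult[OF s])
qed

end

section \<open>Presentations by generators and relations\<close>

context preadditive_category
begin

lemma image_at_yoneda:
  assumes f: "f \<in> arrows C A B" and X: "X \<in> Ob C"
  shows "image_at (yoneda_map C f) X = (\<lambda>w. f \<cdot> w) ` arrows C X A"
proof -
  have "Dom C f = A" using f by (simp add: mem_arrows)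
  then show ?thesis using X by (auto simp: image_at_def yoneda_map_def yoneda_def)
qed

lemma relations_normal:
  assumes f: "f \<in> arrows C A B" and X: "X \<in> Ob C"
  shows "image_at (yoneda_map C f) X \<lhd> Hom C X B"
proof -
  have AB: "A \<in> Ob C" "B \<in> Ob C" using arrows_objects[OF f] by auto
  have "(\<lambda>w. f \<cdot> w) \<in> hom (Hom C X A) (Hom C X B)"
    by (rule homI) (use f comp comp_add_right in auto)
  then interpret h: group_hom "Hom C X A" "Hom C X B" "\<lambda>w. f \<cdot> w"
    using hom_group X AB by (simp add: group_hom_def group_hom_axioms_def comm_group_def)
  have "subgroup ((\<lambda>w. f \<cdot> w) ` arrows C X A) (Hom C X B)"
    using h.img_is_subgroup by blast
  then show ?thesis
    using comm_group.normal_iff_subgroup[OF hom_group[OF X AB(2)]] image_at_yoneda[OF f X] by simp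
qed

lemma mem_relations_coset:
  assumes f: "f \<in> arrows C A B" and X: "X \<in> Ob C"
  shows "z \<in> image_at (yoneda_map C f) X #>\<^bsub>Hom C X B\<^esub> z' \<longleftrightarrow>
           (\<exists>w\<in>arrows C X A. z = Plus C (f \<cdot> w) z')"
  by (auto simp: r_coset_def image_at_yoneda[OF f X])

lemma relations_coset_eq_iff:
  assumes f: "f \<in> arrows C A B" and z: "z \<in> arrows C X B" and z': "z' \<in> arrows C X B"
  shows "image_at (yoneda_map C f) X #>\<^bsub>Hom C X B\<^esub> z = image_at (yoneda_map C f) X #>\<^bsub>Hom C X B\<^esub> z'
           \<longleftrightarrow> (\<exists>w\<in>arrows C X A. z = Plus C (f \<cdot> w) z')"
proof -
  have X: "X \<in> Ob C" using arrows_objects[OF z] by simp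
  interpret N: normal "image_at (yoneda_map C f) X" "Hom C X B" using relations_normal[OF f X] .
  show ?thesis
    using N.repr_independence[OF _ z' N.subgroup_axioms, of z] N.repr_independenceD[OF N.subgroup_axioms z, of z']
      mem_relations_coset[OF f X] by metis
qed

text \<open>The images of the elements of a coset need not exhaust a coset, but adding all relations at
  \<open>X\<close> to them gives one, because relations restrict to relations.\<close>

lemma coker_funct_coset:
  assumes f: "f \<in> arrows C A B" and h: "h \<in> arrows C X Y" and z: "z \<in> arrows C Y B"
  shows "FArr (coker_funct C (yoneda_map C f)) h (image_at (yoneda_map C f) Y #>\<^bsub>Hom C Y B\<^esub> z)
           = image_at (yoneda_map C f) X #>\<^bsub>Hom C X B\<^esub> (z \<cdot> h)" (is "?L = ?R")
proof -
  have XY: "X \<in> Ob C" "Y \<in> Ob C" using arrows_objects[OF h] by auto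
  have zh: "z \<cdot> h \<in> arrows C X B" using comp h z .
  have cod: "Dom C h = X" "TCod (yoneda_map C f) = yoneda C B" "FOb (yoneda C B) X = Hom C X B"
    "FArr (yoneda C B) h = (\<lambda>g. g \<cdot> h)"
    using f h by (auto simp: mem_arrows yoneda_map_def yoneda_def)
  have L: "?L = (\<Union>w\<in>arrows C X A. \<Union>w'\<in>arrows C Y A. {Plus C (f \<cdot> w) (Plus C (f \<cdot> w') z \<cdot> h)})"
    using cod by (auto simp: coker_funct_def image_at_yoneda[OF f] XY set_mult_def r_coset_def)
  have R: "?R = (\<Union>w\<in>arrows C X A. {Plus C (f \<cdot> w) (z \<cdot> h)})"
    by (auto simp: r_coset_def image_at_yoneda[OF f] XY)
  have step: "Plus C (f \<cdot> w) (Plus C (f \<cdot> w') z \<cdot> h) = Plus C (f \<cdot> Plus C w (w' \<cdot> h)) (z \<cdot> h)"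
    if w: "w \<in> arrows C X A" and w': "w' \<in> arrows C Y A" for w w'
  proof -
    have "Plus C (f \<cdot> w') z \<cdot> h = Plus C (f \<cdot> (w' \<cdot> h)) (z \<cdot> h)"
      using comp_add_left[OF h comp[OF w' f] z] assoc[OF h w' f] by simp
    then show ?thesis
      using plus_ac(2)[OF comp[OF w f] comp[OF comp[OF h w'] f] zh]
        comp_add_right[OF w comp[OF h w'] f] by simp
  qed
  show ?thesis
  proof
    show "?L \<subseteq> ?R"
    proof
      fix v assume "v \<in> ?L"
      then obtain w w' where w: "w \<in> arrows C X A" "w' \<in> arrows C Y A"
        and v: "v = Plus C (f \<cdot> w) (Plus C (f \<cdot> w') z \<cdot> h)"
        unfolding L by blast
      have "Plus C w (w' \<cdot> h) \<in> arrows C X A" using plus_arrows[OF w(1) comp[OF h w(2)]] .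
      then show "v \<in> ?R" unfolding R v step[OF w] by blast
    qed
    show "?R \<subseteq> ?L"
    proof
      fix v assume "v \<in> ?R"
      then obtain w where w: "w \<in> arrows C X A" and v: "v = Plus C (f \<cdot> w) (z \<cdot> h)"
        unfolding R by blast
      have z0: "Zero C Y A \<in> arrows C Y A" using zero_arrows XY arrows_objects[OF f] by blast
      have "v = Plus C (f \<cdot> w) (Plus C (f \<cdot> Zero C Y A) z \<cdot> h)"
        using step[OF w z0] v comp_zero(2)[OF h, of A] arrows_objects[OF f] plus_zero[OF w] by simp
      then show "v \<in> ?L" unfolding L using w z0 by blast
    qed
  qed
qed

text \<open>An element \<open>m\<close> of \<open>M (Cod f)\<close> corresponds by the Yoneda lemma to a transformation from
  \<open>Hom(-, Cod f)\<close> to \<open>M\<close>; the two clauses say that this transformation is onto with kernel the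
  image of \<open>Hom(-, f)\<close>. Thus \<open>M\<close> is generated by \<open>m\<close> subject to the single relation that \<open>f\<close>
  kills \<open>m\<close>.\<close>

definition presents :: "('o, 'm, 'v) funct \<Rightarrow> 'm \<Rightarrow> 'v \<Rightarrow> bool" where
  "presents M f m \<longleftrightarrow> contravariant_additive C M \<and> f \<in> Arr C \<and> m \<in> carrier (FOb M (Cod C f)) \<and>
     (\<forall>X\<in>Ob C. \<forall>x\<in>carrier (FOb M X). \<exists>z\<in>arrows C X (Cod C f). x = FArr M z m) \<and>
     (\<forall>X. \<forall>z\<in>arrows C X (Cod C f).
        FArr M z m = \<one>\<^bsub>FOb M X\<^esub> \<longleftrightarrow> (\<exists>w\<in>arrows C X (Dom C f). z = f \<cdot> w))"

lemma presentsI: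
  assumes "contravariant_additive C M" "f \<in> arrows C A B" "m \<in> carrier (FOb M B)"
    and "\<And>X x. \<lbrakk>X \<in> Ob C; x \<in> carrier (FOb M X)\<rbrakk> \<Longrightarrow> \<exists>z\<in>arrows C X B. x = FArr M z m"
    and "\<And>X z. z \<in> arrows C X B \<Longrightarrow>
           FArr M z m = \<one>\<^bsub>FOb M X\<^esub> \<longleftrightarrow> (\<exists>w\<in>arrows C X A. z = f \<cdot> w)"
  shows "presents M f m"
proof -
  have "f \<in> Arr C" "Dom C f = A" "Cod C f = B" using assms(2) by (auto simp: mem_arrows)
  then show ?thesis using assms(1,3-5) unfolding presents_def by blast
qed

lemma presents_functor: "presents M f m \<Longrightarrow> contravariant_additive C M"
  by (simp add: presents_def)

lemma presents_arrow: "presents M f m \<Longrightarrow> f \<in> arrows C (Dom C f) (Cod C f)"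
  by (simp add: presents_def Arr_arrows)

lemma presents_generator:
  "\<lbrakk>presents M f m; f \<in> arrows C A B\<rbrakk> \<Longrightarrow> m \<in> carrier (FOb M B)"
  by (auto simp: presents_def mem_arrows)

lemma presents_generates:
  assumes "presents M f m" "f \<in> arrows C A B" "X \<in> Ob C" "x \<in> carrier (FOb M X)"
  obtains z where "z \<in> arrows C X B" "x = FArr M z m"
proof -
  have "Cod C f = B" using assms(2) by (simp add: mem_arrows)
  then show thesis using assms(1,3,4) that unfolding presents_def by blast
qed

lemma presents_relations:
  assumes "presents M f m" "f \<in> arrows C A B" "z \<in> arrows C X B"
  shows "FArr M z m = \<one>\<^bsub>FOb M X\<^esub> \<longleftrightarrow> (\<exists>w\<in>arrows C X A. z = f \<cdot> w)"
proof -
  have "Dom C f = A" "Cod C f = B" using assms(2) by (auto simp: mem_arrows)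
  then show ?thesis using assms(1,3) unfolding presents_def by blast
qed

lemma presents_kills:
  assumes M: "presents M f m" and f: "f \<in> arrows C A B"
  shows "FArr M f m = \<one>\<^bsub>FOb M A\<^esub>"
  using presents_relations[OF M f f] ident ident_right[OF f] arrows_objects[OF f] by metis

lemma presents_eq_iff:
  assumes M: "presents M f m" and f: "f \<in> arrows C A B"
    and z: "z \<in> arrows C X B" and z': "z' \<in> arrows C X B"
  shows "FArr M z m = FArr M z' m \<longleftrightarrow> (\<exists>w\<in>arrows C X A. z = Plus C (f \<cdot> w) z')"
proof -
  have X: "X \<in> Ob C" using arrows_objects[OF z] by simp
  note fn = presents_functor[OF M] and m = presents_generator[OF M f]
  interpret G: comm_group "FOb M X" using functor_group[OF fn X] .
  note cl = functor_closed[OF fn _ m]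
  obtain n where n: "n \<in> arrows C X B" "Plus C z' n = Zero C X B" "Plus C n z' = Zero C X B"
    using ex_negative[OF z'] by blast
  show ?thesis
  proof
    assume eq: "FArr M z m = FArr M z' m"
    have "FArr M (Plus C z n) m = FArr M (Plus C z' n) m"
      using functor_plus[OF fn z n(1) m] functor_plus[OF fn z' n(1) m] eq by simp
    also have "\<dots> = \<one>\<^bsub>FOb M X\<^esub>"
      using n(2) functor_zero[OF fn X _ m] arrows_objects[OF f] by simp
    finally obtain w where w: "w \<in> arrows C X A" "Plus C z n = f \<cdot> w"
      using presents_relations[OF M f plus_arrows[OF z n(1)]] by blast
    have "z = Plus C (f \<cdot> w) z'"
      using plus_ac(2)[OF z n(1) z'] n(3) plus_zero[OF z] w(2) by simp
    with w(1) show "\<exists>w\<in>arrows C X A. z = Plus C (f \<cdot> w) z'" by blast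
  next
    assume "\<exists>w\<in>arrows C X A. z = Plus C (f \<cdot> w) z'"
    then obtain w where w: "w \<in> arrows C X A" "z = Plus C (f \<cdot> w) z'" by blast
    have fw: "f \<cdot> w \<in> arrows C X B" using comp w f by blast
    have "FArr M (f \<cdot> w) m = \<one>\<^bsub>FOb M X\<^esub>" using presents_relations[OF M f fw] w by blast
    then show "FArr M z m = FArr M z' m"
      using functor_plus[OF fn fw z' m] w(2) cl[OF z'] by simp
  qed
qed

text \<open>The generator is the element that corresponds to the coset of the identity of \<open>B\<close>.\<close>

lemma funct_iso_imp_presents:
  assumes M: "contravariant_additive C M" and f: "f \<in> arrows C A B"
    and iso: "funct_iso C M (coker_funct C (yoneda_map C f))"
  shows "\<exists>m. presents M f m"
proof -
  let ?I = "image_at (yoneda_map C f)" and ?Q = "coker_funct C (yoneda_map C f)"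
  have B: "B \<in> Ob C" and Cf: "Cod C f = B" using arrows_objects[OF f] f by (auto simp: mem_arrows)
  have Q: "FOb ?Q X = Hom C X B Mod ?I X" for X
    using Cf by (simp add: coker_funct_def yoneda_map_def yoneda_def)
  obtain \<phi> where \<phi>: "\<And>X. X \<in> Ob C \<Longrightarrow> \<phi> X \<in> iso (FOb M X) (FOb ?Q X)"
    and nat: "\<And>X Y h y. \<lbrakk>h \<in> arrows C X Y; y \<in> carrier (FOb M Y)\<rbrakk>
                \<Longrightarrow> \<phi> X (FArr M h y) = FArr ?Q h (\<phi> Y y)"
    using iso unfolding funct_iso_def by blast
  have bij: "bij_betw (\<phi> X) (carrier (FOb M X)) (rcosets\<^bsub>Hom C X B\<^esub> (?I X))" if "X \<in> Ob C" for X
    using \<phi>[OF that] by (simp add: iso_def Q FactGroup_def)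
  have id: "Ident C B \<in> arrows C B B" using ident B .
  have "?I B #>\<^bsub>Hom C B B\<^esub> Ident C B \<in> rcosets\<^bsub>Hom C B B\<^esub> (?I B)"
    using id by (auto simp: RCOSETS_def)
  then obtain m where m: "m \<in> carrier (FOb M B)" "\<phi> B m = ?I B #>\<^bsub>Hom C B B\<^esub> Ident C B"
    using bij[OF B] by (metis bij_betw_imp_surj_on imageE)
  have gen: "\<phi> X (FArr M z m) = ?I X #>\<^bsub>Hom C X B\<^esub> z" if z: "z \<in> arrows C X B" for X z
    using nat[OF z m(1)] coker_funct_coset[OF f z id] ident_left[OF z] m(2) by simp
  have "presents M f m"
  proof (rule presentsI[OF M f m(1)])
    fix X x assume X: "X \<in> Ob C" and x: "x \<in> carrier (FOb M X)"
    obtain z where z: "z \<in> arrows C X B" "\<phi> X x = ?I X #>\<^bsub>Hom C X B\<^esub> z"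
      using bij_betw_apply[OF bij[OF X] x] by (auto simp: RCOSETS_def)
    then have "x = FArr M z m"
      using bij_betw_imp_inj_on[OF bij[OF X]] gen[OF z(1)] functor_closed[OF M z(1) m(1)] x
      by (metis inj_on_def)
    with z(1) show "\<exists>z\<in>arrows C X B. x = FArr M z m" by blast
  next
    fix X z assume z: "z \<in> arrows C X B"
    then have X: "X \<in> Ob C" using arrows_objects by blast
    interpret N: normal "?I X" "Hom C X B" using relations_normal[OF f X] .
    interpret G: comm_group "FOb M X" using functor_group[OF M X] .
    interpret Q: group "Hom C X B Mod ?I X" by (rule N.factorgroup_is_group)
    have "\<phi> X \<in> hom (FOb M X) (Hom C X B Mod ?I X)" using \<phi>[OF X] by (simp add: iso_def Q)
    then have one: "\<phi> X \<one>\<^bsub>FOb M X\<^esub> = ?I X"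
      using hom_one[OF _ G.is_group Q.is_group] by simp
    have "FArr M z m = \<one>\<^bsub>FOb M X\<^esub> \<longleftrightarrow> \<phi> X (FArr M z m) = ?I X"
      using bij_betw_imp_inj_on[OF bij[OF X]] functor_closed[OF M z m(1)] one
      by (metis G.one_closed inj_on_def)
    also have "\<dots> \<longleftrightarrow> z \<in> ?I X"
      using gen[OF z] N.coset_join1[OF _ z N.subgroup_axioms] N.coset_join2[OF z N.subgroup_axioms]
      by auto
    also have "\<dots> \<longleftrightarrow> (\<exists>w\<in>arrows C X A. z = f \<cdot> w)"
      using image_at_yoneda[OF f X] by auto
    finally show "FArr M z m = \<one>\<^bsub>FOb M X\<^esub> \<longleftrightarrow> (\<exists>w\<in>arrows C X A. z = f \<cdot> w)" .
  qed
  then show ?thesis by blast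
qed

text \<open>The elements of the cokernel are the cosets of the image of \<open>Hom(-, f)\<close>, and \<open>x\<close> corresponds
  to the coset of all arrows that carry \<open>m\<close> to \<open>x\<close>.\<close>

lemma presents_imp_funct_iso:
  assumes pr: "presents M f m"
  shows "funct_iso C M (coker_funct C (yoneda_map C f))"
proof -
  let ?I = "image_at (yoneda_map C f)" and ?Q = "coker_funct C (yoneda_map C f)"
  define A B where "A = Dom C f" and "B = Cod C f"
  have f: "f \<in> arrows C A B" using presents_arrow[OF pr] by (simp add: A_def B_def)
  note M = presents_functor[OF pr] and m = presents_generator[OF pr f]
  have Q: "FOb ?Q X = Hom C X B Mod ?I X" for X
    by (simp add: coker_funct_def yoneda_map_def yoneda_def B_def)
  define \<phi> where "\<phi> X x = {z \<in> arrows C X B. FArr M z m = x}" for X x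
  have gen: "\<phi> X (FArr M z m) = ?I X #>\<^bsub>Hom C X B\<^esub> z" if z: "z \<in> arrows C X B" for X z
  proof -
    have X: "X \<in> Ob C" using arrows_objects[OF z] by simp
    have "y \<in> \<phi> X (FArr M z m) \<longleftrightarrow> (\<exists>w\<in>arrows C X A. y = Plus C (f \<cdot> w) z)" for y
      using presents_eq_iff[OF pr f _ z, of y] plus_arrows[OF comp[OF _ f] z] by (auto simp: \<phi>_def)
    then show ?thesis
      using mem_relations_coset[OF f X, of _ z] by auto
  qed
  show ?thesis unfolding funct_iso_def
  proof (intro exI[of _ \<phi>] conjI allI ballI)
    fix X assume X: "X \<in> Ob C"
    interpret N: normal "?I X" "Hom C X B" using relations_normal[OF f X] .
    show "\<phi> X \<in> iso (FOb M X) (FOb ?Q X)"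
    proof (rule isoI)
      show "\<phi> X \<in> hom (FOb M X) (FOb ?Q X)"
      proof (rule homI)
        fix x assume x: "x \<in> carrier (FOb M X)"
        obtain z where z: "z \<in> arrows C X B" "x = FArr M z m"
          using presents_generates[OF pr f X x] by blast
        then show "\<phi> X x \<in> carrier (FOb ?Q X)"
          using gen by (auto simp: Q FactGroup_def RCOSETS_def)
        fix y assume y: "y \<in> carrier (FOb M X)"
        obtain z' where z': "z' \<in> arrows C X B" "y = FArr M z' m"
          using presents_generates[OF pr f X y] by blast
        have "x \<otimes>\<^bsub>FOb M X\<^esub> y = FArr M (Plus C z z') m"
          using functor_plus[OF M z(1) z'(1) m] z z' by simp
        then show "\<phi> X (x \<otimes>\<^bsub>FOb M X\<^esub> y) = \<phi> X x \<otimes>\<^bsub>FOb ?Q X\<^esub> \<phi> X y"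
          using gen[OF plus_arrows[OF z(1) z'(1)]] gen[OF z(1)] gen[OF z'(1)] z(2) z'(2)
            N.rcos_sum[OF z(1) z'(1)] by (simp add: Q)
      qed
      show "bij_betw (\<phi> X) (carrier (FOb M X)) (carrier (FOb ?Q X))"
        unfolding bij_betw_def
      proof
        show "inj_on (\<phi> X) (carrier (FOb M X))"
        proof (rule inj_onI)
          fix x y assume x: "x \<in> carrier (FOb M X)" and eq: "\<phi> X x = \<phi> X y"
          obtain z where "z \<in> arrows C X B" "x = FArr M z m"
            using presents_generates[OF pr f X x] by blast
          then have "z \<in> \<phi> X y" using eq by (auto simp: \<phi>_def)
          then show "x = y" using \<open>x = FArr M z m\<close> by (simp add: \<phi>_def)
        qed
        have "c \<in> \<phi> X ` carrier (FOb M X)" if c: "c \<in> carrier (FOb ?Q X)" for c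
        proof -
          obtain z where z: "z \<in> arrows C X B" "c = ?I X #>\<^bsub>Hom C X B\<^esub> z"
            using c unfolding Q FactGroup_def RCOSETS_def by auto
          then show ?thesis using gen[OF z(1)] functor_closed[OF M z(1) m] by auto
        qed
        moreover have "\<phi> X ` carrier (FOb M X) \<subseteq> carrier (FOb ?Q X)"
          using \<open>\<phi> X \<in> hom (FOb M X) (FOb ?Q X)\<close> by (rule hom_carrier)
        ultimately show "\<phi> X ` carrier (FOb M X) = carrier (FOb ?Q X)" by blast
      qed
    qed
  next
    fix X Y h y assume h: "h \<in> arrows C X Y" and y: "y \<in> carrier (FOb M Y)"
    have Y: "Y \<in> Ob C" using arrows_objects[OF h] by simp
    obtain z where z: "z \<in> arrows C Y B" "y = FArr M z m"
      using presents_generates[OF pr f Y y] by blast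
    have "FArr M h y = FArr M (z \<cdot> h) m" using functor_comp[OF M h z(1) m] z(2) by simp
    then show "\<phi> X (FArr M h y) = FArr ?Q h (\<phi> Y y)"
      using gen[OF comp[OF h z(1)]] coker_funct_coset[OF f h z(1)] gen[OF z(1)] z(2) by simp
  qed
qed

lemma finitely_presented_iff: "finitely_presented C M \<longleftrightarrow> (\<exists>f m. presents M f m)"
proof
  assume "finitely_presented C M"
  then obtain f where "contravariant_additive C M" "f \<in> Arr C"
    "funct_iso C M (coker_funct C (yoneda_map C f))" by (auto simp: finitely_presented_def)
  then show "\<exists>f m. presents M f m" using funct_iso_imp_presents[OF _ Arr_arrows] by blast
next
  assume "\<exists>f m. presents M f m"
  then show "finitely_presented C M"
    unfolding finitely_presented_def
    using presents_imp_funct_iso presents_functor presents_arrow by (meson mem_arrows)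
qed

text \<open>The transformation sends \<open>M z m\<close> to \<open>N z n\<close>. This is well defined: two arrows with the same
  \<open>M z m\<close> differ by a multiple of \<open>f\<close>, and \<open>f\<close> kills \<open>n\<close>.\<close>

lemma ex_transf_of_generator:
  assumes pr: "presents M f m" and f: "f \<in> arrows C A B" and N: "contravariant_additive C N"
    and n: "n \<in> carrier (FOb N B)" and rel: "FArr N f n = \<one>\<^bsub>FOb N A\<^esub>"
  obtains t where "t \<in> arrows (Mod_cat C) M N" "TMap t B m = n"
proof -
  note M = presents_functor[OF pr] and m = presents_generator[OF pr f]
  define g where "g X x = FArr N (SOME z. z \<in> arrows C X B \<and> x = FArr M z m) n" for X x
  have g: "g X (FArr M z m) = FArr N z n" if z: "z \<in> arrows C X B" for X z
  proof -
    let ?y = "SOME y. y \<in> arrows C X B \<and> FArr M z m = FArr M y m"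
    have X: "X \<in> Ob C" using arrows_objects[OF z] by simp
    interpret G: comm_group "FOb N X" using functor_group[OF N X] .
    have y: "?y \<in> arrows C X B \<and> FArr M z m = FArr M ?y m"
      by (rule someI[of _ z]) (use z in auto)
    then obtain w where w: "w \<in> arrows C X A" "?y = Plus C (f \<cdot> w) z"
      using presents_eq_iff[OF pr f _ z, of ?y] by metis
    have "FArr N ?y n = FArr N (f \<cdot> w) n \<otimes>\<^bsub>FOb N X\<^esub> FArr N z n"
      using functor_plus[OF N comp[OF w(1) f] z n] w(2) by simp
    also have "FArr N (f \<cdot> w) n = \<one>\<^bsub>FOb N X\<^esub>"
      using functor_comp[OF N w(1) f n] rel functor_one[OF N w(1)] by simp
    finally show ?thesis using functor_closed[OF N z n] by (simp add: g_def)
  qed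
  have "transf_of M N g \<in> arrows (Mod_cat C) M N"
  proof (rule transf_of_arrow[OF M N])
    fix X x assume X: "X \<in> Ob C" and x: "x \<in> carrier (FOb M X)"
    obtain z where z: "z \<in> arrows C X B" "x = FArr M z m"
      using presents_generates[OF pr f X x] by blast
    show "g X x \<in> carrier (FOb N X)" using g[OF z(1)] functor_closed[OF N z(1) n] z(2) by simp
    fix y assume y: "y \<in> carrier (FOb M X)"
    obtain z' where z': "z' \<in> arrows C X B" "y = FArr M z' m"
      using presents_generates[OF pr f X y] by blast
    show "g X (x \<otimes>\<^bsub>FOb M X\<^esub> y) = g X x \<otimes>\<^bsub>FOb N X\<^esub> g X y"
      using functor_plus[OF M z(1) z'(1) m] functor_plus[OF N z(1) z'(1) n]
        g[OF z(1)] g[OF z'(1)] g[OF plus_arrows[OF z(1) z'(1)]] z(2) z'(2) by simp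
  next
    fix X Y h y assume h: "h \<in> arrows C X Y" and y: "y \<in> carrier (FOb M Y)"
    have Y: "Y \<in> Ob C" using arrows_objects[OF h] by simp
    obtain z where z: "z \<in> arrows C Y B" "y = FArr M z m"
      using presents_generates[OF pr f Y y] by blast
    show "g X (FArr M h y) = FArr N h (g Y y)"
      using functor_comp[OF M h z(1) m] functor_comp[OF N h z(1) n] g[OF z(1)] g[OF comp[OF h z(1)]] z(2)
      by simp
  qed
  moreover have "TMap (transf_of M N g) B m = n"
    using g[OF ident] arrows_objects[OF f] functor_ident[OF M _ m] functor_ident[OF N _ n] m by simp
  ultimately show thesis using that by blast
qed

lemma transf_at_generated:
  assumes pr: "presents M f m" and f: "f \<in> arrows C A B" and t: "t \<in> arrows (Mod_cat C) M N"
    and z: "z \<in> arrows C X B"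
  shows "TMap t X (FArr M z m) = FArr N z (TMap t B m)"
  using transf_natural[OF t z presents_generator[OF pr f]] .

lemma transf_eq_generator:
  assumes pr: "presents M f m" and f: "f \<in> arrows C A B"
    and t: "t \<in> arrows (Mod_cat C) M N" and t': "t' \<in> arrows (Mod_cat C) M N"
    and eq: "TMap t B m = TMap t' B m"
  shows "t = t'"
proof (rule transf_eqI[OF t t'])
  fix X x assume X: "X \<in> Ob C" and x: "x \<in> carrier (FOb M X)"
  obtain z where z: "z \<in> arrows C X B" "x = FArr M z m"
    using presents_generates[OF pr f X x] by blast
  then show "TMap t X x = TMap t' X x"
    using transf_at_generated[OF pr f t z(1)] transf_at_generated[OF pr f t' z(1)] eq by simp
qed

lemma presents_transport:
  assumes pr: "presents M f m" and f: "f \<in> arrows C A B" and t: "t \<in> arrows (Mod_cat C) M N"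
    and bij: "\<And>X. X \<in> Ob C \<Longrightarrow> bij_betw (TMap t X) (carrier (FOb M X)) (carrier (FOb N X))"
  shows "presents N f (TMap t B m)"
proof (rule presentsI[OF transf_functors(2)[OF t] f])
  note M = presents_functor[OF pr] and m = presents_generator[OF pr f]
  show "TMap t B m \<in> carrier (FOb N B)" using transf_closed[OF t _ m] arrows_objects[OF f] by blast
  show "\<exists>z\<in>arrows C X B. y = FArr N z (TMap t B m)"
    if X: "X \<in> Ob C" and y: "y \<in> carrier (FOb N X)" for X y
  proof -
    obtain x where x: "x \<in> carrier (FOb M X)" "y = TMap t X x"
      using bij_betw_imp_surj_on[OF bij[OF X]] y by blast
    obtain z where "z \<in> arrows C X B" "x = FArr M z m"
      using presents_generates[OF pr f X x(1)] by blast
    then show ?thesis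
      using transf_at_generated[OF pr f t] x(2) by blast
  qed
  fix X z assume z: "z \<in> arrows C X B"
  have X: "X \<in> Ob C" using arrows_objects[OF z] by simp
  interpret h: group_hom "FOb M X" "FOb N X" "TMap t X" using transf_group_hom[OF t X] .
  have "FArr N z (TMap t B m) = \<one>\<^bsub>FOb N X\<^esub> \<longleftrightarrow> TMap t X (FArr M z m) = TMap t X \<one>\<^bsub>FOb M X\<^esub>"
    using transf_at_generated[OF pr f t z] by simp
  also have "\<dots> \<longleftrightarrow> FArr M z m = \<one>\<^bsub>FOb M X\<^esub>"
    using bij_betw_imp_inj_on[OF bij[OF X]] functor_closed[OF M z m] by (metis h.G.one_closed inj_on_def)
  finally show "FArr N z (TMap t B m) = \<one>\<^bsub>FOb N X\<^esub> \<longleftrightarrow> (\<exists>w\<in>arrows C X A. z = f \<cdot> w)"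
    using presents_relations[OF pr f z] by simp
qed

text \<open>A presentation depends on \<open>f\<close> only through the image of \<open>Hom(-, f)\<close>. This is how a relation
  will be replaced by a deflation.\<close>

lemma presents_same_relations:
  assumes pr: "presents M f m" and f: "f \<in> arrows C A B" and g: "g \<in> arrows C A' B"
    and same: "\<And>X z. z \<in> arrows C X B \<Longrightarrow>
           (\<exists>w\<in>arrows C X A. z = f \<cdot> w) \<longleftrightarrow> (\<exists>w\<in>arrows C X A'. z = g \<cdot> w)"
  shows "presents M g m"
proof (rule presentsI[OF presents_functor[OF pr] g presents_generator[OF pr f]])
  show "\<exists>z\<in>arrows C X B. x = FArr M z m" if "X \<in> Ob C" "x \<in> carrier (FOb M X)" for X x
    using presents_generates[OF pr f that] by blast
qed (use presents_relations[OF pr f] same in blast)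

text \<open>The cokernel of \<open>Hom(-, f)\<close> has sets of arrows as elements. Naming each coset by the image
  under \<open>u\<close> of a chosen representative moves it into the universe \<open>'v\<close>.\<close>

lemma ex_presented:
  fixes u :: "'m \<Rightarrow> 'v"
  assumes u: "inj_on u (Arr C)" and f: "f \<in> arrows C A B"
  obtains M :: "('o, 'm, 'v) funct" and m where "presents M f m"
proof -
  let ?I = "image_at (yoneda_map C f)"
  have A: "A \<in> Ob C" and B: "B \<in> Ob C" using arrows_objects[OF f] by auto
  define e where "e X z = u (SOME y. y \<in> ?I X #>\<^bsub>Hom C X B\<^esub> z)" for X z
  have e_eq: "e X z = e X z' \<longleftrightarrow> (\<exists>w\<in>arrows C X A. z = Plus C (f \<cdot> w) z')"
    if z: "z \<in> arrows C X B" and z': "z' \<in> arrows C X B" for X z z'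
  proof -
    have X: "X \<in> Ob C" using arrows_objects[OF z] by simp
    interpret N: normal "?I X" "Hom C X B" using relations_normal[OF f X] .
    let ?c = "\<lambda>z. ?I X #>\<^bsub>Hom C X B\<^esub> z"
    have some: "(SOME y. y \<in> ?c z) \<in> ?c z" if "z \<in> arrows C X B" for z
      using N.rcos_self[OF that N.subgroup_axioms] by (rule someI)
    have arr: "y \<in> arrows C X B" if "z \<in> arrows C X B" "y \<in> ?c z" for y z
      using mem_relations_coset[OF f X, of y z] that plus_arrows[OF comp[OF _ f]] by blast
    have "e X z = e X z' \<longleftrightarrow> (SOME y. y \<in> ?c z) = (SOME y. y \<in> ?c z')"
      using inj_on_eq_iff[OF u] arr some z z' unfolding e_def by (metis mem_arrows)
    also have "\<dots> \<longleftrightarrow> ?c z = ?c z'"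
      using some[OF z] some[OF z'] N.repr_independence[OF _ _ N.subgroup_axioms] z z' by metis
    finally show ?thesis using relations_coset_eq_iff[OF f z z'] by simp
  qed
  have e_plus: "e X (Plus C z y) = e X (Plus C z' y')"
    if z: "z \<in> arrows C X B" "z' \<in> arrows C X B" and y: "y \<in> arrows C X B" "y' \<in> arrows C X B"
      and eq: "e X z = e X z'" "e X y = e X y'" for X z z' y y'
  proof -
    interpret H: comm_group "Hom C X B" using hom_group arrows_objects[OF z(1)] by blast
    obtain w w' where w: "w \<in> arrows C X A" "w' \<in> arrows C X A"
      "z = Plus C (f \<cdot> w) z'" "y = Plus C (f \<cdot> w') y'"
      using e_eq[OF z] e_eq[OF y] eq by blast
    note fw = comp[OF w(1) f] comp[OF w(2) f]
    have "Plus C (Plus C (f \<cdot> w) z') (Plus C (f \<cdot> w') y') =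
        Plus C (Plus C (f \<cdot> w) (f \<cdot> w')) (Plus C z' y')"
      using H.m_comm[OF fw(2) z(2)] H.m_assoc fw z(2) y(2) plus_arrows by (metis mult_Hom)
    then have "Plus C z y = Plus C (f \<cdot> Plus C w w') (Plus C z' y')"
      using w(3,4) comp_add_right[OF w(1,2) f] by simp
    then show ?thesis
      using e_eq[OF plus_arrows[OF z(1) y(1)] plus_arrows[OF z(2) y(2)]] plus_arrows[OF w(1,2)] by blast
  qed
  have e_comp: "e X (z \<cdot> h) = e X (z' \<cdot> h)"
    if h: "h \<in> arrows C X Y" and z: "z \<in> arrows C Y B" "z' \<in> arrows C Y B" and eq: "e Y z = e Y z'"
    for X Y h z z'
  proof -
    obtain w where w: "w \<in> arrows C Y A" "z = Plus C (f \<cdot> w) z'" using e_eq[OF z] eq by blast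
    have "z \<cdot> h = Plus C (f \<cdot> (w \<cdot> h)) (z' \<cdot> h)"
      using comp_add_left[OF h comp[OF w(1) f] z(2)] assoc[OF h w(1) f] w(2) by simp
    then show ?thesis using e_eq[OF comp[OF h z(1)] comp[OF h z(2)]] comp[OF h w(1)] by blast
  qed
  \<comment> \<open>The operations of \<open>M\<close> are those of \<open>Hom(-, B)\<close>, computed on the representatives \<open>r\<close>.\<close>
  define r where "r X = inv_into (arrows C X B) (e X)" for X
  have r: "r X (e X z) \<in> arrows C X B" "e X (r X (e X z)) = e X z" if "z \<in> arrows C X B" for X z
    unfolding r_def using that by (simp_all add: inv_into_into f_inv_into_f)
  define M :: "('o, 'm, 'v) funct" where
    "M = \<lparr>FOb = (\<lambda>X. \<lparr>carrier = e X ` arrows C X B,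
                      monoid.mult = (\<lambda>a b. e X (Plus C (r X a) (r X b))), one = e X (Zero C X B)\<rparr>),
          FArr = (\<lambda>h v. e (Dom C h) (r (Cod C h) v \<cdot> h))\<rparr>"
  have carrier: "carrier (FOb M X) = e X ` arrows C X B" and one: "\<one>\<^bsub>FOb M X\<^esub> = e X (Zero C X B)" for X
    by (simp_all add: M_def)
  have mult: "e X z \<otimes>\<^bsub>FOb M X\<^esub> e X y = e X (Plus C z y)"
    if "z \<in> arrows C X B" "y \<in> arrows C X B" for X z y
    using e_plus[OF r(1)[OF that(1)] that(1) r(1)[OF that(2)] that(2)] r(2) that by (simp add: M_def)
  have arr: "FArr M h (e Y z) = e X (z \<cdot> h)" if "h \<in> arrows C X Y" "z \<in> arrows C Y B" for X Y h z
  proof -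
    have "Dom C h = X" "Cod C h = Y" using that(1) by (auto simp: mem_arrows)
    then show ?thesis using e_comp[OF that(1) r(1)[OF that(2)] that(2)] r(2)[OF that(2)] by (simp add: M_def)
  qed
  have group: "comm_group (FOb M X)" if X: "X \<in> Ob C" for X
  proof -
    interpret H: comm_group "Hom C X B" using hom_group X B .
    have "e X \<in> hom (Hom C X B) (FOb M X)"
      by (rule homI) (auto simp: carrier mult)
    from H.hom_imp_img_comm_group[OF this] show ?thesis by (simp add: M_def)
  qed
  have M: "contravariant_additive C M"
    unfolding contravariant_additive_def
  proof (intro conjI ballI allI)
    show "comm_group (FOb M X)" if "X \<in> Ob C" for X using group that .
    show "FArr M h \<in> hom (FOb M Y) (FOb M X)" if h: "h \<in> arrows C X Y" for X Y h
    proof (rule homI)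
      show "FArr M h x \<in> carrier (FOb M X)" if "x \<in> carrier (FOb M Y)" for x
        using that comp[OF h] by (auto simp: carrier arr[OF h])
      show "FArr M h (x \<otimes>\<^bsub>FOb M Y\<^esub> y) = FArr M h x \<otimes>\<^bsub>FOb M X\<^esub> FArr M h y"
        if "x \<in> carrier (FOb M Y)" "y \<in> carrier (FOb M Y)" for x y
        using that comp[OF h] by (auto simp: carrier arr[OF h] mult plus_arrows comp_add_left[OF h])
    qed
    show "FArr M (Ident C X) x = x" if "X \<in> Ob C" "x \<in> carrier (FOb M X)" for X x
      using that ident ident_right by (auto simp: carrier arr[of _ X X])
    show "FArr M (h \<cdot> g) z = FArr M g (FArr M h z)"
      if g: "g \<in> arrows C X Y" and h: "h \<in> arrows C Y Z" and z: "z \<in> carrier (FOb M Z)" for X Y Z g h z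
      using z comp[OF g h] comp[OF h] assoc[OF g h] by (auto simp: carrier arr[OF g] arr[OF h] arr)
    show "FArr M (Plus C g h) y = FArr M g y \<otimes>\<^bsub>FOb M X\<^esub> FArr M h y"
      if g: "g \<in> arrows C X Y" and h: "h \<in> arrows C X Y" and y: "y \<in> carrier (FOb M Y)" for X Y g h y
      using y comp[OF g] comp[OF h] comp_add_right[OF g h]
      by (auto simp: carrier arr[OF g] arr[OF h] arr[OF plus_arrows[OF g h]] mult)
  qed
  have id: "Ident C B \<in> arrows C B B" using ident B .
  have gen: "FArr M z (e B (Ident C B)) = e X z" if "z \<in> arrows C X B" for X z
    using arr[OF that id] ident_left[OF that] by simp
  have "presents M f (e B (Ident C B))"
  proof (rule presentsI[OF M f])
    show "e B (Ident C B) \<in> carrier (FOb M B)" using id by (simp add: carrier)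
    show "\<exists>z\<in>arrows C X B. x = FArr M z (e B (Ident C B))" if "x \<in> carrier (FOb M X)" for X x
      using that gen by (auto simp: carrier)
    show "FArr M z (e B (Ident C B)) = \<one>\<^bsub>FOb M X\<^esub> \<longleftrightarrow> (\<exists>w\<in>arrows C X A. z = f \<cdot> w)"
      if z: "z \<in> arrows C X B" for X z
    proof -
      have X: "X \<in> Ob C" using arrows_objects[OF z] by simp
      show ?thesis
        using gen[OF z] e_eq[OF z zero_arrows[OF X B]] plus_zero(1)[OF comp[OF _ f]] by (simp add: one)
    qed
  qed
  then show thesis using that by blast
qed

end

section \<open>Exact sequences of finitely presented functors\<close>

context preadditive_category
begin

lemma arrows_mod:
  "t \<in> arrows (mod_cat C) M N \<longleftrightarrow>
     t \<in> arrows (Mod_cat C) M N \<and> finitely_presented C M \<and> finitely_presented C N"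
  by (auto simp: mem_arrows mod_cat_def full_subcategory_def)

lemma mod_cat_simps [simp]:
  "Comp (mod_cat C) = Comp (Mod_cat C)" "Plus (mod_cat C) = Plus (Mod_cat C)"
  "Zero (mod_cat C) = Zero (Mod_cat C)" "Ident (mod_cat C) = Ident (Mod_cat C)"
  "Dom (mod_cat C) = TDom" "Cod (mod_cat C) = TCod"
  by (simp_all add: mod_cat_def full_subcategory_def Mod_cat_def)

lemma Ob_mod: "M \<in> Ob (mod_cat C) \<longleftrightarrow> finitely_presented C M"
  by (auto simp: mod_cat_def full_subcategory_def Mod_cat_def finitely_presented_def)

lemma Arr_mod: "t \<in> Arr (mod_cat C) \<longleftrightarrow> t \<in> arrows (mod_cat C) (TDom t) (TCod t)"
  by (simp add: mem_arrows)

lemma preadditive_mod: "preadditive_category (mod_cat C)"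
  unfolding mod_cat_def
  using preadditive_category.preadditive_full_subcategory[OF preadditive_Mod] .

lemma mod_arrow_Mod: "t \<in> arrows (mod_cat C) M N \<Longrightarrow> t \<in> arrows (Mod_cat C) M N"
  by (simp add: arrows_mod)

lemma Comp_mod_eq_zero_iff:
  assumes s: "s \<in> arrows (Mod_cat C) L M" and t: "t \<in> arrows (Mod_cat C) M N"
  shows "Comp (Mod_cat C) t s = Zero (Mod_cat C) L N \<longleftrightarrow>
           (\<forall>X\<in>Ob C. \<forall>x\<in>carrier (FOb L X). TMap t X (TMap s X x) = \<one>\<^bsub>FOb N X\<^esub>)"
proof
  assume "Comp (Mod_cat C) t s = Zero (Mod_cat C) L N"
  then show "\<forall>X\<in>Ob C. \<forall>x\<in>carrier (FOb L X). TMap t X (TMap s X x) = \<one>\<^bsub>FOb N X\<^esub>"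
    using Comp_Mod_apply[OF s, of _ _ t] Zero_Mod_apply by metis
next
  assume "\<forall>X\<in>Ob C. \<forall>x\<in>carrier (FOb L X). TMap t X (TMap s X x) = \<one>\<^bsub>FOb N X\<^esub>"
  then show "Comp (Mod_cat C) t s = Zero (Mod_cat C) L N"
    by (intro transf_eqI[OF Comp_Mod_arrow[OF s t]
          Zero_Mod_arrow[OF transf_functors(1)[OF s] transf_functors(2)[OF t]]])
      (simp add: Comp_Mod_apply[OF s])
qed

definition pointwise_inj :: "('o, 'm, 'v) transf \<Rightarrow> bool" where
  "pointwise_inj t \<longleftrightarrow> (\<forall>X\<in>Ob C. inj_on (TMap t X) (carrier (FOb (TDom t) X)))"

definition pointwise_surj :: "('o, 'm, 'v) transf \<Rightarrow> bool" where
  "pointwise_surj t \<longleftrightarrow> (\<forall>X\<in>Ob C. TMap t X ` carrier (FOb (TDom t) X) = carrier (FOb (TCod t) X))"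

definition pointwise_exact :: "('o, 'm, 'v) transf \<Rightarrow> ('o, 'm, 'v) transf \<Rightarrow> bool" where
  "pointwise_exact s t \<longleftrightarrow> (\<forall>X\<in>Ob C. \<forall>x\<in>carrier (FOb (TDom t) X).
     TMap t X x = \<one>\<^bsub>FOb (TCod t) X\<^esub> \<longleftrightarrow> x \<in> TMap s X ` carrier (FOb (TDom s) X))"

lemma pointwise_injI:
  assumes t: "t \<in> arrows (Mod_cat C) M N"
    and "\<And>X x. \<lbrakk>X \<in> Ob C; x \<in> carrier (FOb M X); TMap t X x = \<one>\<^bsub>FOb N X\<^esub>\<rbrakk> \<Longrightarrow> x = \<one>\<^bsub>FOb M X\<^esub>"
  shows "pointwise_inj t"
  unfolding pointwise_inj_def
proof
  fix X assume X: "X \<in> Ob C"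
  interpret h: group_hom "FOb M X" "FOb N X" "TMap t X" using transf_group_hom[OF t X] .
  have "TDom t = M" using t by (simp add: arrows_Mod)
  then show "inj_on (TMap t X) (carrier (FOb (TDom t) X))"
    using assms(2)[OF X] by (simp add: h.inj_on_one_iff)
qed

lemma pointwise_injD:
  assumes "pointwise_inj t" "t \<in> arrows (Mod_cat C) M N" "X \<in> Ob C"
    "x \<in> carrier (FOb M X)" "y \<in> carrier (FOb M X)" "TMap t X x = TMap t X y"
  shows "x = y"
  using assms by (auto simp: pointwise_inj_def arrows_Mod dest: inj_onD)

lemma pointwise_surjI:
  assumes t: "t \<in> arrows (Mod_cat C) M N"
    and "\<And>X y. \<lbrakk>X \<in> Ob C; y \<in> carrier (FOb N X)\<rbrakk> \<Longrightarrow> \<exists>x\<in>carrier (FOb M X). y = TMap t X x"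
  shows "pointwise_surj t"
proof -
  have "TDom t = M" "TCod t = N" using t by (auto simp: arrows_Mod)
  then show ?thesis
    using assms(2) transf_closed[OF t] unfolding pointwise_surj_def by blast
qed

lemma pointwise_surjD:
  assumes "pointwise_surj t" "t \<in> arrows (Mod_cat C) M N" "X \<in> Ob C" "y \<in> carrier (FOb N X)"
  obtains x where "x \<in> carrier (FOb M X)" "TMap t X x = y"
proof -
  have "TDom t = M" "TCod t = N" using assms(2) by (auto simp: arrows_Mod)
  then have "y \<in> TMap t X ` carrier (FOb M X)"
    using assms(1,3,4) by (simp add: pointwise_surj_def)
  then show thesis using that by blast
qed

lemma pointwise_exactI:
  assumes s: "s \<in> arrows (Mod_cat C) L M" and t: "t \<in> arrows (Mod_cat C) M N"
    and "\<And>X x. \<lbrakk>X \<in> Ob C; x \<in> carrier (FOb L X)\<rbrakk> \<Longrightarrow> TMap t X (TMap s X x) = \<one>\<^bsub>FOb N X\<^esub>"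
    and "\<And>X y. \<lbrakk>X \<in> Ob C; y \<in> carrier (FOb M X); TMap t X y = \<one>\<^bsub>FOb N X\<^esub>\<rbrakk>
           \<Longrightarrow> \<exists>x\<in>carrier (FOb L X). y = TMap s X x"
  shows "pointwise_exact s t"
proof -
  have "TDom t = M" "TCod t = N" "TDom s = L" using s t by (auto simp: arrows_Mod)
  then show ?thesis using assms(3,4) unfolding pointwise_exact_def by blast
qed

lemma pointwise_exactD:
  assumes "pointwise_exact s t" "s \<in> arrows (Mod_cat C) L M" "t \<in> arrows (Mod_cat C) M N"
    "X \<in> Ob C" "x \<in> carrier (FOb M X)"
  shows "TMap t X x = \<one>\<^bsub>FOb N X\<^esub> \<longleftrightarrow> x \<in> TMap s X ` carrier (FOb L X)"
proof -
  have "TDom t = M" "TCod t = N" "TDom s = L" using assms(2,3) by (auto simp: arrows_Mod)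
  then show ?thesis using assms(1,4,5) by (simp add: pointwise_exact_def)
qed

text \<open>An arrow that \<open>t\<close> kills takes its values in the image of \<open>j\<close>, and inverting \<open>j\<close> on its
  image factors it.\<close>

lemma pointwise_exact_is_kernel:
  assumes j: "j \<in> arrows (mod_cat C) L M" and t: "t \<in> arrows (mod_cat C) M N"
    and inj: "pointwise_inj j" and ex: "pointwise_exact j t"
  shows "is_kernel (mod_cat C) j t"
proof -
  note j' = mod_arrow_Mod[OF j] and t' = mod_arrow_Mod[OF t]
  have dc: "TDom j = L" "TCod j = M" "TDom t = M" "TCod t = N"
    using j' t' by (auto simp: arrows_Mod)
  have arr: "j \<in> Arr (mod_cat C)" "t \<in> Arr (mod_cat C)" using j t by (auto simp: mem_arrows)
  have zero: "Comp (Mod_cat C) t j = Zero (Mod_cat C) L N"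
    unfolding Comp_mod_eq_zero_iff[OF j' t']
    using pointwise_exactD[OF ex j' t'] transf_closed[OF j'] by blast
  have "\<exists>!h. h \<in> arrows (mod_cat C) P L \<and> Comp (Mod_cat C) j h = g"
    if g: "g \<in> arrows (mod_cat C) P M" and tg: "Comp (Mod_cat C) t g = Zero (Mod_cat C) P N" for P g
  proof -
    note g' = mod_arrow_Mod[OF g]
    have P: "contravariant_additive C P" and L: "contravariant_additive C L"
      using transf_functors[OF g'] transf_functors[OF j'] by auto
    have lift: "TMap g X x \<in> TMap j X ` carrier (FOb L X)" if X: "X \<in> Ob C" and x: "x \<in> carrier (FOb P X)" for X x
    proof -
      have "TMap t X (TMap g X x) = \<one>\<^bsub>FOb N X\<^esub>"
        using tg X x unfolding Comp_mod_eq_zero_iff[OF g' t'] by simp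
      then show ?thesis using pointwise_exactD[OF ex j' t' X transf_closed[OF g' X x]] by simp
    qed
    define k where "k X x = inv_into (carrier (FOb L X)) (TMap j X) (TMap g X x)" for X x
    have k: "k X x \<in> carrier (FOb L X)" "TMap j X (k X x) = TMap g X x"
      if "X \<in> Ob C" "x \<in> carrier (FOb P X)" for X x
      using lift[OF that] unfolding k_def by (auto intro: inv_into_into f_inv_into_f)
    have h: "transf_of P L k \<in> arrows (Mod_cat C) P L"
    proof (rule transf_of_arrow[OF P L k(1)])
      fix X x y assume X: "X \<in> Ob C" and x: "x \<in> carrier (FOb P X)" and y: "y \<in> carrier (FOb P X)"
      interpret P: comm_group "FOb P X" using functor_group[OF P X] .
      interpret L: comm_group "FOb L X" using functor_group[OF L X] .
      show "k X (x \<otimes>\<^bsub>FOb P X\<^esub> y) = k X x \<otimes>\<^bsub>FOb L X\<^esub> k X y"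
        by (rule pointwise_injD[OF inj j' X])
          (use X x y k transf_mult[OF g'] transf_mult[OF j'] in auto)
    next
      fix X Y f y assume f: "f \<in> arrows C X Y" and y: "y \<in> carrier (FOb P Y)"
      have XY: "X \<in> Ob C" "Y \<in> Ob C" using arrows_objects[OF f] by auto
      show "k X (FArr P f y) = FArr L f (k Y y)"
        by (rule pointwise_injD[OF inj j' XY(1)])
          (use XY f y k[OF XY(2) y] k[OF XY(1) functor_closed[OF P f y]] functor_closed[OF L f]
            transf_natural[OF g' f y] transf_natural[OF j' f] in auto)
    qed
    have jh: "Comp (Mod_cat C) j (transf_of P L k) = g"
      by (rule transf_eqI[OF Comp_Mod_arrow[OF h j'] g']) (simp add: Comp_Mod_apply[OF h] k)
    show ?thesis
    proof (rule ex1I[of _ "transf_of P L k"])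
      show "transf_of P L k \<in> arrows (mod_cat C) P L \<and> Comp (Mod_cat C) j (transf_of P L k) = g"
        using h jh g j by (simp add: arrows_mod)
      fix h' assume "h' \<in> arrows (mod_cat C) P L \<and> Comp (Mod_cat C) j h' = g"
      then have h': "h' \<in> arrows (Mod_cat C) P L" and jh': "Comp (Mod_cat C) j h' = g"
        by (auto simp: arrows_mod)
      show "h' = transf_of P L k"
      proof (rule transf_eqI[OF h' h])
        fix X x assume X: "X \<in> Ob C" and x: "x \<in> carrier (FOb P X)"
        show "TMap h' X x = TMap (transf_of P L k) X x"
          by (rule pointwise_injD[OF inj j' X])
            (use X x k[OF X x] transf_closed[OF h' X x] Comp_Mod_apply[OF h' X x, of j] jh' in auto)
      qed
    qed
  qed
  then show ?thesis using zero arr by (simp add: is_kernel_def dc)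
qed

text \<open>Dually, an arrow that kills \<open>t\<close> is constant on the fibres of \<open>q\<close>.\<close>

lemma pointwise_exact_is_cokernel:
  assumes t: "t \<in> arrows (mod_cat C) M N" and q: "q \<in> arrows (mod_cat C) N Q"
    and surj: "pointwise_surj q" and ex: "pointwise_exact t q"
  shows "is_cokernel (mod_cat C) q t"
proof -
  note q' = mod_arrow_Mod[OF q] and t' = mod_arrow_Mod[OF t]
  have dc: "TDom t = M" "TCod t = N" "TDom q = N" "TCod q = Q"
    using q' t' by (auto simp: arrows_Mod)
  have arr: "q \<in> Arr (mod_cat C)" "t \<in> Arr (mod_cat C)" using q t by (auto simp: mem_arrows)
  have zero: "Comp (Mod_cat C) q t = Zero (Mod_cat C) M Q"
    unfolding Comp_mod_eq_zero_iff[OF t' q']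
    using pointwise_exactD[OF ex t' q'] transf_closed[OF t'] by blast
  have "\<exists>!h. h \<in> arrows (mod_cat C) Q P \<and> Comp (Mod_cat C) h q = g"
    if g: "g \<in> arrows (mod_cat C) N P" and gt: "Comp (Mod_cat C) g t = Zero (Mod_cat C) M P" for P g
  proof -
    note g' = mod_arrow_Mod[OF g]
    have P: "contravariant_additive C P" and Q: "contravariant_additive C Q"
      and N: "contravariant_additive C N"
      using transf_functors[OF g'] transf_functors[OF q'] by auto
    define k where "k X y = TMap g X (inv_into (carrier (FOb N X)) (TMap q X) y)" for X y
    have k: "k X (TMap q X x) = TMap g X x" if X: "X \<in> Ob C" and x: "x \<in> carrier (FOb N X)" for X x
    proof -
      interpret q: group_hom "FOb N X" "FOb Q X" "TMap q X" using transf_group_hom[OF q' X] .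
      interpret g: group_hom "FOb N X" "FOb P X" "TMap g X" using transf_group_hom[OF g' X] .
      let ?y = "inv_into (carrier (FOb N X)) (TMap q X) (TMap q X x)"
      have y: "?y \<in> carrier (FOb N X)" "TMap q X ?y = TMap q X x"
        using x by (simp_all add: inv_into_into f_inv_into_f)
      let ?d = "?y \<otimes>\<^bsub>FOb N X\<^esub> inv\<^bsub>FOb N X\<^esub> x"
      have d: "?d \<in> carrier (FOb N X)" using x y by simp
      have "TMap q X ?d = \<one>\<^bsub>FOb Q X\<^esub>" using x y by simp
      then obtain z where "z \<in> carrier (FOb M X)" "?d = TMap t X z"
        using pointwise_exactD[OF ex t' q' X d] by blast
      then have "TMap g X ?d = \<one>\<^bsub>FOb P X\<^esub>"
        using gt[unfolded Comp_mod_eq_zero_iff[OF t' g']] X by auto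
      then have "TMap g X ?y \<otimes>\<^bsub>FOb P X\<^esub> inv\<^bsub>FOb P X\<^esub> TMap g X x = \<one>\<^bsub>FOb P X\<^esub>"
        using x y by simp
      then have "TMap g X ?y = TMap g X x"
        using x y g.hom_closed g.H.inv_unique' g.H.inv_equality g.H.inv_inv by (metis g.H.inv_closed)
      then show ?thesis by (simp add: k_def)
    qed
    have h: "transf_of Q P k \<in> arrows (Mod_cat C) Q P"
    proof (rule transf_of_arrow[OF Q P])
      fix X y assume X: "X \<in> Ob C" and y: "y \<in> carrier (FOb Q X)"
      obtain x where x: "x \<in> carrier (FOb N X)" "TMap q X x = y"
        using pointwise_surjD[OF surj q' X y] by blast
      show "k X y \<in> carrier (FOb P X)"
        using k[OF X x(1)] x(2) transf_closed[OF g' X x(1)] by simp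
      fix y' assume y': "y' \<in> carrier (FOb Q X)"
      obtain x' where x': "x' \<in> carrier (FOb N X)" "TMap q X x' = y'"
        using pointwise_surjD[OF surj q' X y'] by blast
      interpret N: comm_group "FOb N X" using functor_group[OF N X] .
      show "k X (y \<otimes>\<^bsub>FOb Q X\<^esub> y') = k X y \<otimes>\<^bsub>FOb P X\<^esub> k X y'"
        using k[OF X x(1)] k[OF X x'(1)] k[OF X N.m_closed[OF x(1) x'(1)]] x(2) x'(2)
          transf_mult[OF g' X x(1) x'(1)] transf_mult[OF q' X x(1) x'(1)] by simp
    next
      fix X Y f y assume f: "f \<in> arrows C X Y" and y: "y \<in> carrier (FOb Q Y)"
      have XY: "X \<in> Ob C" "Y \<in> Ob C" using arrows_objects[OF f] by auto
      obtain x where x: "x \<in> carrier (FOb N Y)" "TMap q Y x = y"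
        using pointwise_surjD[OF surj q' XY(2) y] by blast
      show "k X (FArr Q f y) = FArr P f (k Y y)"
        using k[OF XY(2) x(1)] k[OF XY(1) functor_closed[OF N f x(1)]] x(2)
          transf_natural[OF g' f x(1)] transf_natural[OF q' f x(1)] by simp
    qed
    have hq: "Comp (Mod_cat C) (transf_of Q P k) q = g"
      by (rule transf_eqI[OF Comp_Mod_arrow[OF q' h] g'])
        (simp add: Comp_Mod_apply[OF q'] k transf_closed[OF q'])
    show ?thesis
    proof (rule ex1I[of _ "transf_of Q P k"])
      show "transf_of Q P k \<in> arrows (mod_cat C) Q P \<and> Comp (Mod_cat C) (transf_of Q P k) q = g"
        using h hq g q by (simp add: arrows_mod)
      fix h' assume "h' \<in> arrows (mod_cat C) Q P \<and> Comp (Mod_cat C) h' q = g"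
      then have h': "h' \<in> arrows (Mod_cat C) Q P" and hq': "Comp (Mod_cat C) h' q = g"
        by (auto simp: arrows_mod)
      show "h' = transf_of Q P k"
      proof (rule transf_eqI[OF h' h])
        fix X y assume X: "X \<in> Ob C" and y: "y \<in> carrier (FOb Q X)"
        obtain x where x: "x \<in> carrier (FOb N X)" "TMap q X x = y"
          using pointwise_surjD[OF surj q' X y] by blast
        show "TMap h' X y = TMap (transf_of Q P k) X y"
          using X y x(2) k[OF X x(1)] Comp_Mod_apply[OF q' X x(1), of h'] hq' by auto
      qed
    qed
  qed
  then show ?thesis using zero arr by (simp add: is_cokernel_def dc)
qed

end

text \<open>Finitely presented functors form an abelian category as soon as the category they are
  defined on has kernels.  The map \<open>u\<close> provides room for them in the universe \<open>'v\<close>.\<close>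

locale presented_functors = additive_category C for C :: "('o, 'm) cat" (structure) +
  fixes u :: "'m \<Rightarrow> 'v"
  assumes inj_u: "inj_on u (Arr C)"
    and ex_kernel: "f \<in> Arr C \<Longrightarrow> \<exists>k. is_kernel C k f"
begin

abbreviation modC :: "(('o, 'm, 'v) funct, ('o, 'm, 'v) transf) cat" where
  "modC \<equiv> mod_cat C"

lemma ex_functor:
  assumes "f \<in> arrows C A B"
  obtains M :: "('o, 'm, 'v) funct" and m where "presents M f m"
  using ex_presented[OF inj_u assms] .

lemma presents_fp: "presents M f m \<Longrightarrow> finitely_presented C M"
  using finitely_presented_iff by blast

lemma fp_presents:
  assumes "finitely_presented C M"
  obtains f A B m where "presents M f m" "f \<in> arrows C A B"
proof -
  obtain f m where M: "presents M f m" using assms unfolding finitely_presented_iff by blast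
  show thesis using that[OF M presents_arrow[OF M]] .
qed

text \<open>A transformation between presented functors is given by an arrow \<open>z\<close> between the generators.
  The kernel is generated by the pullback of \<open>z\<close> along the relations of the target, and its
  relations are those of the source pulled back once more.\<close>

lemma ex_pointwise_kernel:
  assumes t: "t \<in> arrows modC M N"
  obtains L j where "j \<in> arrows modC L M" "pointwise_inj j" "pointwise_exact j t"
proof -
  note t' = mod_arrow_Mod[OF t]
  have fp: "finitely_presented C M" "finitely_presented C N" using t by (simp_all add: arrows_mod)
  obtain f A B m where M: "presents M f m" and f: "f \<in> arrows C A B"
    using fp_presents[OF fp(1)] .
  obtain g A' B' n where N: "presents N g n" and g: "g \<in> arrows C A' B'"
    using fp_presents[OF fp(2)] .
  note Mf = presents_functor[OF M] and Nf = presents_functor[OF N]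
  note m = presents_generator[OF M f] and n = presents_generator[OF N g]
  have B: "B \<in> Ob C" using arrows_objects[OF f] by simp
  obtain z where z: "z \<in> arrows C B B'" and tm: "TMap t B m = FArr N z n"
    using presents_generates[OF N g B transf_closed[OF t' B m]] by blast
  obtain x y where pb: "is_pullback C z g x y" using ex_pullback[OF ex_kernel z g] by blast
  then obtain P where x: "x \<in> arrows C P B" and y: "y \<in> arrows C P A'" and xy: "z \<cdot> x = g \<cdot> y"
    using pullback_arrows z g by blast
  obtain a b where pb': "is_pullback C x f a b" using ex_pullback[OF ex_kernel x f] by blast
  then obtain R where a: "a \<in> arrows C R P" and b: "b \<in> arrows C R A" and ab: "x \<cdot> a = f \<cdot> b"
    using pullback_arrows x f by blast
  have P: "P \<in> Ob C" using arrows_objects[OF x] by simp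
  obtain L :: "('o, 'm, 'v) funct" and l where L: "presents L a l" using ex_functor[OF a] .
  note xm = functor_closed[OF Mf x m]
  have "FArr M a (FArr M x m) = FArr M (x \<cdot> a) m"
    using functor_comp[OF Mf a x m] by simp
  also have "\<dots> = \<one>\<^bsub>FOb M R\<^esub>"
    using presents_relations[OF M f comp[OF a x]] ab b by blast
  finally obtain j where j: "j \<in> arrows (Mod_cat C) L M" and jl: "TMap j P l = FArr M x m"
    using ex_transf_of_generator[OF L a Mf xm] by blast
  have jv: "TMap j X (FArr L v l) = FArr M (x \<cdot> v) m" if v: "v \<in> arrows C X P" for X v
    using transf_at_generated[OF L a j v] jl functor_comp[OF Mf v x m] by simp
  have tv: "TMap t X (FArr M v m) = FArr N (z \<cdot> v) n" if v: "v \<in> arrows C X B" for X v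
    using transf_at_generated[OF M f t' v] tm functor_comp[OF Nf v z n] by simp
  have "pointwise_inj j"
  proof (rule pointwise_injI[OF j])
    fix X e assume X: "X \<in> Ob C" and e: "e \<in> carrier (FOb L X)" and je: "TMap j X e = \<one>\<^bsub>FOb M X\<^esub>"
    obtain v where v: "v \<in> arrows C X P" "e = FArr L v l"
      using presents_generates[OF L a X e] by blast
    obtain w where w: "w \<in> arrows C X A" "x \<cdot> v = f \<cdot> w"
      using presents_relations[OF M f comp[OF v(1) x]] jv[OF v(1)] v(2) je by auto
    obtain h where "h \<in> arrows C X R" "a \<cdot> h = v"
      using pullback_lift[OF pb' a f v(1) w] by blast
    then show "e = \<one>\<^bsub>FOb L X\<^esub>"
      using presents_relations[OF L a v(1)] v(2) by blast
  qed
  moreover have "pointwise_exact j t"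
  proof (rule pointwise_exactI[OF j t'])
    fix X e assume X: "X \<in> Ob C" and e: "e \<in> carrier (FOb L X)"
    obtain v where v: "v \<in> arrows C X P" "e = FArr L v l"
      using presents_generates[OF L a X e] by blast
    have "z \<cdot> (x \<cdot> v) = g \<cdot> (y \<cdot> v)" using assoc[OF v(1) x z] assoc[OF v(1) y g] xy by simp
    then show "TMap t X (TMap j X e) = \<one>\<^bsub>FOb N X\<^esub>"
      using tv[OF comp[OF v(1) x]] jv[OF v(1)] v(2) comp[OF v(1) y]
        presents_relations[OF N g comp[OF comp[OF v(1) x] z]] by auto
  next
    fix X e assume X: "X \<in> Ob C" and e: "e \<in> carrier (FOb M X)" and te: "TMap t X e = \<one>\<^bsub>FOb N X\<^esub>"
    obtain v where v: "v \<in> arrows C X B" "e = FArr M v m"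
      using presents_generates[OF M f X e] by blast
    obtain w where w: "w \<in> arrows C X A'" "z \<cdot> v = g \<cdot> w"
      using presents_relations[OF N g comp[OF v(1) z]] tv[OF v(1)] v(2) te by auto
    obtain h where h: "h \<in> arrows C X P" "x \<cdot> h = v"
      using pullback_lift[OF pb x g v(1) w] by blast
    then show "\<exists>x\<in>carrier (FOb L X). e = TMap j X x"
      using jv[OF h(1)] v(2) functor_closed[OF presents_functor[OF L] h(1) presents_generator[OF L a]]
      by metis
  qed
  moreover have "j \<in> arrows modC L M"
    using j presents_fp[OF L] presents_fp[OF M] by (simp add: arrows_mod)
  ultimately show thesis using that by blast
qed

text \<open>The cokernel has the generator of the target; its relations are those of the target
  together with the image of the generator of the source.\<close>

lemma ex_pointwise_cokernel:
  assumes t: "t \<in> arrows modC M N"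
  obtains Q q where "q \<in> arrows modC N Q" "pointwise_surj q" "pointwise_exact t q"
proof -
  note t' = mod_arrow_Mod[OF t]
  have fp: "finitely_presented C M" "finitely_presented C N" using t by (simp_all add: arrows_mod)
  obtain f A B m where M: "presents M f m" and f: "f \<in> arrows C A B"
    using fp_presents[OF fp(1)] .
  obtain g A' B' n where N: "presents N g n" and g: "g \<in> arrows C A' B'"
    using fp_presents[OF fp(2)] .
  note Mf = presents_functor[OF M] and Nf = presents_functor[OF N]
  note m = presents_generator[OF M f] and n = presents_generator[OF N g]
  have B: "B \<in> Ob C" and A': "A' \<in> Ob C" and B': "B' \<in> Ob C"
    using arrows_objects[OF f] arrows_objects[OF g] by auto
  obtain z where z: "z \<in> arrows C B B'" and tm: "TMap t B m = FArr N z n"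
    using presents_generates[OF N g B transf_closed[OF t' B m]] by blast
  obtain r S where r: "r \<in> arrows C S B'"
    and rel: "\<forall>T v. (\<exists>w\<in>arrows C T S. v = r \<cdot> w) \<longleftrightarrow>
           (\<exists>x\<in>arrows C T A'. \<exists>y\<in>arrows C T B. v = Plus C (g \<cdot> x) (z \<cdot> y))"
    using ex_copair[OF g z] .
  obtain Q :: "('o, 'm, 'v) funct" and c where Q: "presents Q r c" using ex_functor[OF r] .
  note Qf = presents_functor[OF Q] and c = presents_generator[OF Q r]
  have Qrel: "FArr Q v c = \<one>\<^bsub>FOb Q X\<^esub> \<longleftrightarrow>
      (\<exists>x\<in>arrows C X A'. \<exists>y\<in>arrows C X B. v = Plus C (g \<cdot> x) (z \<cdot> y))"
    if v: "v \<in> arrows C X B'" for X v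
    using presents_relations[OF Q r v] rel by simp
  have Zz: "z \<cdot> Zero C X B = Zero C X B'" "g \<cdot> Zero C X A' = Zero C X B'" if "X \<in> Ob C" for X
    using comp_zero(1)[OF z that] comp_zero(1)[OF g that] by auto
  have "g = Plus C (g \<cdot> Ident C A') (z \<cdot> Zero C A' B)"
    using ident_right[OF g] Zz(1)[OF A'] plus_zero[OF g] by simp
  then have "FArr Q g c = \<one>\<^bsub>FOb Q A'\<^esub>"
    using Qrel[OF g] ident[OF A'] zero_arrows[OF A' B] by blast
  then obtain q where q: "q \<in> arrows (Mod_cat C) N Q" and qn: "TMap q B' n = c"
    using ex_transf_of_generator[OF N g Qf c] by blast
  have qv: "TMap q X (FArr N v n) = FArr Q v c" if "v \<in> arrows C X B'" for X v
    using transf_at_generated[OF N g q that] qn by simp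
  have tv: "TMap t X (FArr M v m) = FArr N (z \<cdot> v) n" if v: "v \<in> arrows C X B" for X v
    using transf_at_generated[OF M f t' v] tm functor_comp[OF Nf v z n] by simp
  have "pointwise_surj q"
  proof (rule pointwise_surjI[OF q])
    fix X e assume X: "X \<in> Ob C" and e: "e \<in> carrier (FOb Q X)"
    obtain v where v: "v \<in> arrows C X B'" "e = FArr Q v c"
      using presents_generates[OF Q r X e] by blast
    then show "\<exists>x\<in>carrier (FOb N X). e = TMap q X x"
      using qv[OF v(1)] functor_closed[OF Nf v(1) n] by metis
  qed
  moreover have "pointwise_exact t q"
  proof (rule pointwise_exactI[OF t' q])
    fix X e assume X: "X \<in> Ob C" and e: "e \<in> carrier (FOb M X)"
    obtain v where v: "v \<in> arrows C X B" "e = FArr M v m"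
      using presents_generates[OF M f X e] by blast
    have "z \<cdot> v = Plus C (g \<cdot> Zero C X A') (z \<cdot> v)"
      using Zz(2)[OF X] plus_zero[OF comp[OF v(1) z]] by simp
    then show "TMap q X (TMap t X e) = \<one>\<^bsub>FOb Q X\<^esub>"
      using tv[OF v(1)] qv[OF comp[OF v(1) z]] Qrel[OF comp[OF v(1) z]] v zero_arrows[OF X A'] by auto
  next
    fix X e assume X: "X \<in> Ob C" and e: "e \<in> carrier (FOb N X)" and qe: "TMap q X e = \<one>\<^bsub>FOb Q X\<^esub>"
    obtain v where v: "v \<in> arrows C X B'" "e = FArr N v n"
      using presents_generates[OF N g X e] by blast
    obtain x y where x: "x \<in> arrows C X A'" and y: "y \<in> arrows C X B" and vxy: "v = Plus C (g \<cdot> x) (z \<cdot> y)"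
      using Qrel[OF v(1)] qv[OF v(1)] v(2) qe by auto
    have "FArr N v n = FArr N (z \<cdot> y) n"
      using presents_eq_iff[OF N g v(1) comp[OF y z]] vxy x by blast
    then show "\<exists>x\<in>carrier (FOb M X). e = TMap t X x"
      using tv[OF y] v(2) functor_closed[OF Mf y m] by metis
  qed
  moreover have "q \<in> arrows modC N Q"
    using q presents_fp[OF N] presents_fp[OF Q] by (simp add: arrows_mod)
  ultimately show thesis using that by blast
qed

text \<open>The inclusion of the pointwise kernel is killed by \<open>t\<close>, just as the zero arrow is; a
  monomorphism cannot distinguish the two.\<close>

lemma is_mono_iff_pointwise_inj:
  assumes t: "t \<in> arrows modC M N"
  shows "is_mono modC t \<longleftrightarrow> pointwise_inj t"
proof -
  note t' = mod_arrow_Mod[OF t]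
  have dc: "TDom t = M" "TCod t = N" using t' by (auto simp: arrows_Mod)
  show ?thesis
  proof
    assume mono: "is_mono modC t"
    obtain L j where j: "j \<in> arrows modC L M" and inj: "pointwise_inj j" and ex: "pointwise_exact j t"
      using ex_pointwise_kernel[OF t] .
    note j' = mod_arrow_Mod[OF j]
    have z: "Zero (Mod_cat C) L M \<in> arrows (Mod_cat C) L M"
      using Zero_Mod_arrow[OF transf_functors[OF j']] .
    then have zm: "Zero (Mod_cat C) L M \<in> arrows modC L M" using j by (simp add: arrows_mod)
    have "Comp (Mod_cat C) t j = Comp (Mod_cat C) t (Zero (Mod_cat C) L M)"
    proof (rule transf_eqI[OF Comp_Mod_arrow[OF j' t'] Comp_Mod_arrow[OF z t']])
      fix X x assume X: "X \<in> Ob C" and x: "x \<in> carrier (FOb L X)"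
      show "TMap (Comp (Mod_cat C) t j) X x = TMap (Comp (Mod_cat C) t (Zero (Mod_cat C) L M)) X x"
        using Comp_Mod_apply[OF j' X x] Comp_Mod_apply[OF z X x] X x transf_one[OF t' X]
          pointwise_exactD[OF ex j' t' X transf_closed[OF j' X x]] by simp
    qed
    then have jz: "j = Zero (Mod_cat C) L M"
      using mono j zm unfolding is_mono_def by (simp add: dc)
    show "pointwise_inj t"
    proof (rule pointwise_injI[OF t'])
      fix X x assume X: "X \<in> Ob C" and x: "x \<in> carrier (FOb M X)" and "TMap t X x = \<one>\<^bsub>FOb N X\<^esub>"
      then obtain e where e: "e \<in> carrier (FOb L X)" "x = TMap j X e"
        using pointwise_exactD[OF ex j' t' X x] by blast
      then show "x = \<one>\<^bsub>FOb M X\<^esub>" using Zero_Mod_apply[OF X e(1), of M] jz by simp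
    qed
  next
    assume inj: "pointwise_inj t"
    have "g = h" if g: "g \<in> arrows modC P M" and h: "h \<in> arrows modC P M"
      and eq: "Comp (Mod_cat C) t g = Comp (Mod_cat C) t h" for P g h
    proof -
      note g' = mod_arrow_Mod[OF g] and h' = mod_arrow_Mod[OF h]
      show ?thesis
      proof (rule transf_eqI[OF g' h'])
        fix X x assume X: "X \<in> Ob C" and x: "x \<in> carrier (FOb P X)"
        show "TMap g X x = TMap h X x"
          using pointwise_injD[OF inj t' X transf_closed[OF g' X x] transf_closed[OF h' X x]]
            Comp_Mod_apply[OF g' X x, of t] Comp_Mod_apply[OF h' X x, of t] eq by simp
      qed
    qed
    then show "is_mono modC t" using t by (auto simp: is_mono_def dc Arr_mod)
  qed
qed

text \<open>Dually, the projection onto the pointwise cokernel of an epimorphism is zero.\<close>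

lemma is_epi_iff_pointwise_surj:
  assumes t: "t \<in> arrows modC M N"
  shows "is_epi modC t \<longleftrightarrow> pointwise_surj t"
proof -
  note t' = mod_arrow_Mod[OF t]
  have dc: "TDom t = M" "TCod t = N" using t' by (auto simp: arrows_Mod)
  show ?thesis
  proof
    assume epi: "is_epi modC t"
    obtain Q q where q: "q \<in> arrows modC N Q" and surj: "pointwise_surj q" and ex: "pointwise_exact t q"
      using ex_pointwise_cokernel[OF t] .
    note q' = mod_arrow_Mod[OF q]
    have z: "Zero (Mod_cat C) N Q \<in> arrows (Mod_cat C) N Q"
      using Zero_Mod_arrow[OF transf_functors[OF q']] .
    then have zm: "Zero (Mod_cat C) N Q \<in> arrows modC N Q" using q by (simp add: arrows_mod)
    have "Comp (Mod_cat C) q t = Comp (Mod_cat C) (Zero (Mod_cat C) N Q) t"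
    proof (rule transf_eqI[OF Comp_Mod_arrow[OF t' q'] Comp_Mod_arrow[OF t' z]])
      fix X x assume X: "X \<in> Ob C" and x: "x \<in> carrier (FOb M X)"
      show "TMap (Comp (Mod_cat C) q t) X x = TMap (Comp (Mod_cat C) (Zero (Mod_cat C) N Q) t) X x"
        using Comp_Mod_apply[OF t' X x] X x transf_closed[OF t' X x]
          pointwise_exactD[OF ex t' q' X transf_closed[OF t' X x]] by simp
    qed
    then have qz: "q = Zero (Mod_cat C) N Q"
      using epi q zm unfolding is_epi_def by (simp add: dc)
    show "pointwise_surj t"
    proof (rule pointwise_surjI[OF t'])
      fix X y assume X: "X \<in> Ob C" and y: "y \<in> carrier (FOb N X)"
      have "TMap q X y = \<one>\<^bsub>FOb Q X\<^esub>" using Zero_Mod_apply[OF X y, of Q] qz by simp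
      then show "\<exists>x\<in>carrier (FOb M X). y = TMap t X x"
        using pointwise_exactD[OF ex t' q' X y] by blast
    qed
  next
    assume surj: "pointwise_surj t"
    have "g = h" if g: "g \<in> arrows modC N P" and h: "h \<in> arrows modC N P"
      and eq: "Comp (Mod_cat C) g t = Comp (Mod_cat C) h t" for P g h
    proof -
      note g' = mod_arrow_Mod[OF g] and h' = mod_arrow_Mod[OF h]
      show ?thesis
      proof (rule transf_eqI[OF g' h'])
        fix X y assume X: "X \<in> Ob C" and y: "y \<in> carrier (FOb N X)"
        obtain x where x: "x \<in> carrier (FOb M X)" "TMap t X x = y"
          using pointwise_surjD[OF surj t' X y] .
        then show "TMap g X y = TMap h X y"
          using Comp_Mod_apply[OF t' X x(1), of g] Comp_Mod_apply[OF t' X x(1), of h] eq by simp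
      qed
    qed
    then show "is_epi modC t" using t by (auto simp: is_epi_def dc Arr_mod)
  qed
qed

text \<open>Every arrow factors through an identity, so a functor whose relation is an identity is zero.\<close>

lemma ex_zero_functor: "\<exists>Z. is_zero_object modC Z"
proof -
  obtain A where "A \<in> Ob C" using ex_zero_object by (auto simp: is_zero_object_def)
  then have id: "Ident C A \<in> arrows C A A" by (rule ident)
  obtain Z :: "('o, 'm, 'v) funct" and e where Z: "presents Z (Ident C A) e" using ex_functor[OF id] .
  note Zf = presents_functor[OF Z]
  have triv: "x = \<one>\<^bsub>FOb Z X\<^esub>" if X: "X \<in> Ob C" and x: "x \<in> carrier (FOb Z X)" for X x
  proof -
    obtain v where v: "v \<in> arrows C X A" "x = FArr Z v e" using presents_generates[OF Z id X x] .
    then show ?thesis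
      using presents_relations[OF Z id v(1)] ident_left[OF v(1)] by metis
  qed
  have "is_zero_object modC Z"
    unfolding is_zero_object_def
  proof (intro conjI ballI)
    show "Z \<in> Ob modC" using presents_fp[OF Z] by (simp add: Ob_mod)
    fix M assume "M \<in> Ob modC"
    then have M: "finitely_presented C M" and Mf: "contravariant_additive C M"
      by (auto simp: Ob_mod finitely_presented_def)
    have "t = t'" if "t \<in> arrows modC M Z" "t' \<in> arrows modC M Z" for t t'
      using transf_eqI[OF that[THEN mod_arrow_Mod]] triv transf_closed[OF that(1)[THEN mod_arrow_Mod]]
        transf_closed[OF that(2)[THEN mod_arrow_Mod]] by metis
    moreover have "Zero (Mod_cat C) M Z \<in> arrows modC M Z"
      using Zero_Mod_arrow[OF Mf Zf] presents_fp[OF Z] M by (simp add: arrows_mod)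
    ultimately show "\<exists>!f. f \<in> arrows modC M Z" by blast
    have "t = t'" if "t \<in> arrows modC Z M" "t' \<in> arrows modC Z M" for t t'
      using transf_eqI[OF that[THEN mod_arrow_Mod]] triv transf_one[OF that(1)[THEN mod_arrow_Mod]]
        transf_one[OF that(2)[THEN mod_arrow_Mod]] by metis
    moreover have "Zero (Mod_cat C) Z M \<in> arrows modC Z M"
      using Zero_Mod_arrow[OF Zf Mf] presents_fp[OF Z] M by (simp add: arrows_mod)
    ultimately show "\<exists>!f. f \<in> arrows modC Z M" by blast
  qed
  then show ?thesis by blast
qed

text \<open>The biproduct lives on the biproduct of the generators, with both sets of relations.\<close>

lemma ex_functor_biproduct:
  assumes "M \<in> Ob modC" "N \<in> Ob modC"
  shows "\<exists>S i j p q. is_biproduct modC M N S i j p q"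
proof -
  obtain f A B m where M: "presents M f m" and f: "f \<in> arrows C A B"
    using fp_presents[OF assms(1)[unfolded Ob_mod]] .
  obtain g A' B' n where N: "presents N g n" and g: "g \<in> arrows C A' B'"
    using fp_presents[OF assms(2)[unfolded Ob_mod]] .
  note Mf = presents_functor[OF M] and Nf = presents_functor[OF N]
  note m = presents_generator[OF M f] and n = presents_generator[OF N g]
  have A: "A \<in> Ob C" "A' \<in> Ob C" and B: "B \<in> Ob C" "B' \<in> Ob C"
    using arrows_objects[OF f] arrows_objects[OF g] by auto
  obtain D i j p q where "is_biproduct C B B' D i j p q" using ex_biproduct[OF B] by blast
  then have i: "i \<in> arrows C B D" and j: "j \<in> arrows C B' D"
    and p: "p \<in> arrows C D B" and q: "q \<in> arrows C D B'"
    and eq: "p \<cdot> i = Ident C B" "q \<cdot> j = Ident C B'" "q \<cdot> i = Zero C B B'" "p \<cdot> j = Zero C B' B"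
    "Plus C (i \<cdot> p) (j \<cdot> q) = Ident C D"
    by (auto simp: is_biproduct_def)
  have D: "D \<in> Ob C" using arrows_objects[OF i] by simp
  note fi = comp[OF f i] and gj = comp[OF g j]
  obtain r R where r: "r \<in> arrows C R D"
    and rel: "\<forall>T v. (\<exists>w\<in>arrows C T R. v = r \<cdot> w) \<longleftrightarrow>
           (\<exists>x\<in>arrows C T A. \<exists>y\<in>arrows C T A'. v = Plus C ((i \<cdot> f) \<cdot> x) ((j \<cdot> g) \<cdot> y))"
    using ex_copair[OF fi gj] .
  obtain S :: "('o, 'm, 'v) funct" and s where S: "presents S r s" using ex_functor[OF r] .
  note Sf = presents_functor[OF S] and s = presents_generator[OF S r]
  have R: "R \<in> Ob C" using arrows_objects[OF r] by simp
  obtain x y where x: "x \<in> arrows C R A" and y: "y \<in> arrows C R A'"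
    and rxy: "r = Plus C ((i \<cdot> f) \<cdot> x) ((j \<cdot> g) \<cdot> y)"
    using rel ident[OF R] ident_right[OF r] by metis
  note ifx = comp[OF x fi] and jgy = comp[OF y gj]
  have pr: "p \<cdot> r = f \<cdot> x"
    using comp_add_right[OF ifx jgy p] assoc[OF x fi p] assoc[OF y gj p] assoc[OF f i p] assoc[OF g j p]
      eq ident_left[OF f] comp_zero(2)[OF g B(1)] comp_zero(2)[OF y B(1)] plus_zero[OF comp[OF x f]] rxy by simp
  have qr: "q \<cdot> r = g \<cdot> y"
    using comp_add_right[OF ifx jgy q] assoc[OF x fi q] assoc[OF y gj q] assoc[OF f i q] assoc[OF g j q]
      eq ident_left[OF g] comp_zero(2)[OF f B(2)] comp_zero(2)[OF x B(2)] plus_zero[OF comp[OF y g]] rxy by simp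
  have "i \<cdot> f = Plus C ((i \<cdot> f) \<cdot> Ident C A) ((j \<cdot> g) \<cdot> Zero C A A')"
    using ident_right[OF fi] comp_zero(1)[OF gj A(1)] plus_zero[OF fi] by simp
  then have "\<exists>w\<in>arrows C A R. i \<cdot> f = r \<cdot> w"
    using rel ident[OF A(1)] zero_arrows[OF A] by blast
  then have "FArr S f (FArr S i s) = \<one>\<^bsub>FOb S A\<^esub>"
    using functor_comp[OF Sf f i s] presents_relations[OF S r fi] by simp
  then obtain I where I: "I \<in> arrows (Mod_cat C) M S" and Im: "TMap I B m = FArr S i s"
    using ex_transf_of_generator[OF M f Sf functor_closed[OF Sf i s]] by blast
  have "j \<cdot> g = Plus C ((i \<cdot> f) \<cdot> Zero C A' A) ((j \<cdot> g) \<cdot> Ident C A')"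
    using ident_right[OF gj] comp_zero(1)[OF fi A(2)] plus_zero[OF gj] by simp
  then have "\<exists>w\<in>arrows C A' R. j \<cdot> g = r \<cdot> w"
    using rel ident[OF A(2)] zero_arrows[OF A(2,1)] by blast
  then have "FArr S g (FArr S j s) = \<one>\<^bsub>FOb S A'\<^esub>"
    using functor_comp[OF Sf g j s] presents_relations[OF S r gj] by simp
  then obtain J where J: "J \<in> arrows (Mod_cat C) N S" and Jn: "TMap J B' n = FArr S j s"
    using ex_transf_of_generator[OF N g Sf functor_closed[OF Sf j s]] by blast
  have "FArr M r (FArr M p m) = \<one>\<^bsub>FOb M R\<^esub>"
    using functor_comp[OF Mf r p m] presents_relations[OF M f comp[OF r p]] pr x by auto
  then obtain P where P: "P \<in> arrows (Mod_cat C) S M" and Ps: "TMap P D s = FArr M p m"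
    using ex_transf_of_generator[OF S r Mf functor_closed[OF Mf p m]] by blast
  have "FArr N r (FArr N q n) = \<one>\<^bsub>FOb N R\<^esub>"
    using functor_comp[OF Nf r q n] presents_relations[OF N g comp[OF r q]] qr y by auto
  then obtain Q where Q: "Q \<in> arrows (Mod_cat C) S N" and Qs: "TMap Q D s = FArr N q n"
    using ex_transf_of_generator[OF S r Nf functor_closed[OF Nf q n]] by blast
  note IS = transf_at_generated[OF M f I] and JS = transf_at_generated[OF N g J]
  note PM = transf_at_generated[OF S r P] and QN = transf_at_generated[OF S r Q]
  have "is_biproduct modC M N S I J P Q"
    unfolding is_biproduct_def mod_cat_simps
  proof (intro conjI)
    show "I \<in> arrows modC M S" "J \<in> arrows modC N S" "P \<in> arrows modC S M" "Q \<in> arrows modC S N"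
      using I J P Q presents_fp[OF M] presents_fp[OF N] presents_fp[OF S] by (auto simp: arrows_mod)
    show "Comp (Mod_cat C) P I = Ident (Mod_cat C) M"
      using Comp_Mod_apply[OF I B(1) m] B m Im PM[OF i] Ps functor_comp[OF Mf i p m] eq(1)
        functor_ident[OF Mf B(1) m]
      by (intro transf_eq_generator[OF M f Comp_Mod_arrow[OF I P] Ident_Mod_arrow[OF Mf]]) simp
    show "Comp (Mod_cat C) Q J = Ident (Mod_cat C) N"
      using Comp_Mod_apply[OF J B(2) n] B n Jn QN[OF j] Qs functor_comp[OF Nf j q n] eq(2)
        functor_ident[OF Nf B(2) n]
      by (intro transf_eq_generator[OF N g Comp_Mod_arrow[OF J Q] Ident_Mod_arrow[OF Nf]]) simp
    show "Comp (Mod_cat C) Q I = Zero (Mod_cat C) M N"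
      using Comp_Mod_apply[OF I B(1) m] B m Im QN[OF i] Qs functor_comp[OF Nf i q n] eq(3)
        functor_zero[OF Nf B n]
      by (intro transf_eq_generator[OF M f Comp_Mod_arrow[OF I Q] Zero_Mod_arrow[OF Mf Nf]]) simp
    show "Comp (Mod_cat C) P J = Zero (Mod_cat C) N M"
      using Comp_Mod_apply[OF J B(2) n] B n Jn PM[OF j] Ps functor_comp[OF Mf j p m] eq(4)
        functor_zero[OF Mf B(2,1) m]
      by (intro transf_eq_generator[OF N g Comp_Mod_arrow[OF J P] Zero_Mod_arrow[OF Nf Mf]]) simp
    have ip: "TMap (Comp (Mod_cat C) I P) D s = FArr S (i \<cdot> p) s"
      using Comp_Mod_apply[OF P D s] Ps IS[OF p] Im functor_comp[OF Sf p i s] by simp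
    have jq: "TMap (Comp (Mod_cat C) J Q) D s = FArr S (j \<cdot> q) s"
      using Comp_Mod_apply[OF Q D s] Qs JS[OF q] Jn functor_comp[OF Sf q j s] by simp
    have "TMap (Plus (Mod_cat C) (Comp (Mod_cat C) I P) (Comp (Mod_cat C) J Q)) D s = s"
      using Plus_Mod_apply[OF Comp_Mod_arrow[OF P I] D s] ip jq eq(5)
        functor_plus[OF Sf comp[OF p i] comp[OF q j] s] functor_ident[OF Sf D s] by simp
    then show "Plus (Mod_cat C) (Comp (Mod_cat C) I P) (Comp (Mod_cat C) J Q) = Ident (Mod_cat C) S"
      using D s by (intro transf_eq_generator[OF S r Plus_Mod_arrow[OF Comp_Mod_arrow[OF P I]
            Comp_Mod_arrow[OF Q J]] Ident_Mod_arrow[OF Sf]]) simp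
  qed
  then show ?thesis by blast
qed

text \<open>Kernels and cokernels are computed pointwise, so a monomorphism is the kernel of its cokernel
  and an epimorphism the cokernel of its kernel because this holds for abelian groups.\<close>

theorem abelian_mod: "abelian_category modC"
proof (intro abelian_category.intro additive_category.intro preadditive_mod
    additive_category_axioms.intro abelian_category_axioms.intro ex_zero_functor ex_functor_biproduct)
  fix t assume "t \<in> Arr modC"
  then have t: "t \<in> arrows modC (TDom t) (TCod t)" by (simp add: Arr_mod)
  show "\<exists>k. is_kernel modC k t"
    using ex_pointwise_kernel[OF t] pointwise_exact_is_kernel[OF _ t] by metis
  show "\<exists>q. is_cokernel modC q t"
    using ex_pointwise_cokernel[OF t] pointwise_exact_is_cokernel[OF t] by metis
next
  fix t assume mono: "is_mono modC t"
  then have t: "t \<in> arrows modC (TDom t) (TCod t)" by (simp add: Arr_mod is_mono_def)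
  show "\<exists>g. is_kernel modC t g"
    using ex_pointwise_cokernel[OF t] pointwise_exact_is_kernel[OF t]
      is_mono_iff_pointwise_inj[OF t] mono by metis
next
  fix t assume epi: "is_epi modC t"
  then have t: "t \<in> arrows modC (TDom t) (TCod t)" by (simp add: Arr_mod is_epi_def)
  show "\<exists>g. is_cokernel modC t g"
    using ex_pointwise_kernel[OF t] pointwise_exact_is_cokernel[OF _ t]
      is_epi_iff_pointwise_surj[OF t] epi by metis
qed

end

section \<open>Short exact sequences and projective functors\<close>

context preadditive_category
begin

lemma kernel_is_mono:
  assumes "is_kernel C k f"
  shows "is_mono C k"
proof -
  define P A B where "P = Dom C k" and "A = Dom C f" and "B = Cod C f"
  have k: "k \<in> arrows C P A" and f: "f \<in> arrows C A B" and fk: "f \<cdot> k = Zero C P B"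
    and univ: "\<And>T g. \<lbrakk>g \<in> arrows C T A; f \<cdot> g = Zero C T B\<rbrakk> \<Longrightarrow> \<exists>!h. h \<in> arrows C T P \<and> k \<cdot> h = g"
    using assms by (auto simp: is_kernel_def mem_arrows P_def A_def B_def)
  have "g = h" if g: "g \<in> arrows C T P" and h: "h \<in> arrows C T P" and eq: "k \<cdot> g = k \<cdot> h" for T g h
  proof -
    have "f \<cdot> (k \<cdot> h) = Zero C T B"
      using assoc[OF h k f] fk comp_zero(2)[OF h] arrows_objects[OF f] by simp
    then have "\<exists>!e. e \<in> arrows C T P \<and> k \<cdot> e = k \<cdot> h" by (rule univ[OF comp[OF h k]])
    then show ?thesis using g h eq by blast
  qed
  then show ?thesis using k by (auto simp: is_mono_def P_def mem_arrows)
qed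

lemma cokernel_is_epi:
  assumes "is_cokernel C q f"
  shows "is_epi C q"
proof -
  define A B Q where "A = Dom C f" and "B = Cod C f" and "Q = Cod C q"
  have q: "q \<in> arrows C B Q" and f: "f \<in> arrows C A B" and qf: "q \<cdot> f = Zero C A Q"
    and univ: "\<And>T g. \<lbrakk>g \<in> arrows C B T; g \<cdot> f = Zero C A T\<rbrakk> \<Longrightarrow> \<exists>!h. h \<in> arrows C Q T \<and> h \<cdot> q = g"
    using assms by (auto simp: is_cokernel_def mem_arrows Q_def A_def B_def)
  have "g = h" if g: "g \<in> arrows C Q T" and h: "h \<in> arrows C Q T" and eq: "g \<cdot> q = h \<cdot> q" for T g h
  proof -
    have "(h \<cdot> q) \<cdot> f = Zero C A T"
      using assoc[OF f q h] qf comp_zero(1)[OF h] arrows_objects[OF f] by simp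
    then have "\<exists>!e. e \<in> arrows C Q T \<and> e \<cdot> q = h \<cdot> q" by (rule univ[OF comp[OF q h]])
    then show ?thesis using g h eq by blast
  qed
  then show ?thesis using q by (auto simp: is_epi_def Q_def mem_arrows)
qed

lemma is_monoI:
  assumes m: "m \<in> arrows C A B"
    and zero: "\<And>T g. \<lbrakk>g \<in> arrows C T A; m \<cdot> g = Zero C T B\<rbrakk> \<Longrightarrow> g = Zero C T A"
  shows "is_mono C m"
proof -
  have "g = h" if g: "g \<in> arrows C T A" and h: "h \<in> arrows C T A" and eq: "m \<cdot> g = m \<cdot> h" for T g h
  proof -
    obtain n where n: "n \<in> arrows C T A" "Plus C h n = Zero C T A" using ex_negative[OF h] .
    have "m \<cdot> Plus C g n = m \<cdot> Plus C h n"
      using comp_add_right[OF g n(1) m] comp_add_right[OF h n(1) m] eq by simp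
    then have "m \<cdot> Plus C g n = Zero C T B"
      using n(2) comp_zero(1)[OF m] arrows_objects[OF g] by simp
    then show ?thesis
      using zero[OF plus_arrows[OF g n(1)]] negative_unique[OF g h n(1)] n(2) by blast
  qed
  moreover have "Dom C m = A" "m \<in> Arr C" using m by (auto simp: mem_arrows)
  ultimately show ?thesis by (simp add: is_mono_def)
qed

lemma is_monoD:
  assumes "is_mono C m" "m \<in> arrows C A B" "g \<in> arrows C T A" "h \<in> arrows C T A" "m \<cdot> g = m \<cdot> h"
  shows "g = h"
proof -
  have "Dom C m = A" using assms(2) by (simp add: mem_arrows)
  then show ?thesis using assms unfolding is_mono_def by blast
qed

lemma is_epiD:
  assumes "is_epi C e" "e \<in> arrows C A B" "g \<in> arrows C B T" "h \<in> arrows C B T" "g \<cdot> e = h \<cdot> e"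
  shows "g = h"
proof -
  have "Cod C e = B" using assms(2) by (simp add: mem_arrows)
  then show ?thesis using assms unfolding is_epi_def by blast
qed

end

context presented_functors
begin

text \<open>The arrows \<open>i\<close> and \<open>q\<close> of a kernel-cokernel pair are a monomorphism and an epimorphism. The
  pointwise kernel of \<open>q\<close> factors through \<open>i\<close>, so the elements that \<open>q\<close> kills are values of \<open>i\<close>.\<close>

lemma short_exact_iff_pointwise:
  assumes i: "i \<in> arrows modC L M" and q: "q \<in> arrows modC M N"
  shows "kernel_cokernel_pair modC i q \<longleftrightarrow> pointwise_inj i \<and> pointwise_exact i q \<and> pointwise_surj q"
proof
  assume "pointwise_inj i \<and> pointwise_exact i q \<and> pointwise_surj q"
  then show "kernel_cokernel_pair modC i q"
    using pointwise_exact_is_kernel[OF i q] pointwise_exact_is_cokernel[OF i q]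
    by (simp add: kernel_cokernel_pair_def)
next
  interpret D: preadditive_category modC using preadditive_mod .
  assume "kernel_cokernel_pair modC i q"
  then have ker: "is_kernel modC i q" and coker: "is_cokernel modC q i"
    by (auto simp: kernel_cokernel_pair_def)
  note i' = mod_arrow_Mod[OF i] and q' = mod_arrow_Mod[OF q]
  have dc: "TDom i = L" "TDom q = M" "TCod q = N" using i' q' by (auto simp: arrows_Mod)
  have qi: "Comp (Mod_cat C) q i = Zero (Mod_cat C) L N" using ker by (simp add: is_kernel_def dc)
  obtain L' j where j: "j \<in> arrows modC L' M" and ex: "pointwise_exact j q"
    using ex_pointwise_kernel[OF q] .
  note j' = mod_arrow_Mod[OF j]
  have "Comp (Mod_cat C) q j = Zero (Mod_cat C) L' N"
    unfolding Comp_mod_eq_zero_iff[OF j' q']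
    using pointwise_exactD[OF ex j' q'] transf_closed[OF j'] by blast
  then have "\<exists>!h. h \<in> arrows modC L' L \<and> Comp (Mod_cat C) i h = j"
    using ker j by (simp add: is_kernel_def dc)
  then obtain h where h: "h \<in> arrows modC L' L" "Comp (Mod_cat C) i h = j" by blast
  note h' = mod_arrow_Mod[OF h(1)]
  have "pointwise_exact i q"
  proof (rule pointwise_exactI[OF i' q'])
    show "TMap q X (TMap i X x) = \<one>\<^bsub>FOb N X\<^esub>" if "X \<in> Ob C" "x \<in> carrier (FOb L X)" for X x
      using qi[unfolded Comp_mod_eq_zero_iff[OF i' q']] that by blast
    fix X y assume X: "X \<in> Ob C" and y: "y \<in> carrier (FOb M X)" and "TMap q X y = \<one>\<^bsub>FOb N X\<^esub>"
    then obtain x where x: "x \<in> carrier (FOb L' X)" "y = TMap j X x"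
      using pointwise_exactD[OF ex j' q' X y] by blast
    then have "y = TMap i X (TMap h X x)"
      using Comp_Mod_apply[OF h' X x(1), of i] h(2) by simp
    then show "\<exists>x\<in>carrier (FOb L X). y = TMap i X x"
      using transf_closed[OF h' X x(1)] by blast
  qed
  then show "pointwise_inj i \<and> pointwise_exact i q \<and> pointwise_surj q"
    using D.kernel_is_mono[OF ker] D.cokernel_is_epi[OF coker]
      is_mono_iff_pointwise_inj[OF i] is_epi_iff_pointwise_surj[OF q] by blast
qed

lemma iso_pointwise_bij:
  assumes "is_iso modC t" and t: "t \<in> arrows modC M N" and X: "X \<in> Ob C"
  shows "bij_betw (TMap t X) (carrier (FOb M X)) (carrier (FOb N X))"
proof -
  note t' = mod_arrow_Mod[OF t]
  have dc: "TDom t = M" "TCod t = N" using t' by (auto simp: arrows_Mod)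
  obtain s where s: "s \<in> arrows modC N M" and st: "Comp (Mod_cat C) s t = Ident (Mod_cat C) M"
    and ts: "Comp (Mod_cat C) t s = Ident (Mod_cat C) N"
    using assms(1) by (auto simp: is_iso_def dc)
  note s' = mod_arrow_Mod[OF s]
  show ?thesis
  proof (rule bij_betw_byWitness[of _ "TMap s X"])
    show "\<forall>x\<in>carrier (FOb M X). TMap s X (TMap t X x) = x"
      using Comp_Mod_apply[OF t' X, of _ s] X st by simp
    show "\<forall>y\<in>carrier (FOb N X). TMap t X (TMap s X y) = y"
      using Comp_Mod_apply[OF s' X, of _ t] X ts by simp
  qed (use transf_closed[OF t' X] transf_closed[OF s' X] in auto)
qed

text \<open>The functor presented by a zero arrow into \<open>B\<close> is a copy of \<open>Hom(-, B)\<close> in the universe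
  \<open>'v\<close>, in which the generator plays the role of the identity of \<open>B\<close>.\<close>

definition represents :: "('o, 'm, 'v) funct \<Rightarrow> 'o \<Rightarrow> 'v \<Rightarrow> bool" where
  "represents R B r \<longleftrightarrow> B \<in> Ob C \<and> presents R (Zero C B B) r"

lemma ex_representing:
  assumes "B \<in> Ob C"
  obtains R :: "('o, 'm, 'v) funct" and r where "represents R B r"
proof -
  obtain R :: "('o, 'm, 'v) funct" and r where "presents R (Zero C B B) r"
    using ex_functor[OF zero_arrows[OF assms assms]] .
  with assms that show thesis by (simp add: represents_def)
qed

lemma represents_presents:
  assumes "represents R B r"
  shows "presents R (Zero C B B) r" "Zero C B B \<in> arrows C B B" "B \<in> Ob C"
  using assms zero_arrows by (auto simp: represents_def)

lemma represents_relations: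
  assumes R: "represents R B r" and v: "v \<in> arrows C X B"
  shows "FArr R v r = \<one>\<^bsub>FOb R X\<^esub> \<longleftrightarrow> v = Zero C X B"
proof -
  note p = represents_presents[OF R]
  have X: "X \<in> Ob C" using arrows_objects[OF v] by simp
  have "(\<exists>w\<in>arrows C X B. v = Zero C B B \<cdot> w) \<longleftrightarrow> v = Zero C X B"
    using comp_zero(2)[of _ X B B] p(3) zero_arrows[OF X p(3)] by metis
  then show ?thesis using presents_relations[OF p(1,2) v] by simp
qed

lemma ex_transf_of_representing:
  assumes R: "represents R B r" and N: "contravariant_additive C N" and n: "n \<in> carrier (FOb N B)"
  obtains t where "t \<in> arrows (Mod_cat C) R N" "TMap t B r = n"
    "\<forall>X. \<forall>v\<in>arrows C X B. TMap t X (FArr R v r) = FArr N v n"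
proof -
  note p = represents_presents[OF R]
  obtain t where t: "t \<in> arrows (Mod_cat C) R N" "TMap t B r = n"
    using ex_transf_of_generator[OF p(1,2) N n functor_zero[OF N p(3,3) n]] .
  show thesis using that[OF t] transf_at_generated[OF p(1,2) t(1)] t(2) by simp
qed

text \<open>Epimorphisms are pointwise onto, so the value at the generator lifts; and an arrow out of a
  representable functor is freely determined by this value.\<close>

lemma represents_projective:
  assumes R: "represents R B r"
  shows "is_projective modC R"
  unfolding is_projective_def
proof (intro conjI allI impI ballI)
  note p = represents_presents[OF R]
  note r = presents_generator[OF p(1,2)]
  show "R \<in> Ob modC" using presents_fp[OF p(1)] by (simp add: Ob_mod)
  fix e f assume epi: "is_epi modC e" and "f \<in> arrows modC R (Cod modC e)"
  define M N where "M = TDom e" and "N = TCod e"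
  have e: "e \<in> arrows modC M N" using epi by (simp add: is_epi_def Arr_mod M_def N_def)
  have f: "f \<in> arrows modC R N" using \<open>f \<in> _\<close> by (simp add: N_def)
  note e' = mod_arrow_Mod[OF e] and f' = mod_arrow_Mod[OF f]
  have surj: "pointwise_surj e" using epi is_epi_iff_pointwise_surj[OF e] by simp
  obtain y where y: "y \<in> carrier (FOb M B)" "TMap e B y = TMap f B r"
    using pointwise_surjD[OF surj e' p(3) transf_closed[OF f' p(3) r]] .
  obtain g where g: "g \<in> arrows (Mod_cat C) R M" "TMap g B r = y"
    using ex_transf_of_representing[OF R transf_functors(1)[OF e'] y(1)] .
  have "Comp (Mod_cat C) e g = f"
    using transf_eq_generator[OF p(1,2) Comp_Mod_arrow[OF g(1) e'] f']
      Comp_Mod_apply[OF g(1) p(3) r] g(2) y(2) by simp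
  moreover have "g \<in> arrows modC R M" using g(1) e f by (simp add: arrows_mod)
  ultimately show "\<exists>g\<in>arrows modC R (Dom modC e). Comp modC e g = f"
    by (auto simp: M_def)
qed

text \<open>The generator of \<open>P\<close> defines an epimorphism from a representable functor, along which the
  identity of \<open>P\<close> lifts.\<close>

lemma projective_retract:
  assumes P: "is_projective modC P"
  obtains R B r e s where "represents R B r" "e \<in> arrows (Mod_cat C) R P" "s \<in> arrows (Mod_cat C) P R"
    "\<And>X x. \<lbrakk>X \<in> Ob C; x \<in> carrier (FOb P X)\<rbrakk> \<Longrightarrow> TMap e X (TMap s X x) = x"
proof -
  have fp: "finitely_presented C P" using P by (simp add: is_projective_def Ob_mod)
  obtain f A B m where pr: "presents P f m" and f: "f \<in> arrows C A B"
    using fp_presents[OF fp] .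
  note Pf = presents_functor[OF pr] and m = presents_generator[OF pr f]
  have B: "B \<in> Ob C" using arrows_objects[OF f] by simp
  obtain R :: "('o, 'm, 'v) funct" and r where R: "represents R B r" using ex_representing[OF B] .
  obtain e where e: "e \<in> arrows (Mod_cat C) R P" and "TMap e B r = m"
    and ev: "\<forall>X. \<forall>v\<in>arrows C X B. TMap e X (FArr R v r) = FArr P v m"
    using ex_transf_of_representing[OF R Pf m] .
  note p = represents_presents[OF R]
  have em: "e \<in> arrows modC R P" using e fp presents_fp[OF p(1)] by (simp add: arrows_mod)
  have "pointwise_surj e"
  proof (rule pointwise_surjI[OF e])
    fix X x assume X: "X \<in> Ob C" and x: "x \<in> carrier (FOb P X)"
    obtain v where v: "v \<in> arrows C X B" "x = FArr P v m" using presents_generates[OF pr f X x] .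
    then show "\<exists>y\<in>carrier (FOb R X). x = TMap e X y"
      using ev v(1) functor_closed[OF presents_functor[OF p(1)] v(1) presents_generator[OF p(1,2)]]
      by metis
  qed
  then have epi: "is_epi modC e" using is_epi_iff_pointwise_surj[OF em] by simp
  have dc: "TDom e = R" "TCod e = P" using e by (auto simp: arrows_Mod)
  have "Ident modC P \<in> arrows modC P (Cod modC e)"
    using Ident_Mod_arrow[OF Pf] fp by (simp add: arrows_mod dc)
  then have "\<exists>s\<in>arrows modC P (Dom modC e). Comp modC e s = Ident modC P"
    using P epi unfolding is_projective_def by blast
  then obtain s where s: "s \<in> arrows modC P R" "Comp (Mod_cat C) e s = Ident (Mod_cat C) P"
    by (auto simp: dc)
  note s' = mod_arrow_Mod[OF s(1)]
  have "TMap e X (TMap s X x) = x" if "X \<in> Ob C" "x \<in> carrier (FOb P X)" for X x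
    using Comp_Mod_apply[OF s' that, of e] s(2) that by simp
  then show thesis using that[OF R e s'] by blast
qed

text \<open>Representable functors turn a cokernel into a kernel, and so do their retracts.\<close>

lemma projective_left_exact:
  assumes P: "is_projective modC P" and coker: "is_cokernel C p k"
    and k: "k \<in> arrows C D A" and p: "p \<in> arrows C A B"
  shows "\<lbrakk>y \<in> carrier (FOb P B); FArr P p y = \<one>\<^bsub>FOb P A\<^esub>\<rbrakk> \<Longrightarrow> y = \<one>\<^bsub>FOb P B\<^esub>"
    and "\<lbrakk>z \<in> carrier (FOb P A); FArr P k z = \<one>\<^bsub>FOb P D\<^esub>\<rbrakk> \<Longrightarrow> \<exists>w\<in>carrier (FOb P B). z = FArr P p w"
proof -
  obtain R G r e s where R: "represents R G r" and e: "e \<in> arrows (Mod_cat C) R P"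
    and s: "s \<in> arrows (Mod_cat C) P R"
    and es: "\<And>X x. \<lbrakk>X \<in> Ob C; x \<in> carrier (FOb P X)\<rbrakk> \<Longrightarrow> TMap e X (TMap s X x) = x"
    using projective_retract[OF P] by blast
  note pr = represents_presents[OF R]
  note Rf = presents_functor[OF pr(1)] and r = presents_generator[OF pr(1,2)]
  have ob: "A \<in> Ob C" "B \<in> Ob C" "D \<in> Ob C" using arrows_objects[OF p] arrows_objects[OF k] by auto
  {
    assume y: "y \<in> carrier (FOb P B)" and py: "FArr P p y = \<one>\<^bsub>FOb P A\<^esub>"
    obtain v where v: "v \<in> arrows C B G" "TMap s B y = FArr R v r"
      using presents_generates[OF pr(1,2) ob(2) transf_closed[OF s ob(2) y]] .
    have "FArr R (v \<cdot> p) r = TMap s A (FArr P p y)"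
      using functor_comp[OF Rf p v(1) r] transf_natural[OF s p y] v(2) by simp
    also have "\<dots> = \<one>\<^bsub>FOb R A\<^esub>" using py transf_one[OF s ob(1)] by simp
    finally have "v \<cdot> p = Zero C B G \<cdot> p"
      using represents_relations[OF R comp[OF p v(1)]] comp_zero(2)[OF p pr(3)] by simp
    then have "v = Zero C B G"
      using is_epiD[OF cokernel_is_epi[OF coker] p v(1)] zero_arrows[OF ob(2) pr(3)] by blast
    then have "TMap s B y = \<one>\<^bsub>FOb R B\<^esub>" using represents_relations[OF R v(1)] v(2) by simp
    then show "y = \<one>\<^bsub>FOb P B\<^esub>" using es[OF ob(2) y] transf_one[OF e ob(2)] by simp
  next
    assume z: "z \<in> carrier (FOb P A)" and kz: "FArr P k z = \<one>\<^bsub>FOb P D\<^esub>"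
    obtain v where v: "v \<in> arrows C A G" "TMap s A z = FArr R v r"
      using presents_generates[OF pr(1,2) ob(1) transf_closed[OF s ob(1) z]] .
    have "FArr R (v \<cdot> k) r = TMap s D (FArr P k z)"
      using functor_comp[OF Rf k v(1) r] transf_natural[OF s k z] v(2) by simp
    also have "\<dots> = \<one>\<^bsub>FOb R D\<^esub>" using kz transf_one[OF s ob(3)] by simp
    finally have "v \<cdot> k = Zero C D G"
      using represents_relations[OF R comp[OF k v(1)]] by simp
    moreover have "Cod C k = A" "Dom C k = D" "Cod C p = B" using k p by (auto simp: mem_arrows)
    ultimately obtain w where w: "w \<in> arrows C B G" "w \<cdot> p = v"
      using coker v(1) unfolding is_cokernel_def by blast
    note wr = functor_closed[OF Rf w(1) r]
    have "z = TMap e A (FArr R p (FArr R w r))"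
      using es[OF ob(1) z] v(2) w(2) functor_comp[OF Rf p w(1) r] by simp
    also have "\<dots> = FArr P p (TMap e B (FArr R w r))" using transf_natural[OF e p wr] .
    finally show "\<exists>w\<in>carrier (FOb P B). z = FArr P p w"
      using transf_closed[OF e ob(2) wr] by blast
  }
qed

text \<open>As \<open>m\<close> is a monomorphism, \<open>Hom(-, m)\<close> is pointwise injective, and the presentation
  is already a projective resolution of length one.\<close>

lemma coker_of_mono_proj_dim_le_1:
  assumes Q: "presents Q m c" and m: "m \<in> arrows C A B" and mono: "is_mono C m"
  shows "proj_dim_le modC 1 Q"
proof -
  note Qf = presents_functor[OF Q] and c = presents_generator[OF Q m]
  have ob: "A \<in> Ob C" "B \<in> Ob C" using arrows_objects[OF m] by auto
  obtain R :: "('o, 'm, 'v) funct" and r where R: "represents R A r" using ex_representing[OF ob(1)] .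
  obtain S :: "('o, 'm, 'v) funct" and s where S: "represents S B s" using ex_representing[OF ob(2)] .
  note Rp = represents_presents[OF R] and Sp = represents_presents[OF S]
  note Rf = presents_functor[OF Rp(1)] and r = presents_generator[OF Rp(1,2)]
  note Sf = presents_functor[OF Sp(1)] and s = presents_generator[OF Sp(1,2)]
  obtain i where i: "i \<in> arrows (Mod_cat C) R S" and "TMap i A r = FArr S m s"
    and i_gen: "\<forall>X. \<forall>v\<in>arrows C X A. TMap i X (FArr R v r) = FArr S v (FArr S m s)"
    using ex_transf_of_representing[OF R Sf functor_closed[OF Sf m s]] .
  obtain q where q: "q \<in> arrows (Mod_cat C) S Q" and "TMap q B s = c"
    and q_gen: "\<forall>X. \<forall>v\<in>arrows C X B. TMap q X (FArr S v s) = FArr Q v c"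
    using ex_transf_of_representing[OF S Qf c] .
  have qv: "TMap q X (FArr S v s) = FArr Q v c" if "v \<in> arrows C X B" for X v
    using q_gen that by blast
  have iv: "TMap i X (FArr R v r) = FArr S (m \<cdot> v) s" if "v \<in> arrows C X A" for X v
    using i_gen that functor_comp[OF Sf that m s] by simp
  have "pointwise_inj i"
  proof (rule pointwise_injI[OF i])
    fix X x assume X: "X \<in> Ob C" and x: "x \<in> carrier (FOb R X)" and ix: "TMap i X x = \<one>\<^bsub>FOb S X\<^esub>"
    obtain v where v: "v \<in> arrows C X A" "x = FArr R v r" using presents_generates[OF Rp(1,2) X x] .
    have "m \<cdot> v = m \<cdot> Zero C X A"
      using represents_relations[OF S comp[OF v(1) m]] iv[OF v(1)] v(2) ix comp_zero(1)[OF m X] by simp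
    then show "x = \<one>\<^bsub>FOb R X\<^esub>"
      using is_monoD[OF mono m v(1) zero_arrows[OF X ob(1)]] represents_relations[OF R v(1)] v(2) by simp
  qed
  moreover have "pointwise_exact i q"
  proof (rule pointwise_exactI[OF i q])
    fix X x assume X: "X \<in> Ob C" and x: "x \<in> carrier (FOb R X)"
    obtain v where v: "v \<in> arrows C X A" "x = FArr R v r" using presents_generates[OF Rp(1,2) X x] .
    then show "TMap q X (TMap i X x) = \<one>\<^bsub>FOb Q X\<^esub>"
      using iv[OF v(1)] qv[OF comp[OF v(1) m]] presents_relations[OF Q m comp[OF v(1) m]] by auto
  next
    fix X y assume X: "X \<in> Ob C" and y: "y \<in> carrier (FOb S X)" and qy: "TMap q X y = \<one>\<^bsub>FOb Q X\<^esub>"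
    obtain v where v: "v \<in> arrows C X B" "y = FArr S v s" using presents_generates[OF Sp(1,2) X y] .
    obtain w where w: "w \<in> arrows C X A" "v = m \<cdot> w"
      using presents_relations[OF Q m v(1)] qv[OF v(1)] v(2) qy by auto
    then show "\<exists>x\<in>carrier (FOb R X). y = TMap i X x"
      using iv[OF w(1)] v(2) functor_closed[OF Rf w(1) r] by metis
  qed
  moreover have "pointwise_surj q"
  proof (rule pointwise_surjI[OF q])
    fix X y assume X: "X \<in> Ob C" and y: "y \<in> carrier (FOb Q X)"
    obtain v where v: "v \<in> arrows C X B" "y = FArr Q v c" using presents_generates[OF Q m X y] .
    then show "\<exists>x\<in>carrier (FOb S X). y = TMap q X x"
      using qv[OF v(1)] functor_closed[OF Sf v(1) s] by metis
  qed
  moreover have iq: "i \<in> arrows modC R S" "q \<in> arrows modC S Q"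
    using i q presents_fp[OF Rp(1)] presents_fp[OF Sp(1)] presents_fp[OF Q] by (auto simp: arrows_mod)
  ultimately have "kernel_cokernel_pair modC i q" using short_exact_iff_pointwise by blast
  moreover have "TDom i = R" "TDom q = S" "TCod q = Q" using i q by (auto simp: arrows_Mod)
  ultimately show ?thesis
    using represents_projective[OF R] represents_projective[OF S] by auto
qed

end

section \<open>The torsion pair\<close>

context conflation_category
begin

lemma deflation_cokernel:
  assumes "deflation K p"
  obtains k where "is_kernel E k p" "is_cokernel E p k"
  using assms conflation unfolding deflation_def kernel_cokernel_pair_def by blast

lemma deflation_epi:
  assumes "deflation K p"
  shows "is_epi E p"
proof -
  obtain k where "is_cokernel E p k" using deflation_cokernel[OF assms] .
  then show ?thesis by (rule cokernel_is_epi)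
qed

lemma deflation_Arr: "deflation K p \<Longrightarrow> p \<in> Arr E"
  using deflation_epi by (simp add: is_epi_def)

end

text \<open>The deflation is the cokernel of the kernel of \<open>f\<close>. An arrow \<open>g\<close> killed by the induced
  arrow \<open>m\<close> becomes, after pulling the deflation \<open>p\<close> back along \<open>g\<close>, an arrow killed by \<open>f\<close>; this
  factors through the kernel of \<open>f\<close> and is killed by \<open>p\<close>. As the pulled back deflation is an
  epimorphism, \<open>g\<close> is zero.\<close>

lemma (in deflation_exact_category) ex_deflation_mono_factorization:
  assumes ker: "has_admissible_kernels E K" and f: "f \<in> arrows E A B"
  obtains I p m where "deflation K p" "p \<in> arrows E A I" "m \<in> arrows E I B" "is_mono E m" "f = m \<cdot> p"
proof -
  have f': "f \<in> Arr E" "Dom E f = A" "Cod E f = B" using f by (auto simp: mem_arrows)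
  obtain k where k: "is_kernel E k f" using ker f'(1) by (auto simp: has_admissible_kernels_def)
  then have "inflation K k" using ker by (auto simp: has_admissible_kernels_def)
  then obtain p where kp: "(k, p) \<in> K" by (auto simp: inflation_def)
  then have defl: "deflation K p" by (auto simp: deflation_def)
  have pk: "is_cokernel E p k" using conflation[OF kp] by (simp add: kernel_cokernel_pair_def)
  define D I where "D = Dom E k" and "I = Cod E p"
  have karr: "k \<in> arrows E D A" and fk: "f \<cdot> k = Zero E D B"
    and kuniv: "\<And>T g. \<lbrakk>g \<in> arrows E T A; f \<cdot> g = Zero E T B\<rbrakk> \<Longrightarrow> \<exists>!h. h \<in> arrows E T D \<and> k \<cdot> h = g"
    using k by (auto simp: is_kernel_def f' D_def mem_arrows)
  have kdc: "Dom E k = D" "Cod E k = A" using karr by (auto simp: mem_arrows)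
  have p: "p \<in> arrows E A I" and pk0: "p \<cdot> k = Zero E D I"
    and puniv: "\<And>T g. \<lbrakk>g \<in> arrows E A T; g \<cdot> k = Zero E D T\<rbrakk> \<Longrightarrow> \<exists>!h. h \<in> arrows E I T \<and> h \<cdot> p = g"
    using pk by (auto simp: is_cokernel_def kdc I_def mem_arrows)
  obtain m where m: "m \<in> arrows E I B" and mp: "m \<cdot> p = f" using puniv[OF f fk] by blast
  have I: "I \<in> Ob E" "B \<in> Ob E" using arrows_objects[OF m] by auto
  have "is_mono E m"
  proof (rule is_monoI[OF m])
    fix T g assume g: "g \<in> arrows E T I" and mg: "m \<cdot> g = Zero E T B"
    have "g \<in> Arr E" "Cod E g = Cod E p" using g by (auto simp: mem_arrows I_def)
    then obtain g' p' where pb: "is_pullback E p g g' p'" using R2_ex[OF defl] by blast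
    obtain P where g': "g' \<in> arrows E P A" and p': "p' \<in> arrows E P T" and comm: "p \<cdot> g' = g \<cdot> p'"
      using pullback_arrows[OF pb p g] .
    have P: "P \<in> Ob E" and T: "T \<in> Ob E" using arrows_objects[OF p'] by auto
    have "f \<cdot> g' = m \<cdot> (p \<cdot> g')" using assoc[OF g' p m] mp by simp
    also have "\<dots> = (m \<cdot> g) \<cdot> p'" using assoc[OF p' g m] comm by simp
    also have "\<dots> = Zero E P B" using mg comp_zero(2)[OF p' I(2)] by simp
    finally obtain h where h: "h \<in> arrows E P D" "k \<cdot> h = g'" using kuniv[OF g'] by blast
    have "g \<cdot> p' = p \<cdot> (k \<cdot> h)" using comm h(2) by simp
    also have "\<dots> = Zero E P I"
      using assoc[OF h(1) karr p] pk0 comp_zero(2)[OF h(1) I(1)] by simp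
    also have "\<dots> = Zero E T I \<cdot> p'" using comp_zero(2)[OF p' I(1)] by simp
    finally show "g = Zero E T I"
      using is_epiD[OF deflation_epi[OF R2_deflation[OF defl pb]] p' g zero_arrows[OF T I(1)]] by blast
  qed
  then show thesis using that[OF defl p m] mp by simp
qed

locale admissible_kernel_category = deflation_exact_category E K + presented_functors E u
  for E :: "('o, 'm) cat" (structure) and K :: "('m \<times> 'm) set" and u :: "'m \<Rightarrow> 'v" +
  assumes admissible: "has_admissible_kernels E K"
begin

lemma mem_eff: "M \<in> eff E K \<longleftrightarrow> (\<exists>p m. deflation K p \<and> presents M p m)"
proof
  assume "M \<in> eff E K"
  then obtain p where "contravariant_additive E M" "deflation K p"
    "funct_iso E M (coker_funct E (yoneda_map E p))"
    by (auto simp: eff_def Ob_mod finitely_presented_def)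
  then show "\<exists>p m. deflation K p \<and> presents M p m"
    using funct_iso_imp_presents[OF _ Arr_arrows[OF deflation_Arr]] by blast
next
  assume "\<exists>p m. deflation K p \<and> presents M p m"
  then obtain p m where p: "deflation K p" and pr: "presents M p m" by blast
  then show "M \<in> eff E K"
    using presents_imp_funct_iso[OF pr] presents_fp[OF pr] by (auto simp: eff_def Ob_mod)
qed

lemma replete_eff: "is_replete modC (eff E K)"
  unfolding is_replete_def
proof (intro conjI allI impI)
  show "eff E K \<subseteq> Ob modC" by (auto simp: eff_def)
  fix t assume "is_iso modC t \<and> Dom modC t \<in> eff E K"
  then have iso: "is_iso modC t" and "TDom t \<in> eff E K" by auto
  then obtain p m where p: "deflation K p" and pr: "presents (TDom t) p m" by (auto simp: mem_eff)
  have t: "t \<in> arrows modC (TDom t) (TCod t)" using iso by (simp add: is_iso_def Arr_mod)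
  show "Cod modC t \<in> eff E K"
    using presents_transport[OF pr presents_arrow[OF pr] mod_arrow_Mod[OF t]]
      iso_pointwise_bij[OF iso t] p by (auto simp: mem_eff)
qed

lemma mem_mod1:
  "M \<in> mod1 E \<longleftrightarrow> (\<exists>P Q i q. i \<in> arrows modC Q P \<and> q \<in> arrows modC P M \<and>
     is_projective modC P \<and> is_projective modC Q \<and>
     pointwise_inj i \<and> pointwise_exact i q \<and> pointwise_surj q)"
proof
  assume "M \<in> mod1 E"
  then obtain i q where iq: "kernel_cokernel_pair modC i q" and M: "TCod q = M"
    and proj: "is_projective modC (TDom q)" "is_projective modC (TDom i)"
    by (auto simp: mod1_def)
  have i: "i \<in> arrows modC (TDom i) (TDom q)" and q: "q \<in> arrows modC (TDom q) M"
    using iq M by (auto simp: kernel_cokernel_pair_def is_kernel_def mem_arrows)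
  then show "\<exists>P Q i q. i \<in> arrows modC Q P \<and> q \<in> arrows modC P M \<and>
     is_projective modC P \<and> is_projective modC Q \<and>
     pointwise_inj i \<and> pointwise_exact i q \<and> pointwise_surj q"
    using iq proj short_exact_iff_pointwise[OF i q] by blast
next
  assume "\<exists>P Q i q. i \<in> arrows modC Q P \<and> q \<in> arrows modC P M \<and>
     is_projective modC P \<and> is_projective modC Q \<and>
     pointwise_inj i \<and> pointwise_exact i q \<and> pointwise_surj q"
  then obtain P Q i q where i: "i \<in> arrows modC Q P" and q: "q \<in> arrows modC P M"
    and proj: "is_projective modC P" "is_projective modC Q"
    and ex: "pointwise_inj i \<and> pointwise_exact i q \<and> pointwise_surj q" by blast
  have "kernel_cokernel_pair modC i q" using short_exact_iff_pointwise[OF i q] ex by simp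
  moreover have "TDom i = Q" "TDom q = P" "TCod q = M" using i q by (auto simp: arrows_mod arrows_Mod)
  moreover have "M \<in> Ob modC" using q by (simp add: arrows_mod Ob_mod)
  ultimately show "M \<in> mod1 E" using proj by (auto simp: mod1_def)
qed

lemma replete_mod1: "is_replete modC (mod1 E)"
  unfolding is_replete_def
proof (intro conjI allI impI)
  show "mod1 E \<subseteq> Ob modC" by (auto simp: mod1_def)
  fix t assume "is_iso modC t \<and> Dom modC t \<in> mod1 E"
  then have iso: "is_iso modC t" and "TDom t \<in> mod1 E" by auto
  define M N where "M = TDom t" and "N = TCod t"
  have t: "t \<in> arrows modC M N" using iso by (simp add: is_iso_def Arr_mod M_def N_def)
  obtain P Q i q where i: "i \<in> arrows modC Q P" and q: "q \<in> arrows modC P M"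
    and proj: "is_projective modC P" "is_projective modC Q"
    and inj: "pointwise_inj i" and ex: "pointwise_exact i q" and surj: "pointwise_surj q"
    using \<open>TDom t \<in> mod1 E\<close> unfolding mem_mod1 M_def by blast
  note t' = mod_arrow_Mod[OF t] and i' = mod_arrow_Mod[OF i] and q' = mod_arrow_Mod[OF q]
  note bij = iso_pointwise_bij[OF iso t]
  let ?s = "Comp (Mod_cat E) t q"
  have s': "?s \<in> arrows (Mod_cat E) P N" using Comp_Mod_arrow[OF q' t'] .
  then have s: "?s \<in> arrows modC P N" using q t by (simp add: arrows_mod)
  have "pointwise_surj ?s"
  proof (rule pointwise_surjI[OF s'])
    fix X y assume X: "X \<in> Ob E" and y: "y \<in> carrier (FOb N X)"
    have "y \<in> TMap t X ` carrier (FOb M X)" using bij_betw_imp_surj_on[OF bij[OF X]] y by simp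
    then obtain x where x: "x \<in> carrier (FOb M X)" "TMap t X x = y" by blast
    obtain z where z: "z \<in> carrier (FOb P X)" "TMap q X z = x"
      using pointwise_surjD[OF surj q' X x(1)] .
    then show "\<exists>z\<in>carrier (FOb P X). y = TMap ?s X z"
      using Comp_Mod_apply[OF q' X z(1), of t] x(2) by metis
  qed
  moreover have "pointwise_exact i ?s"
  proof (rule pointwise_exactI[OF i' s'])
    fix X assume X: "X \<in> Ob E"
    have one: "TMap ?s X y = \<one>\<^bsub>FOb N X\<^esub> \<longleftrightarrow> TMap q X y = \<one>\<^bsub>FOb M X\<^esub>" if y: "y \<in> carrier (FOb P X)" for y
    proof -
      interpret h: group_hom "FOb M X" "FOb N X" "TMap t X" using transf_group_hom[OF t' X] .
      show ?thesis
        using Comp_Mod_apply[OF q' X y, of t] bij_betw_imp_inj_on[OF bij[OF X]]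
          transf_closed[OF q' X y] by (simp add: h.inj_on_one_iff) (metis h.hom_one)
    qed
    show "TMap ?s X (TMap i X x) = \<one>\<^bsub>FOb N X\<^esub>" if "x \<in> carrier (FOb Q X)" for x
      using one[OF transf_closed[OF i' X that]] pointwise_exactD[OF ex i' q' X transf_closed[OF i' X that]]
        that by blast
    show "\<exists>x\<in>carrier (FOb Q X). y = TMap i X x"
      if "y \<in> carrier (FOb P X)" "TMap ?s X y = \<one>\<^bsub>FOb N X\<^esub>" for y
      using one[OF that(1)] that(2) pointwise_exactD[OF ex i' q' X that(1)] by blast
  qed
  ultimately have "N \<in> mod1 E" using i s proj inj unfolding mem_mod1 by blast
  then show "Cod modC t \<in> mod1 E" by (simp add: N_def)
qed

text \<open>Let the deflation \<open>p\<close>, with kernel \<open>k\<close>, present the effaceable functor \<open>M\<close>, and resolve \<open>N\<close>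
  by projectives \<open>Q\<close> and \<open>P\<close>. The image in \<open>N\<close> of the generator of \<open>M\<close> lifts to an element \<open>y\<close> of
  \<open>P\<close>. As \<open>p\<close> kills the generator, \<open>P p y\<close> comes from an element \<open>z\<close> of \<open>Q\<close>, which \<open>k\<close> kills
  because \<open>Q\<close> embeds into \<open>P\<close>. Left exactness of \<open>Q\<close> makes \<open>z\<close> the restriction along \<open>p\<close> of some
  \<open>w\<close>, and left exactness of \<open>P\<close> shows that \<open>y\<close> is the image of \<open>w\<close>, hence zero in \<open>N\<close>.\<close>

lemma hom_eff_mod1_zero:
  assumes "M \<in> eff E K" and "N \<in> mod1 E" and t: "t \<in> arrows modC M N"
  shows "t = Zero modC M N"
proof -
  note t' = mod_arrow_Mod[OF t]
  obtain p m where defl: "deflation K p" and M: "presents M p m"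
    using assms(1) by (auto simp: mem_eff)
  obtain k where ker: "is_kernel E k p" and coker: "is_cokernel E p k"
    using deflation_cokernel[OF defl] .
  define A B D where "A = Dom E p" and "B = Cod E p" and "D = Dom E k"
  have p: "p \<in> arrows E A B" and k: "k \<in> arrows E D A" and pk: "p \<cdot> k = Zero E D B"
    using ker by (auto simp: is_kernel_def mem_arrows A_def B_def D_def)
  have ob: "A \<in> Ob E" "B \<in> Ob E" "D \<in> Ob E" using arrows_objects[OF p] arrows_objects[OF k] by auto
  note m = presents_generator[OF M p]
  obtain P Q i q where i: "i \<in> arrows modC Q P" and q: "q \<in> arrows modC P N"
    and proj: "is_projective modC P" "is_projective modC Q"
    and inj: "pointwise_inj i" and ex: "pointwise_exact i q" and surj: "pointwise_surj q"
    using assms(2) unfolding mem_mod1 by blast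
  note i' = mod_arrow_Mod[OF i] and q' = mod_arrow_Mod[OF q]
  note Pf = transf_functors(2)[OF i'] and Qf = transf_functors(1)[OF i']
  let ?x = "TMap t B m"
  have px: "FArr N p ?x = \<one>\<^bsub>FOb N A\<^esub>"
    using transf_natural[OF t' p m] presents_kills[OF M p] transf_one[OF t' ob(1)] by simp
  obtain y where y: "y \<in> carrier (FOb P B)" "TMap q B y = ?x"
    using pointwise_surjD[OF surj q' ob(2) transf_closed[OF t' ob(2) m]] .
  have py: "FArr P p y \<in> carrier (FOb P A)" using functor_closed[OF Pf p y(1)] .
  have "TMap q A (FArr P p y) = \<one>\<^bsub>FOb N A\<^esub>" using transf_natural[OF q' p y(1)] y(2) px by simp
  then obtain z where z: "z \<in> carrier (FOb Q A)" "FArr P p y = TMap i A z"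
    using pointwise_exactD[OF ex i' q' ob(1) py] by blast
  have "TMap i D (FArr Q k z) = FArr P (p \<cdot> k) y"
    using transf_natural[OF i' k z(1)] z(2) functor_comp[OF Pf k p y(1)] by simp
  also have "\<dots> = TMap i D \<one>\<^bsub>FOb Q D\<^esub>"
    using pk functor_zero[OF Pf ob(3,2) y(1)] transf_one[OF i' ob(3)] by simp
  finally have "FArr Q k z = \<one>\<^bsub>FOb Q D\<^esub>"
    using pointwise_injD[OF inj i' ob(3) functor_closed[OF Qf k z(1)]]
      group.is_monoid[OF comm_group.axioms(2)[OF functor_group[OF Qf ob(3)]]]
    by (metis monoid.one_closed)
  then obtain w where w: "w \<in> carrier (FOb Q B)" "z = FArr Q p w"
    using projective_left_exact(2)[OF proj(2) coker k p z(1)] by blast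
  note iw = transf_closed[OF i' ob(2) w(1)]
  interpret P: comm_group "FOb P B" using functor_group[OF Pf ob(2)] .
  interpret PA: comm_group "FOb P A" using functor_group[OF Pf ob(1)] .
  interpret h: group_hom "FOb P B" "FOb P A" "FArr P p"
    using functor_hom[OF Pf p] by unfold_locales
  let ?d = "y \<otimes>\<^bsub>FOb P B\<^esub> inv\<^bsub>FOb P B\<^esub> TMap i B w"
  have "FArr P p (TMap i B w) = FArr P p y" using transf_natural[OF i' p w(1)] w(2) z(2) by simp
  then have "FArr P p ?d = \<one>\<^bsub>FOb P A\<^esub>" using y(1) iw py by simp
  then have "?d = \<one>\<^bsub>FOb P B\<^esub>"
    using projective_left_exact(1)[OF proj(1) coker k p, of ?d] y(1) iw by simp
  then have "y = TMap i B w" using y(1) iw P.inv_solve_right'[of "\<one>\<^bsub>FOb P B\<^esub>" y "TMap i B w"] by simp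
  then have "TMap q B y = \<one>\<^bsub>FOb N B\<^esub>"
    using pointwise_exactD[OF ex i' q' ob(2) y(1)] w(1) by blast
  then show ?thesis
    using transf_eq_generator[OF M p t' Zero_Mod_arrow[OF transf_functors[OF t']]] y(2)
      Zero_Mod_apply[OF ob(2) m, of N] by simp
qed

text \<open>Factor the relation \<open>f\<close> of \<open>M\<close> as a deflation \<open>p\<close> followed by a monomorphism \<open>m\<close>. The
  cokernels of \<open>p\<close>, \<open>f = m \<cdot> p\<close> and \<open>m\<close> form an exact sequence, which is short exact because \<open>m\<close> is a
  monomorphism.\<close>

lemma ex_eff_mod1_sequence:
  assumes "M \<in> Ob modC"
  shows "\<exists>j q. kernel_cokernel_pair modC j q \<and> Cod modC j = M \<and> Dom modC j \<in> eff E K \<and> Cod modC q \<in> mod1 E"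
proof -
  obtain f A B x where M: "presents M f x" and f: "f \<in> arrows E A B"
    using fp_presents[OF assms[unfolded Ob_mod]] .
  obtain I p m where defl: "deflation K p" and p: "p \<in> arrows E A I" and m: "m \<in> arrows E I B"
    and mono: "is_mono E m" and fmp: "f = m \<cdot> p"
    using ex_deflation_mono_factorization[OF admissible f] .
  have I: "I \<in> Ob E" using arrows_objects[OF p] by simp
  obtain T :: "('o, 'm, 'v) funct" and y where T: "presents T p y" using ex_functor[OF p] .
  obtain Q :: "('o, 'm, 'v) funct" and c where Q: "presents Q m c" using ex_functor[OF m] .
  note Mf = presents_functor[OF M] and x = presents_generator[OF M f]
  note Tf = presents_functor[OF T] and y = presents_generator[OF T p]
  note Qf = presents_functor[OF Q] and c = presents_generator[OF Q m]
  have "FArr M p (FArr M m x) = \<one>\<^bsub>FOb M A\<^esub>"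
    using functor_comp[OF Mf p m x] presents_kills[OF M f] fmp by simp
  then obtain j where j: "j \<in> arrows (Mod_cat E) T M" and jy: "TMap j I y = FArr M m x"
    using ex_transf_of_generator[OF T p Mf functor_closed[OF Mf m x]] by blast
  have jv: "TMap j X (FArr T v y) = FArr M (m \<cdot> v) x" if "v \<in> arrows E X I" for X v
    using transf_at_generated[OF T p j that] jy functor_comp[OF Mf that m x] by simp
  have "FArr Q f c = \<one>\<^bsub>FOb Q A\<^esub>"
    using functor_comp[OF Qf p m c] presents_kills[OF Q m] functor_one[OF Qf p] fmp by simp
  then obtain q where q: "q \<in> arrows (Mod_cat E) M Q" and qx: "TMap q B x = c"
    using ex_transf_of_generator[OF M f Qf c] by blast
  have qv: "TMap q X (FArr M v x) = FArr Q v c" if "v \<in> arrows E X B" for X v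
    using transf_at_generated[OF M f q that] qx by simp
  have "pointwise_inj j"
  proof (rule pointwise_injI[OF j])
    fix X e assume X: "X \<in> Ob E" and e: "e \<in> carrier (FOb T X)" and je: "TMap j X e = \<one>\<^bsub>FOb M X\<^esub>"
    obtain v where v: "v \<in> arrows E X I" "e = FArr T v y" using presents_generates[OF T p X e] .
    obtain w where w: "w \<in> arrows E X A" "m \<cdot> v = f \<cdot> w"
      using presents_relations[OF M f comp[OF v(1) m]] jv[OF v(1)] v(2) je by auto
    have "m \<cdot> v = m \<cdot> (p \<cdot> w)" using w(2) fmp assoc[OF w(1) p m] by simp
    then have "v = p \<cdot> w" by (rule is_monoD[OF mono m v(1) comp[OF w(1) p]])
    then show "e = \<one>\<^bsub>FOb T X\<^esub>" using presents_relations[OF T p v(1)] v(2) w(1) by blast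
  qed
  moreover have "pointwise_exact j q"
  proof (rule pointwise_exactI[OF j q])
    fix X e assume X: "X \<in> Ob E" and e: "e \<in> carrier (FOb T X)"
    obtain v where v: "v \<in> arrows E X I" "e = FArr T v y" using presents_generates[OF T p X e] .
    then show "TMap q X (TMap j X e) = \<one>\<^bsub>FOb Q X\<^esub>"
      using jv[OF v(1)] qv[OF comp[OF v(1) m]] presents_relations[OF Q m comp[OF v(1) m]] by auto
  next
    fix X e assume X: "X \<in> Ob E" and e: "e \<in> carrier (FOb M X)" and qe: "TMap q X e = \<one>\<^bsub>FOb Q X\<^esub>"
    obtain v where v: "v \<in> arrows E X B" "e = FArr M v x" using presents_generates[OF M f X e] .
    obtain w where w: "w \<in> arrows E X I" "v = m \<cdot> w"
      using presents_relations[OF Q m v(1)] qv[OF v(1)] v(2) qe by auto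
    then show "\<exists>e'\<in>carrier (FOb T X). e = TMap j X e'"
      using jv[OF w(1)] v(2) functor_closed[OF Tf w(1) y] by metis
  qed
  moreover have "pointwise_surj q"
  proof (rule pointwise_surjI[OF q])
    fix X e assume X: "X \<in> Ob E" and e: "e \<in> carrier (FOb Q X)"
    obtain v where v: "v \<in> arrows E X B" "e = FArr Q v c" using presents_generates[OF Q m X e] .
    then show "\<exists>e'\<in>carrier (FOb M X). e = TMap q X e'"
      using qv[OF v(1)] functor_closed[OF Mf v(1) x] by metis
  qed
  moreover have "j \<in> arrows modC T M" "q \<in> arrows modC M Q"
    using j q presents_fp[OF T] presents_fp[OF M] presents_fp[OF Q] by (auto simp: arrows_mod)
  ultimately have "kernel_cokernel_pair modC j q" using short_exact_iff_pointwise by blast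
  moreover have "TDom j = T" "TCod j = M" "TCod q = Q" using j q by (auto simp: arrows_Mod)
  moreover have "T \<in> eff E K" using T defl by (auto simp: mem_eff)
  moreover have "Q \<in> mod1 E"
    using coker_of_mono_proj_dim_le_1[OF Q m mono] presents_fp[OF Q] by (simp add: mod1_def Ob_mod)
  ultimately show ?thesis by auto
qed

text \<open>Let \<open>t\<close> embed \<open>N\<close> into a functor \<open>M\<close> presented by a deflation \<open>p\<close>, and let \<open>b\<close> be an arrow
  between the generators that induces \<open>t\<close>. An arrow kills the generator of \<open>N\<close> if and only if its
  composite with \<open>b\<close> factors through \<open>p\<close>, so the pullback of \<open>p\<close> along \<open>b\<close> presents \<open>N\<close>.\<close>

lemma eff_subobject:
  assumes mono: "is_mono modC t" and "Cod modC t \<in> eff E K"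
  shows "Dom modC t \<in> eff E K"
proof -
  define N M where "N = TDom t" and "M = TCod t"
  have t: "t \<in> arrows modC N M" using mono by (simp add: is_mono_def Arr_mod M_def N_def)
  note t' = mod_arrow_Mod[OF t]
  have inj: "pointwise_inj t" using mono is_mono_iff_pointwise_inj[OF t] by simp
  obtain p x where defl: "deflation K p" and M: "presents M p x"
    using assms(2) by (auto simp: mem_eff M_def)
  define A B where "A = Dom E p" and "B = Cod E p"
  have p: "p \<in> arrows E A B" using presents_arrow[OF M] by (simp add: A_def B_def)
  have "finitely_presented E N" using t by (simp add: arrows_mod)
  then obtain g A' B' n where N: "presents N g n" and g: "g \<in> arrows E A' B'" by (rule fp_presents)
  note Mf = presents_functor[OF M] and x = presents_generator[OF M p]
  note Nf = presents_functor[OF N] and n = presents_generator[OF N g]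
  have B': "B' \<in> Ob E" using arrows_objects[OF g] by simp
  obtain b where b: "b \<in> arrows E B' B" and tn: "TMap t B' n = FArr M b x"
    using presents_generates[OF M p B' transf_closed[OF t' B' n]] .
  have "b \<in> Arr E" "Cod E b = Cod E p" using b by (auto simp: mem_arrows B_def)
  then obtain b' p' where pb: "is_pullback E p b b' p'" using R2_ex[OF defl] by blast
  obtain P where bP: "b' \<in> arrows E P A" and pP: "p' \<in> arrows E P B'" and comm: "p \<cdot> b' = b \<cdot> p'"
    using pullback_arrows[OF pb p b] .
  have "presents N p' n"
  proof (rule presents_same_relations[OF N g pP])
    fix X z assume z: "z \<in> arrows E X B'"
    have X: "X \<in> Ob E" using arrows_objects[OF z] by simp
    interpret h: group_hom "FOb N X" "FOb M X" "TMap t X" using transf_group_hom[OF t' X] .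
    have "(\<exists>w\<in>arrows E X A'. z = g \<cdot> w) \<longleftrightarrow> FArr N z n = \<one>\<^bsub>FOb N X\<^esub>"
      using presents_relations[OF N g z] by simp
    also have "\<dots> \<longleftrightarrow> TMap t X (FArr N z n) = \<one>\<^bsub>FOb M X\<^esub>"
      using pointwise_injD[OF inj t' X functor_closed[OF Nf z n] h.G.one_closed] h.hom_one by metis
    also have "\<dots> \<longleftrightarrow> FArr M (b \<cdot> z) x = \<one>\<^bsub>FOb M X\<^esub>"
      using transf_natural[OF t' z n] tn functor_comp[OF Mf z b x] by simp
    also have "\<dots> \<longleftrightarrow> (\<exists>w\<in>arrows E X A. b \<cdot> z = p \<cdot> w)"
      using presents_relations[OF M p comp[OF z b]] .
    also have "\<dots> \<longleftrightarrow> (\<exists>w\<in>arrows E X P. z = p' \<cdot> w)"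
    proof
      assume "\<exists>w\<in>arrows E X A. b \<cdot> z = p \<cdot> w"
      then obtain w where w: "w \<in> arrows E X A" "p \<cdot> w = b \<cdot> z" by auto
      obtain h where "h \<in> arrows E X P" "p' \<cdot> h = z"
        using pullback_lift[OF pb bP b w(1) z w(2)] by blast
      then show "\<exists>w\<in>arrows E X P. z = p' \<cdot> w" by auto
    next
      assume "\<exists>w\<in>arrows E X P. z = p' \<cdot> w"
      then obtain h where h: "h \<in> arrows E X P" "z = p' \<cdot> h" by blast
      have "b \<cdot> z = p \<cdot> (b' \<cdot> h)"
        using assoc[OF h(1) pP b] assoc[OF h(1) bP p] comm h(2) by simp
      then show "\<exists>w\<in>arrows E X A. b \<cdot> z = p \<cdot> w" using comp[OF h(1) bP] by blast
    qed
    finally show "(\<exists>w\<in>arrows E X A'. z = g \<cdot> w) \<longleftrightarrow> (\<exists>w\<in>arrows E X P. z = p' \<cdot> w)" .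
  qed
  then have "N \<in> eff E K" using R2_deflation[OF defl pb] by (auto simp: mem_eff)
  then show ?thesis by (simp add: N_def)
qed

end

theorem proposition7p8:
  fixes E :: "('o, 'm) cat" and K :: "('m \<times> 'm) set" and u :: "'m \<Rightarrow> 'v"
  assumes "deflation_exact_category E K"
    and "has_admissible_kernels E K"
    and "inj_on u (Arr E)"
  shows "hereditary_torsion_pair
           (mod_cat E :: (('o, 'm, 'v) funct, ('o, 'm, 'v) transf) cat) (eff E K) (mod1 E)"
proof -
  interpret deflation_exact_category E K using assms(1) .
  interpret admissible_kernel_category E K u
    by unfold_locales (use assms(2,3) in \<open>auto simp: has_admissible_kernels_def\<close>)
  show ?thesis
    by (intro hereditary_torsion_pair.intro torsion_pair.intro abelian_mod torsion_pair_axioms.intro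
        hereditary_torsion_pair_axioms.intro replete_eff replete_mod1 hom_eff_mod1_zero
        ex_eff_mod1_sequence eff_subobject)
qed

end
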